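(* The railway track initial value problem $$\dot{\bm{x}}(t)=\mathcal{A}\bm{x}(t)+\mathcal{F}(\bm{x}(t))+\mathcal{B}\bm{u}(t),\quad t>0,\qquad \bm{x}(0)=\bm{x}_0,$$ with the spaces and operators defined in the context, is input-to-state stable (ISS); that is, there exist $\beta\in\mathscr{KL}$ and $\gamma\in\mathscr{K}$ such that for all $\bm{x}_0\in\mathbb{X}$, all $\bm{u}\in PC(\mathbb{R}^+;\mathbb{U})$ and all $t>0$, the mild solution $\bm{x}(t)$ satisfies $$\|\bm{x}(t)\|\le\beta(\|\bm{x}_0\|,t)+\gamma\Big(\sup_{s\ge 0}\|\bm{u}(s)\|_{\mathbb{U}}\Big).$$
   Context: The constants $E, I, \rho, a, \ell, k, \alpha, \mu$ are positive and $C_d\ge 0$. All function spaces are real; the subscript $\xi$ denotes differentiation with respect to $\xi\in[0,\ell]$; $\mathbb{R}^+=[0,\infty)$. The state space is $\mathbb{X}=\big(H^2(0,\ell)\cap H^1_0(0,\ell)\big)\times L^2(0,\ell)$ with norm $\|(w,v)\|^2=\int_0^{\ell} EI\, w_{\xi\xi}^2+k w^2+\rho a\, v^2\, d\xi$. The input space is $\mathbb{U}=L^2(0,\ell)$, and $PC(\mathbb{R}^+;\mathbb{U})$ is the space of all bounded, piecewise continuous $\mathbb{U}$-valued functions on $\mathbb{R}^+$. Let $\mathcal{A}_0 w=w_{\xi\xi\xi\xi}$ with $D(\mathcal{A}_0)=\{w\in H^4(0,\ell): w(0)=w(\ell)=0,\ w_{\xi\xi}(0)=w_{\xi\xi}(\ell)=0\}$.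 The linear operator $\mathcal{A}$ is $$\mathcal{A}(w,v)=\Big(v,\,-\tfrac{1}{\rho a}\mathcal{A}_0(EI w+C_d v)-\tfrac{1}{\rho a}(\mu v+k w)\Big),$$ $$D(\mathcal{A})=\{(w,v)\in\mathbb{X}: v\in H^2(0,\ell)\cap H^1_0(0,\ell),\ EI w+C_d v\in D(\mathcal{A}_0)\};$$ it generates a strongly continuous semigroup $\mathcal{T}(t)$ on $\mathbb{X}$. Further, $\mathcal{B}\bm{u}=(0,\tfrac{1}{\rho a}\bm{u})$ for $\bm{u}\in\mathbb{U}$, and $\mathcal{F}(w,v)=(0,-\tfrac{\alpha}{\rho a}w^3)$ for $(w,v)\in\mathbb{X}$. Mild solution: a function $\bm{x}\in C([0,T];\mathbb{X})$ for every $T>0$ with $\bm{x}(t)=\mathcal{T}(t)\bm{x}_0+\int_0^t\mathcal{T}(t-s)\mathcal{F}(\bm{x}(s))ds+\int_0^t\mathcal{T}(t-s)\mathcal{B}\bm{u}(s)ds$ for all $t\ge 0$. For every $\bm{x}_0\in\mathbb{X}$ and $\bm{u}\in PC(\mathbb{R}^+;\mathbb{U})$ a unique such (global) mild solution exists. Comparison functions: $\mathscr{K}$ is the set of continuous, strictly increasing $\gamma:\mathbb{R}^+\to\mathbb{R}^+$ with $\gamma(0)=0$; $\mathscr{L}$ is the set of continuous, strictly decreasing $\gamma:\mathbb{R}^+\to\mathbb{R}^+$ with $\lim_{t\to\infty}\gamma(t)=0$; $\mathscr{KL}$ is the set of continuous $\beta:\mathbb{R}^+\times\mathbb{R}^+\to\mathbb{R}^+$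 with $\beta(\cdot,t)\in\mathscr{K}$ for all $t\ge 0$ and $\beta(r,\cdot)\in\mathscr{L}$ for all $r>0$. *)

theory Defs
  imports "HOL-Analysis.Analysis"
begin

definition square_integrable :: "(real \<Rightarrow> real) \<Rightarrow> bool" where
  "square_integrable f \<longleftrightarrow> f \<in> borel_measurable lborel \<and> integrable lborel (\<lambda>x. (f x)\<^sup>2)"

definition L2_rel :: "(real \<Rightarrow> real) \<Rightarrow> (real \<Rightarrow> real) \<Rightarrow> bool" where
  "L2_rel f g \<longleftrightarrow> square_integrable f \<and> square_integrable g \<and> (AE x in lborel. f x = g x)"

lemma square_integrable_zero: "square_integrable (\<lambda>x. 0)"
  by (simp add: square_integrable_def)

lemma square_integrable_scale:
  assumes "square_integrable f" shows "square_integrable (\<lambda>x. c * f x)"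
  using assms by (auto simp: square_integrable_def power_mult_distrib)

lemma square_integrable_mult:
  assumes "square_integrable f" "square_integrable g"
  shows "integrable lborel (\<lambda>x. f x * g x)"
proof (rule Bochner_Integration.integrable_bound)
  show "integrable lborel (\<lambda>x. (f x)\<^sup>2 + (g x)\<^sup>2)"
    using assms by (auto simp: square_integrable_def)
  show "(\<lambda>x. f x * g x) \<in> borel_measurable lborel"
    using assms by (auto simp: square_integrable_def)
  have "\<bar>p * q\<bar> \<le> p\<^sup>2 + q\<^sup>2" for p q :: real
  proof -
    have "2 * \<bar>p\<bar> * \<bar>q\<bar> \<le> p\<^sup>2 + q\<^sup>2"
      using sum_squares_bound[of "\<bar>p\<bar>" "\<bar>q\<bar>"] by simp
    moreover have "0 \<le> \<bar>p\<bar> * \<bar>q\<bar>" by simp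
    ultimately show ?thesis unfolding abs_mult by linarith
  qed
  then show "AE x in lborel. norm (f x * g x) \<le> norm ((f x)\<^sup>2 + (g x)\<^sup>2)"
    by (auto intro!: AE_I2)
qed

lemma square_integrable_add:
  assumes "square_integrable f" "square_integrable g"
  shows "square_integrable (\<lambda>x. f x + g x)"
proof -
  have "integrable lborel (\<lambda>x. (f x)\<^sup>2 + (g x)\<^sup>2 + 2 * (f x * g x))"
    using assms square_integrable_mult[OF assms]
    by (intro Bochner_Integration.integrable_add integrable_mult_right)
       (auto simp: square_integrable_def)
  then show ?thesis
    using assms by (auto simp: square_integrable_def power2_sum algebra_simps)
qed

lemma part_equivp_L2_rel: "part_equivp L2_rel"
proof (rule part_equivpI)
  show "\<exists>f. L2_rel f f"
    by (rule exI[of _ "\<lambda>x. 0"]) (simp add: L2_rel_def square_integrable_zero)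
  show "symp L2_rel"
    by (auto simp: symp_def L2_rel_def elim: AE_mp)
  show "transp L2_rel"
  proof (rule transpI)
    fix f g h assume *: "L2_rel f g" "L2_rel g h"
    then have "AE x in lborel. f x = g x" "AE x in lborel. g x = h x"
      by (auto simp: L2_rel_def)
    then have "AE x in lborel. f x = h x" by eventually_elim simp
    with * show "L2_rel f h" by (auto simp: L2_rel_def)
  qed
qed

quotient_type L2 = "real \<Rightarrow> real" / partial: L2_rel
  by (rule part_equivp_L2_rel)

instantiation L2 :: real_inner
begin

lift_definition zero_L2 :: L2 is "\<lambda>x. 0"
  by (simp add: L2_rel_def square_integrable_zero)

lift_definition plus_L2 :: "L2 \<Rightarrow> L2 \<Rightarrow> L2" is "\<lambda>f g x. f x + g x"
  by (auto simp: L2_rel_def intro: square_integrable_add)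

lift_definition scaleR_L2 :: "real \<Rightarrow> L2 \<Rightarrow> L2" is "\<lambda>c f x. c * f x"
  by (auto simp: L2_rel_def intro: square_integrable_scale)

lift_definition inner_L2 :: "L2 \<Rightarrow> L2 \<Rightarrow> real" is "\<lambda>f g. LINT x|lborel. f x * g x"
  by (auto simp: L2_rel_def square_integrable_def intro!: integral_cong_AE)

definition uminus_L2 :: "L2 \<Rightarrow> L2" where "uminus_L2 f = scaleR (-1) f"
definition minus_L2 :: "L2 \<Rightarrow> L2 \<Rightarrow> L2" where "minus_L2 f g = f + scaleR (-1) g"
definition norm_L2 :: "L2 \<Rightarrow> real" where "norm_L2 f = sqrt (inner f f)"
definition sgn_L2 :: "L2 \<Rightarrow> L2" where "sgn_L2 f = scaleR (inverse (norm f)) f"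
definition dist_L2 :: "L2 \<Rightarrow> L2 \<Rightarrow> real" where "dist_L2 f g = norm (f - g)"
definition uniformity_L2 :: "(L2 \<times> L2) filter" where
  "uniformity_L2 = (INF e\<in>{0<..}. principal {(x, y). dist x y < e})"
definition open_L2 :: "L2 set \<Rightarrow> bool" where
  "open_L2 U \<longleftrightarrow> (\<forall>x\<in>U. \<forall>\<^sub>F (x', y) in uniformity. x' = x \<longrightarrow> y \<in> U)"

instance
proof
  fix f g h :: L2 and c d :: real
  show "f + g + h = f + (g + h)"
    by transfer (auto simp: L2_rel_def algebra_simps intro: square_integrable_add)
  show "f + g = g + f"
    by transfer (auto simp: L2_rel_def algebra_simps intro: square_integrable_add)
  show "0 + f = f"
    by transfer (auto simp: L2_rel_def)
  show "- f + f = 0"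
    unfolding uminus_L2_def
    by transfer (auto simp: L2_rel_def square_integrable_zero)
  show "f - g = f + - g"
    by (simp add: minus_L2_def uminus_L2_def)
  show "c *\<^sub>R (f + g) = c *\<^sub>R f + c *\<^sub>R g"
    by transfer (auto simp: L2_rel_def algebra_simps intro!: square_integrable_add square_integrable_scale)
  show "(c + d) *\<^sub>R f = c *\<^sub>R f + d *\<^sub>R f"
    apply transfer
    subgoal for c d f
      using square_integrable_scale[of f "c + d"]
      by (auto simp: L2_rel_def algebra_simps intro!: square_integrable_add square_integrable_scale)
    done
  show "c *\<^sub>R d *\<^sub>R f = (c * d) *\<^sub>R f"
    apply transfer
    subgoal for c d f
      using square_integrable_scale[of f "c * d"]
      by (auto simp: L2_rel_def algebra_simps)
    done
  show "1 *\<^sub>R f = f"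
    by transfer (auto simp: L2_rel_def)
  show "dist f g = norm (f - g)" by (rule dist_L2_def)
  show "sgn f = scaleR (inverse (norm f)) f" by (simp add: sgn_L2_def)
  show "uniformity = (INF e\<in>{0<..}. principal {(x::L2, y). dist x y < e})"
    by (rule uniformity_L2_def)
  show "open U = (\<forall>x\<in>U. \<forall>\<^sub>F (x', y) in uniformity. x' = x \<longrightarrow> y \<in> U)" for U :: "L2 set"
    by (rule open_L2_def)
  show "inner f g = inner g f"
    by transfer (simp add: mult.commute)
  show "inner (f + g) h = inner f h + inner g h"
    by transfer (auto simp: L2_rel_def distrib_right intro!: Bochner_Integration.integral_add square_integrable_mult)
  show "inner (c *\<^sub>R f) g = c * inner f g"
    by transfer (simp add: mult.assoc)
  show "0 \<le> inner f f"
    by transfer simp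
  show "(inner f f = 0) = (f = 0)"
    apply transfer
    subgoal for f
      using integral_nonneg_eq_0_iff_AE[of lborel "\<lambda>x. f x * f x"] square_integrable_mult[of f f]
      by (auto simp: L2_rel_def square_integrable_zero)
    done
  show "norm f = sqrt (inner f f)" by (rule norm_L2_def)
qed

end

text \<open>The space $L^2(0,\ell)$ is realised as the closed subspace of $L^2(\mathbb{R})$ of the (classes of)
  functions vanishing almost everywhere outside $(0,\ell)$; extension by zero is an isometry, so the
  norm of type \<open>L2\<close> is the norm of $L^2(0,\ell)$ there.\<close>

definition L2_on :: "real \<Rightarrow> L2 set" where
  "L2_on l = {u. AE \<xi> in lborel. \<xi> \<notin> {0<..<l} \<longrightarrow> rep_L2 u \<xi> = 0}"

text \<open>Weak derivatives are taken against $C^1_c$ test functions, as is usual in one dimension (Brezis);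
  by mollification this agrees with $C^\infty_c$. Likewise \<open>H10\<close> below is the closure of $C^1_c$ in
  the $H^1$ norm. On \<open>L2_on l\<close> the weak derivative is unique when it exists.\<close>

definition C1c :: "real \<Rightarrow> (real \<Rightarrow> real) set" where
  "C1c l = {\<phi>. (\<forall>x. \<phi> differentiable at x) \<and> continuous_on UNIV (deriv \<phi>) \<and>
               closure {x. \<phi> x \<noteq> 0} \<subseteq> {0<..<l}}"

definition weak_derivative :: "real \<Rightarrow> L2 \<Rightarrow> L2 \<Rightarrow> bool" where
  "weak_derivative l u g \<longleftrightarrow> g \<in> L2_on l \<and>
     (\<forall>\<phi>\<in>C1c l. (LINT \<xi>:{0<..<l}|lborel. rep_L2 u \<xi> * deriv \<phi> \<xi>)
               = - (LINT \<xi>:{0<..<l}|lborel. rep_L2 g \<xi> * \<phi> \<xi>))"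

definition wderiv :: "real \<Rightarrow> L2 \<Rightarrow> L2" where
  "wderiv l u = (THE g. weak_derivative l u g)"

primrec sobolev :: "real \<Rightarrow> nat \<Rightarrow> L2 set" where
  "sobolev l 0 = L2_on l"
| "sobolev l (Suc m) = {u \<in> L2_on l. \<exists>g\<in>sobolev l m. weak_derivative l u g}"

definition H10 :: "real \<Rightarrow> L2 set" where
  "H10 l = {u \<in> sobolev l 1. \<forall>\<epsilon>>0. \<exists>\<phi>\<in>C1c l.
     sqrt ((norm (u - abs_L2 \<phi>))\<^sup>2 + (norm (wderiv l u - abs_L2 (deriv \<phi>)))\<^sup>2) < \<epsilon>}"

text \<open>Point values of an element of $H^1(0,\ell)$ are those of its continuous representative on
  $[0,\ell]$, which exists and is unique on that interval.\<close>

definition cont_rep :: "real \<Rightarrow> L2 \<Rightarrow> real \<Rightarrow> real" where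
  "cont_rep l u = (SOME g. continuous_on {0..l} g \<and>
     (AE \<xi> in lborel. \<xi> \<in> {0<..<l} \<longrightarrow> rep_L2 u \<xi> = g \<xi>))"

text \<open>The norm of the state space depends on real parameters and so cannot be the norm of a type.
  The notions below therefore refer to a linear subspace \<open>V\<close> carrying a norm \<open>N\<close>.\<close>

definition strongly_continuous_semigroup ::
  "'a::real_vector set \<Rightarrow> ('a \<Rightarrow> real) \<Rightarrow> (real \<Rightarrow> 'a \<Rightarrow> 'a) \<Rightarrow> bool" where
  "strongly_continuous_semigroup V N T \<longleftrightarrow>
     (\<forall>t\<ge>0. \<forall>x\<in>V. T t x \<in> V) \<and>
     (\<forall>t\<ge>0. \<forall>x\<in>V. \<forall>y\<in>V. T t (x + y) = T t x + T t y) \<and>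
     (\<forall>t\<ge>0. \<forall>c. \<forall>x\<in>V. T t (c *\<^sub>R x) = c *\<^sub>R T t x) \<and>
     (\<forall>t\<ge>0. \<exists>C. \<forall>x\<in>V. N (T t x) \<le> C * N x) \<and>
     (\<forall>x\<in>V. T 0 x = x) \<and>
     (\<forall>s\<ge>0. \<forall>t\<ge>0. \<forall>x\<in>V. T (s + t) x = T s (T t x)) \<and>
     (\<forall>x\<in>V. ((\<lambda>t. N (T t x - x)) \<longlongrightarrow> 0) (at_right 0))"

definition generates ::
  "'a::real_vector set \<Rightarrow> ('a \<Rightarrow> real) \<Rightarrow> 'a set \<Rightarrow> ('a \<Rightarrow> 'a) \<Rightarrow> (real \<Rightarrow> 'a \<Rightarrow> 'a) \<Rightarrow> bool" where
  "generates V N D A T \<longleftrightarrow> strongly_continuous_semigroup V N T \<and>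
     (\<forall>x\<in>V. \<forall>y\<in>V. ((\<lambda>t. N ((1 / t) *\<^sub>R (T t x - x) - y)) \<longlongrightarrow> 0) (at_right 0)
                     \<longleftrightarrow> x \<in> D \<and> A x = y)"

text \<open>This is \<open>has_integral\<close> of the library on \<open>{a..b}\<close>, with the norm of the type replaced by \<open>N\<close>.
  The integrands below are piecewise continuous with respect to \<open>N\<close>, for which this integral agrees
  with the Riemann and the Bochner integral.\<close>

definition has_integral_norm ::
  "'a::real_vector set \<Rightarrow> ('a \<Rightarrow> real) \<Rightarrow> (real \<Rightarrow> 'a) \<Rightarrow> 'a \<Rightarrow> real \<Rightarrow> real \<Rightarrow> bool" where
  "has_integral_norm V N f y a b \<longleftrightarrow> y \<in> V \<and>
     (\<forall>e>0. \<exists>\<gamma>. gauge \<gamma> \<and> (\<forall>\<D>. \<D> tagged_division_of {a..b} \<and> \<gamma> fine \<D> \<longrightarrow>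
        N ((\<Sum>(x, J)\<in>\<D>. measure lborel J *\<^sub>R f x) - y) < e))"

definition mild_solution ::
  "'a::real_vector set \<Rightarrow> ('a \<Rightarrow> real) \<Rightarrow> (real \<Rightarrow> 'a \<Rightarrow> 'a) \<Rightarrow> ('a \<Rightarrow> 'a) \<Rightarrow> ('u \<Rightarrow> 'a) \<Rightarrow>
   'a \<Rightarrow> (real \<Rightarrow> 'u) \<Rightarrow> (real \<Rightarrow> 'a) \<Rightarrow> bool" where
  "mild_solution V N T F B x0 u x \<longleftrightarrow>
     (\<forall>t\<ge>0. x t \<in> V) \<and>
     (\<forall>\<tau>>0. \<forall>t\<in>{0..\<tau>}. ((\<lambda>s. N (x s - x t)) \<longlongrightarrow> 0) (at t within {0..\<tau>})) \<and>
     (\<forall>t\<ge>0. \<exists>y z. has_integral_norm V N (\<lambda>s. T (t - s) (F (x s))) y 0 t \<and>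
                   has_integral_norm V N (\<lambda>s. T (t - s) (B (u s))) z 0 t \<and>
                   x t = T t x0 + y + z)"

definition state_space :: "real \<Rightarrow> (L2 \<times> L2) set" where
  "state_space l = (sobolev l 2 \<inter> H10 l) \<times> L2_on l"

definition state_norm :: "real \<Rightarrow> real \<Rightarrow> real \<Rightarrow> real \<Rightarrow> real \<Rightarrow> real \<Rightarrow> L2 \<times> L2 \<Rightarrow> real" where
  "state_norm E I \<rho> a l k = (\<lambda>(w, v).
     sqrt (LINT \<xi>:{0..l}|lborel. E * I * (rep_L2 ((wderiv l ^^ 2) w) \<xi>)\<^sup>2
                                + k * (rep_L2 w \<xi>)\<^sup>2 + \<rho> * a * (rep_L2 v \<xi>)\<^sup>2))"

definition dom_A0 :: "real \<Rightarrow> L2 set" where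
  "dom_A0 l = {w \<in> sobolev l 4. cont_rep l w 0 = 0 \<and> cont_rep l w l = 0 \<and>
     cont_rep l ((wderiv l ^^ 2) w) 0 = 0 \<and> cont_rep l ((wderiv l ^^ 2) w) l = 0}"

definition A0 :: "real \<Rightarrow> L2 \<Rightarrow> L2" where
  "A0 l w = (wderiv l ^^ 4) w"

definition dom_A :: "real \<Rightarrow> real \<Rightarrow> real \<Rightarrow> real \<Rightarrow> (L2 \<times> L2) set" where
  "dom_A E I l C\<^sub>d = {(w, v) \<in> state_space l. v \<in> sobolev l 2 \<inter> H10 l \<and>
     (E * I) *\<^sub>R w + C\<^sub>d *\<^sub>R v \<in> dom_A0 l}"

definition op_A ::
  "real \<Rightarrow> real \<Rightarrow> real \<Rightarrow> real \<Rightarrow> real \<Rightarrow> real \<Rightarrow> real \<Rightarrow> real \<Rightarrow> L2 \<times> L2 \<Rightarrow> L2 \<times> L2" where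
  "op_A E I \<rho> a l k \<mu> C\<^sub>d = (\<lambda>(w, v).
     (v, - (1 / (\<rho> * a)) *\<^sub>R A0 l ((E * I) *\<^sub>R w + C\<^sub>d *\<^sub>R v)
         - (1 / (\<rho> * a)) *\<^sub>R (\<mu> *\<^sub>R v + k *\<^sub>R w)))"

definition op_B :: "real \<Rightarrow> real \<Rightarrow> L2 \<Rightarrow> L2 \<times> L2" where
  "op_B \<rho> a u = (0, (1 / (\<rho> * a)) *\<^sub>R u)"

text \<open>The cube is square-integrable for \<open>(w, v)\<close> in the state space, since $w$ is then essentially bounded.\<close>

definition op_F :: "real \<Rightarrow> real \<Rightarrow> real \<Rightarrow> L2 \<times> L2 \<Rightarrow> L2 \<times> L2" where
  "op_F \<rho> a \<alpha> = (\<lambda>(w, v). (0, - (\<alpha> / (\<rho> * a)) *\<^sub>R abs_L2 (\<lambda>\<xi>. (rep_L2 w \<xi>) ^ 3)))"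

text \<open>Piecewise continuity: on each compact interval there are finitely many discontinuities, and all
  one-sided limits exist.\<close>

definition PC :: "'u::real_normed_vector set \<Rightarrow> (real \<Rightarrow> 'u) set" where
  "PC U = {u. (\<forall>t\<ge>0. u t \<in> U) \<and> bounded (u ` {0..}) \<and>
     (\<forall>\<tau>>0. \<exists>P. finite P \<and> continuous_on ({0..\<tau>} - P) u) \<and>
     (\<forall>t\<ge>0. \<exists>y. (u \<longlongrightarrow> y) (at_right t)) \<and>
     (\<forall>t>0. \<exists>y. (u \<longlongrightarrow> y) (at_left t))}"

definition class_K :: "(real \<Rightarrow> real) set" where
  "class_K = {\<gamma>. \<gamma> ` {0..} \<subseteq> {0..} \<and> continuous_on {0..} \<gamma> \<and> strict_mono_on {0..} \<gamma> \<and> \<gamma> 0 = 0}"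

definition class_L :: "(real \<Rightarrow> real) set" where
  "class_L = {\<gamma>. \<gamma> ` {0..} \<subseteq> {0..} \<and> continuous_on {0..} \<gamma> \<and>
     strict_antimono_on {0..} \<gamma> \<and> (\<gamma> \<longlongrightarrow> 0) at_top}"

definition class_KL :: "(real \<Rightarrow> real \<Rightarrow> real) set" where
  "class_KL = {\<beta>. (\<forall>r\<ge>0. \<forall>t\<ge>0. 0 \<le> \<beta> r t) \<and>
     continuous_on ({0..} \<times> {0..}) (\<lambda>(r, t). \<beta> r t) \<and>
     (\<forall>t\<ge>0. (\<lambda>r. \<beta> r t) \<in> class_K) \<and> (\<forall>r>0. \<beta> r \<in> class_L)}"

end

theory Submission
  imports Defs
begin

text \<open>Write \<open>Q(w, v)\<close> for the squared norm of \<open>(w, v)\<close> plus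
  \<open>\<epsilon> (2 \<rho> a \<langle>w, v\<rangle> + \<mu> \<parallel>w\<parallel>\<^sup>2 + C\<^sub>d \<parallel>w''\<parallel>\<^sup>2)\<close>. On the domain of \<open>A\<close> an integration by parts gives
  \<open>2 Q(x, A x) \<le> - c Q(x)\<close>, and by density the semigroup contracts \<open>Q\<close> at rate \<open>c\<close> on the whole space.
  A mild solution satisfies \<open>x(t + h) = T(h) x(t) + h f(t+) + o(h)\<close>, so that \<open>Q(x(t))\<close> obeys a
  differential inequality for right derivatives although \<open>x(t)\<close> need not lie in the domain. The first
  component satisfies \<open>w' = v\<close> in \<open>L2\<close>, because the first component of \<open>A (w, v)\<close> is \<open>v\<close>; hence the
  quartic term of the Lyapunov function \<open>Q + (\<alpha> / 2) \<integral> w^4\<close> cancels the indefinite contribution of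
  \<open>- \<alpha> w^3\<close>, and the function decays exponentially up to a multiple of \<open>sup \<parallel>u\<parallel>\<^sup>2\<close>.

  Local boundedness of the semigroup comes from uniform boundedness, hence from completeness of the
  state space, which in turn rests on \<open>\<parallel>w'\<parallel>\<^sup>2 \<le> \<parallel>w\<parallel> \<parallel>w''\<parallel>\<close> and the description of \<open>H10\<close> as the
  set of primitives of mean-zero functions.\<close>

section \<open>The Hilbert space \<open>L2\<close>\<close>

text \<open>The energy alone gives no rate: along \<open>A\<close> the derivative of the squared
  norm is -2 \<mu> |v|^2 - 2 \<open>C\<^sub>d\<close> |v''|^2, which does not see w. Differentiating
  2 \<epsilon> \<rho> a <w, v> supplies -2 \<epsilon> (E I |w''|^2 + k |w|^2), and the additions
  \<mu> |w|^2 and \<open>C\<^sub>d\<close> |w''|^2 are those whose derivatives cancel the mixed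
  products <w, v> and <w'', v''> arising with it. No smoothing enters, so
  \<open>C\<^sub>d = 0\<close> is included. Paired with - \<alpha> w^3 the same term yields -2
  \<epsilon> \<alpha> times the integral of w^4, so the quartic part decays too, at a rate
  independent of the size of the state. The semigroup is known only through
  \<open>generates\<close>: each \<open>T t\<close> is bounded separately and the generator is a
  right limit at 0. Uniform bounds, strong continuity, invariance and density of the domain are
  extracted from this. As inputs may jump, the forcing has only right limits. The quartic growth of
  the Lyapunov function in the norm becomes, after a square root, the quadratic term of the KL
  bound.\<close>

lemma L2_rel_refl: "L2_rel f f \<longleftrightarrow> square_integrable f"
  by (auto simp: L2_rel_def)

lemma square_integrable_rep_L2: "square_integrable (rep_L2 u)"
  using Quotient_rep_reflp[OF Quotient_L2] by (auto simp: L2_rel_def)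

lemma rep_L2_measurable [measurable]: "rep_L2 u \<in> borel_measurable borel"
  using square_integrable_rep_L2[of u] by (simp add: square_integrable_def)

lemma integrable_rep_L2_sq: "integrable lborel (\<lambda>x. (rep_L2 u x)\<^sup>2)"
  using square_integrable_rep_L2[of u] by (simp add: square_integrable_def)

lemma abs_L2_rep: "abs_L2 (rep_L2 u) = u"
  using Quotient_abs_rep[OF Quotient_L2] .

lemma abs_L2_eqI:
  assumes "square_integrable f" "square_integrable g" "AE x in lborel. f x = g x"
  shows "abs_L2 f = abs_L2 g"
  using assms Quotient_rel_abs[OF Quotient_L2] by (auto simp: L2_rel_def)

lemma AE_rep_abs_L2:
  assumes "square_integrable f"
  shows "AE x in lborel. rep_L2 (abs_L2 f) x = f x"
  using Quotient_rep_abs[OF Quotient_L2, of f] assms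
  by (auto simp: L2_rel_def)

lemma L2_eq_absI:
  assumes "square_integrable f" "AE x in lborel. rep_L2 u x = f x"
  shows "u = abs_L2 f"
  using abs_L2_eqI[OF square_integrable_rep_L2 assms] by (simp add: abs_L2_rep)

lemma AE_rep_add: "AE x in lborel. rep_L2 (u + v) x = rep_L2 u x + rep_L2 v x"
proof -
  have "u + v = abs_L2 (\<lambda>x. rep_L2 u x + rep_L2 v x)"
    using plus_L2.abs_eq[of "rep_L2 u" "rep_L2 v"] by (simp add: L2_rel_refl square_integrable_rep_L2 abs_L2_rep)
  then show ?thesis
    using AE_rep_abs_L2[of "\<lambda>x. rep_L2 u x + rep_L2 v x"] by (simp add: square_integrable_add square_integrable_rep_L2)
qed

lemma AE_rep_scale: "AE x in lborel. rep_L2 (c *\<^sub>R u) x = c * rep_L2 u x"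
proof -
  have "c *\<^sub>R u = abs_L2 (\<lambda>x. c * rep_L2 u x)"
    using scaleR_L2.abs_eq[of "rep_L2 u" c] by (simp add: L2_rel_refl square_integrable_rep_L2 abs_L2_rep)
  then show ?thesis
    using AE_rep_abs_L2[of "\<lambda>x. c * rep_L2 u x"] by (simp add: square_integrable_scale square_integrable_rep_L2)
qed

lemma AE_rep_diff: "AE x in lborel. rep_L2 (u - v) x = rep_L2 u x - rep_L2 v x"
  using AE_rep_add[of u "-1 *\<^sub>R v"] AE_rep_scale[of "-1" v]
  by eventually_elim simp

lemma inner_abs_L2:
  assumes "square_integrable f" "square_integrable g"
  shows "inner (abs_L2 f) (abs_L2 g) = (LINT x|lborel. f x * g x)"
  using inner_L2.abs_eq assms by (simp add: L2_rel_refl)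

lemma inner_rep_L2: "inner u v = (LINT x|lborel. rep_L2 u x * rep_L2 v x)"
  by (rule inner_L2.rep_eq)

lemma norm_sq_rep_L2: "(norm u)\<^sup>2 = (LINT x|lborel. (rep_L2 u x)\<^sup>2)"
  unfolding power2_norm_eq_inner by (simp add: inner_rep_L2 power2_eq_square)

lemma norm_sq_abs_L2:
  assumes "square_integrable f"
  shows "(norm (abs_L2 f))\<^sup>2 = (LINT x|lborel. (f x)\<^sup>2)"
  unfolding power2_norm_eq_inner by (simp add: inner_abs_L2 assms power2_eq_square)

lemma abs_L2_add:
  assumes "square_integrable f" "square_integrable g"
  shows "abs_L2 f + abs_L2 g = abs_L2 (\<lambda>x. f x + g x)"
  using plus_L2.abs_eq assms by (simp add: L2_rel_refl)

lemma abs_L2_scale: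
  assumes "square_integrable f"
  shows "c *\<^sub>R abs_L2 f = abs_L2 (\<lambda>x. c * f x)"
  using scaleR_L2.abs_eq assms by (simp add: L2_rel_refl)

lemma square_integrable_diff:
  assumes "square_integrable f" "square_integrable g"
  shows "square_integrable (\<lambda>x. f x - g x)"
  using square_integrable_add[OF assms(1) square_integrable_scale[OF assms(2), of "-1"]] by simp

lemma abs_L2_diff:
  assumes "square_integrable f" "square_integrable g"
  shows "abs_L2 f - abs_L2 g = abs_L2 (\<lambda>x. f x - g x)"
  using abs_L2_add[OF assms(1) square_integrable_scale[OF assms(2), of "-1"]]
    abs_L2_scale[OF assms(2), of "-1"]
  by (simp add: diff_conv_add_uminus del: add_uminus_conv_diff)

lemma square_integrable_bound:
  assumes "f \<in> borel_measurable borel" "square_integrable g" "AE x in lborel. \<bar>f x\<bar> \<le> \<bar>g x\<bar>"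
  shows "square_integrable f"
proof -
  have "integrable lborel (\<lambda>x. (f x)\<^sup>2)"
  proof (rule Bochner_Integration.integrable_bound)
    show "integrable lborel (\<lambda>x. (g x)\<^sup>2)" using assms by (simp add: square_integrable_def)
    show "AE x in lborel. norm ((f x)\<^sup>2) \<le> norm ((g x)\<^sup>2)"
      using assms(3) by eventually_elim (simp add: abs_le_square_iff)
  qed (use assms in measurable)
  then show ?thesis using assms by (simp add: square_integrable_def)
qed

lemma norm_abs_L2_mono:
  assumes "square_integrable f" "square_integrable g" "AE x in lborel. \<bar>f x\<bar> \<le> \<bar>g x\<bar>"
  shows "norm (abs_L2 f) \<le> norm (abs_L2 g)"
proof -
  have "(norm (abs_L2 f))\<^sup>2 \<le> (norm (abs_L2 g))\<^sup>2"
    unfolding norm_sq_abs_L2[OF assms(1)] norm_sq_abs_L2[OF assms(2)]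
    using assms by (intro integral_mono_AE) (auto simp: square_integrable_def abs_le_square_iff)
  then show ?thesis by simp
qed

text \<open>The weights \<open>2 ^ k\<close> make the subsequence of a sequence with \<open>\<parallel>x\<^sub>k\<^sub>+\<^sub>1 - x\<^sub>k\<parallel> \<le> 2 ^ - k\<close> converge
  geometrically at almost every point.\<close>

lemma L2_fast_Cauchy_convergent:
  fixes X :: "nat \<Rightarrow> L2"
  assumes fast: "\<And>k. norm (X (Suc k) - X k) \<le> (1/2)^k" and C: "Cauchy X"
  shows "convergent X"
proof -
  define f where "f k = rep_L2 (X k)" for k
  have [measurable]: "f k \<in> borel_measurable borel" for k by (simp add: f_def)
  have dist: "(\<integral>\<^sup>+x. ennreal ((f i x - f j x)\<^sup>2) \<partial>lborel) = ennreal ((norm (X i - X j))\<^sup>2)" for i j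
  proof -
    have "(\<integral>\<^sup>+x. ennreal ((f i x - f j x)\<^sup>2) \<partial>lborel) = (\<integral>\<^sup>+x. ennreal ((rep_L2 (X i - X j) x)\<^sup>2) \<partial>lborel)"
      using AE_rep_diff[of "X i" "X j"] by (intro nn_integral_cong_AE) (auto simp: f_def)
    also have "\<dots> = ennreal (LINT x|lborel. (rep_L2 (X i - X j) x)\<^sup>2)"
      by (intro nn_integral_eq_integral integrable_rep_L2_sq) auto
    finally show ?thesis by (simp add: norm_sq_rep_L2)
  qed
  let ?g = "\<lambda>k x. ennreal (2^k * (f (Suc k) x - f k x)\<^sup>2)"
  have "(\<integral>\<^sup>+x. (\<Sum>k. ?g k x) \<partial>lborel) = (\<Sum>k. \<integral>\<^sup>+x. ?g k x \<partial>lborel)"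
    by (intro nn_integral_suminf) measurable
  also have "\<dots> \<le> (\<Sum>k. ennreal ((1/2)^k))"
  proof (intro suminf_le allI)
    fix k
    have "(\<integral>\<^sup>+x. ?g k x \<partial>lborel) = ennreal (2^k) * (\<integral>\<^sup>+x. ennreal ((f (Suc k) x - f k x)\<^sup>2) \<partial>lborel)"
      by (subst nn_integral_cmult[symmetric]) (auto simp: ennreal_mult)
    also have "\<dots> = ennreal (2^k * (norm (X (Suc k) - X k))\<^sup>2)"
      by (simp add: dist ennreal_mult)
    also have "\<dots> \<le> ennreal (2^k * ((1/2)^k)\<^sup>2)"
      using fast[of k] by (intro ennreal_leI mult_left_mono power_mono) auto
    also have "2^k * ((1/2)^k)\<^sup>2 = (1/2::real)^k"
      by (simp add: power2_eq_square power_divide)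
    finally show "(\<integral>\<^sup>+x. ?g k x \<partial>lborel) \<le> ennreal ((1/2)^k)" .
  qed auto
  also have "\<dots> = ennreal (\<Sum>k. (1/2)^k)"
    by (intro suminf_ennreal2) (auto intro: summable_geometric)
  finally have "(\<integral>\<^sup>+x. (\<Sum>k. ?g k x) \<partial>lborel) \<noteq> \<infinity>"
    using ennreal_less_top le_less_trans by (metis infinity_ennreal_def less_irrefl)
  then have "AE x in lborel. (\<Sum>k. ?g k x) \<noteq> \<infinity>"
    by (intro nn_integral_PInf_AE) auto
  then have conv: "AE x in lborel. convergent (\<lambda>k. f k x)"
  proof eventually_elim
    case (elim x)
    have sm: "summable (\<lambda>k. 2^k * (f (Suc k) x - f k x)\<^sup>2)"
      using elim by (intro summable_suminf_not_top) auto
    define M where "M = (\<Sum>k. 2^k * (f (Suc k) x - f k x)\<^sup>2)"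
    have le: "2^k * (f (Suc k) x - f k x)\<^sup>2 \<le> M" for k
      unfolding M_def using sum_le_suminf[OF sm, of "{k}"] by auto
    have "M \<ge> 0" using le[of 0] by (smt (verit) mult_nonneg_nonneg zero_le_power2 zero_le_power)
    have b: "norm (f (Suc k) x - f k x) \<le> sqrt M * (1 / sqrt 2)^k" for k
    proof -
      have "(f (Suc k) x - f k x)\<^sup>2 \<le> M * (1/2)^k"
        using le[of k] by (simp add: field_simps power_divide)
      then have "sqrt ((f (Suc k) x - f k x)\<^sup>2) \<le> sqrt (M * (1/2)^k)"
        by (rule real_sqrt_le_mono)
      also have "\<dots> = sqrt M * (1 / sqrt 2)^k"
        by (simp add: real_sqrt_mult real_sqrt_power real_sqrt_divide)
      finally show ?thesis by simp
    qed
    have "summable (\<lambda>k. sqrt M * (1 / sqrt 2)^k)"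
      by (intro summable_mult summable_geometric) (auto simp: real_less_rsqrt)
    then have "summable (\<lambda>k. f (Suc k) x - f k x)"
      by (rule summable_comparison_test'[where N=0]) (use b in auto)
    then have "convergent (\<lambda>n. \<Sum>k<n. f (Suc k) x - f k x)"
      by (simp add: summable_iff_convergent)
    then have "convergent (\<lambda>n. (f n x - f 0 x) + f 0 x)"
      by (intro convergent_add convergent_const) (simp add: sum_lessThan_telescope[of "\<lambda>k. f k x"])
    then show ?case by simp
  qed
  define F where "F x = lim (\<lambda>k. f k x)" for x
  have [measurable]: "F \<in> borel_measurable borel" unfolding F_def by measurable
  have lim: "AE x in lborel. (\<lambda>k. f k x) \<longlonglongrightarrow> F x"
    using conv by eventually_elim (simp add: F_def convergent_LIMSEQ_iff)
  \<comment> \<open>\<open>F\<close> is not yet known to be square integrable, so the estimate is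
    made with nonnegative integrals; Fatou's lemma carries the Cauchy bound at index
    \<open>i\<close> over to \<open>F\<close>.\<close>
  have fatou: "(\<integral>\<^sup>+x. ennreal ((F x - f i x)\<^sup>2) \<partial>lborel) \<le> ennreal (e\<^sup>2)"
    if "\<And>j. j \<ge> i \<Longrightarrow> norm (X j - X i) \<le> e" for i e
  proof -
    have "(\<integral>\<^sup>+x. ennreal ((F x - f i x)\<^sup>2) \<partial>lborel)
        = (\<integral>\<^sup>+x. liminf (\<lambda>j. ennreal ((f j x - f i x)\<^sup>2)) \<partial>lborel)"
    proof (rule nn_integral_cong_AE)
      show "AE x in lborel. ennreal ((F x - f i x)\<^sup>2) = liminf (\<lambda>j. ennreal ((f j x - f i x)\<^sup>2))"
        using lim
      proof eventually_elim
        case (elim x)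
        have "(\<lambda>j. ennreal ((f j x - f i x)\<^sup>2)) \<longlonglongrightarrow> ennreal ((F x - f i x)\<^sup>2)"
          by (intro tendsto_intros elim)
        then show ?case
          by (rule lim_imp_Liminf[OF trivial_limit_sequentially, symmetric])
      qed
    qed
    also have "\<dots> \<le> liminf (\<lambda>j. \<integral>\<^sup>+x. ennreal ((f j x - f i x)\<^sup>2) \<partial>lborel)"
      by (intro nn_integral_liminf) measurable
    also have "\<dots> \<le> liminf (\<lambda>j. ennreal (e\<^sup>2))"
    proof (rule Liminf_mono)
      show "\<forall>\<^sub>F j in sequentially. (\<integral>\<^sup>+x. ennreal ((f j x - f i x)\<^sup>2) \<partial>lborel) \<le> ennreal (e\<^sup>2)"
        using eventually_ge_at_top[of i]
        by eventually_elim (use that in \<open>auto simp: dist intro!: ennreal_leI power_mono\<close>)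
    qed
    finally show ?thesis by (simp add: Liminf_const)
  qed
  have "\<forall>e>0. \<exists>i. \<forall>m\<ge>i. \<forall>n\<ge>i. norm (X m - X n) < e"
    using C by (simp add: Cauchy_iff)
  then obtain i0 where i0: "\<And>m. m \<ge> i0 \<Longrightarrow> norm (X m - X i0) \<le> 1"
    by (metis less_imp_le order_refl zero_less_one)
  have "integrable lborel (\<lambda>x. (F x - f i0 x)\<^sup>2)"
    unfolding integrable_iff_bounded using fatou[OF i0]
    by (auto simp: ennreal_one_less_top intro: le_less_trans)
  then have "square_integrable (\<lambda>x. (F x - f i0 x) + f i0 x)"
    by (intro square_integrable_add) (auto simp: square_integrable_def f_def integrable_rep_L2_sq)
  then have F: "square_integrable F" by simp
  have conv_le: "norm (abs_L2 F - X i) \<le> e" if e: "\<And>j. j \<ge> i \<Longrightarrow> norm (X j - X i) \<le> e" for i e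
  proof -
    have "e \<ge> 0" using e[of i] by simp
    have "abs_L2 F - X i = abs_L2 (\<lambda>x. F x - f i x)"
      using abs_L2_diff[OF F square_integrable_rep_L2[of "X i"]] by (simp add: f_def abs_L2_rep)
    then have "ennreal ((norm (abs_L2 F - X i))\<^sup>2) = (\<integral>\<^sup>+x. ennreal ((F x - f i x)\<^sup>2) \<partial>lborel)"
      using square_integrable_diff[OF F square_integrable_rep_L2[of "X i"]]
      by (simp add: norm_sq_abs_L2 f_def nn_integral_eq_integral square_integrable_def)
    also have "\<dots> \<le> ennreal (e\<^sup>2)" by (rule fatou[OF e])
    finally show ?thesis using \<open>e \<ge> 0\<close>
      by (metis ennreal_le_iff power2_le_imp_le zero_le_power2)
  qed
  have "X \<longlonglongrightarrow> abs_L2 F"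
  proof (rule LIMSEQ_I)
    fix r :: real assume "0 < r"
    then obtain N where N: "\<And>m n. m \<ge> N \<Longrightarrow> n \<ge> N \<Longrightarrow> norm (X m - X n) < r/2"
      using C unfolding Cauchy_iff by (metis half_gt_zero)
    have "norm (X n - abs_L2 F) < r" if "n \<ge> N" for n
    proof -
      have "norm (abs_L2 F - X n) \<le> r/2"
        using N that by (intro conv_le less_imp_le) auto
      then show ?thesis using \<open>0 < r\<close> by (simp add: norm_minus_commute)
    qed
    then show "\<exists>no. \<forall>n\<ge>no. norm (X n - abs_L2 F) < r" by blast
  qed
  then show ?thesis by (rule convergentI)
qed

instance L2 :: complete_space
proof
  fix X :: "nat \<Rightarrow> L2" assume C: "Cauchy X"
  have "\<exists>N. \<forall>m\<ge>N. \<forall>n\<ge>N. norm (X m - X n) < (1/2)^k" for k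
    using C by (simp add: Cauchy_iff)
  then obtain N where N: "\<And>k m n. m \<ge> N k \<Longrightarrow> n \<ge> N k \<Longrightarrow> norm (X m - X n) < (1/2)^k"
    by metis
  \<comment> \<open>The sum makes \<open>r k\<close> at least every \<open>N j\<close> with j \<le>
    k; the summand \<open>k\<close> makes \<open>r\<close> strictly increasing.\<close>
  define r where "r k = (\<Sum>j\<le>k. N j) + k" for k
  have r: "strict_mono r" by (auto simp: strict_mono_Suc_iff r_def)
  have rN: "r k \<ge> N k" "r (Suc k) \<ge> N k" for k
    using member_le_sum[of k "{..k}" N] member_le_sum[of k "{..Suc k}" N] by (auto simp: r_def)
  have "convergent (X \<circ> r)"
  proof (rule L2_fast_Cauchy_convergent)
    show "norm ((X \<circ> r) (Suc k) - (X \<circ> r) k) \<le> (1/2)^k" for k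
      using N[of k "r (Suc k)" "r k"] rN[of k] by simp
    show "Cauchy (X \<circ> r)" using C r by (rule Cauchy_subseq_Cauchy)
  qed
  then obtain L where "(X \<circ> r) \<longlonglongrightarrow> L" by (auto simp: convergent_def)
  then have "X \<longlonglongrightarrow> L" using Cauchy_converges_subseq C r by blast
  then show "convergent X" by (rule convergentI)
qed

instance L2 :: banach ..

section \<open>Test functions\<close>

lemma square_integrable_compact_support:
  fixes f :: "real \<Rightarrow> real"
  assumes "continuous_on UNIV f" "\<And>x. x \<notin> {a..b} \<Longrightarrow> f x = 0"
  shows "square_integrable f"
proof -
  have "integrable lborel (\<lambda>x. indicator {a..b} x *\<^sub>R (f x)\<^sup>2)"
    using assms(1) by (intro borel_integrable_compact continuous_intros) (auto intro: continuous_on_subset)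
  moreover have "(\<lambda>x. indicator {a..b} x *\<^sub>R (f x)\<^sup>2) = (\<lambda>x. (f x)\<^sup>2)"
    by (rule ext) (use assms(2) in \<open>force simp: indicator_def\<close>)
  ultimately show ?thesis
    using assms(1) by (simp add: square_integrable_def borel_measurable_continuous_onI)
qed

lemma inner_rep_abs_L2:
  assumes "square_integrable f"
  shows "inner u (abs_L2 f) = (LINT x|lborel. rep_L2 u x * f x)"
  using inner_abs_L2[OF square_integrable_rep_L2 assms, of u] by (simp add: abs_L2_rep)

text \<open>Vanishing a.e. outside the interval is a statement about representatives. Written as
  orthogonality to all functions that vanish inside, it exhibits the set as an intersection of
  kernels of continuous functionals, hence as a closed subspace.\<close>

lemma L2_on_iff:
  "u \<in> L2_on l \<longleftrightarrow> (\<forall>f. square_integrable f \<longrightarrow> (\<forall>x\<in>{0<..<l}. f x = 0) \<longrightarrow> inner u (abs_L2 f) = 0)"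
proof
  assume u: "u \<in> L2_on l"
  show "\<forall>f. square_integrable f \<longrightarrow> (\<forall>x\<in>{0<..<l}. f x = 0) \<longrightarrow> inner u (abs_L2 f) = 0"
  proof (intro allI impI)
    fix f assume f: "square_integrable f" "\<forall>x\<in>{0<..<l}. f x = 0"
    have "(LINT x|lborel. rep_L2 u x * f x) = (LINT x|(lborel::real measure). 0)"
    proof (rule Bochner_Integration.integral_cong_AE)
      show "AE x in lborel. rep_L2 u x * f x = 0"
        using u unfolding L2_on_def mem_Collect_eq by eventually_elim (use f in auto)
    qed (use f in \<open>auto simp: square_integrable_def\<close>)
    then show "inner u (abs_L2 f) = 0" by (simp add: inner_rep_abs_L2 f)
  qed
next
  assume *: "\<forall>f. square_integrable f \<longrightarrow> (\<forall>x\<in>{0<..<l}. f x = 0) \<longrightarrow> inner u (abs_L2 f) = 0"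
  \<comment> \<open>Test with the part of \<open>u\<close> outside the interval: the inner product
    is the integral of its square.\<close>
  let ?f = "\<lambda>x. indicator (- {0<..<l}) x * rep_L2 u x"
  have f: "square_integrable ?f"
    by (rule square_integrable_bound[OF _ square_integrable_rep_L2[of u]]) (auto simp: indicator_def)
  have "inner u (abs_L2 ?f) = 0" using * f by auto
  then have "(LINT x|lborel. rep_L2 u x * ?f x) = 0" by (simp only: inner_rep_abs_L2[OF f])
  then have "AE x in lborel. rep_L2 u x * ?f x = 0"
    by (subst (asm) integral_nonneg_eq_0_iff_AE)
      (simp_all only: square_integrable_mult square_integrable_rep_L2 f, auto simp: indicator_def)
  then show "u \<in> L2_on l"
    unfolding L2_on_def mem_Collect_eq by eventually_elim auto
qed

lemma subspace_L2_on: "subspace (L2_on l)"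
  unfolding subspace_def by (auto simp: L2_on_iff inner_add_left)

lemma closed_L2_on: "closed (L2_on l)"
proof -
  have "L2_on l = (\<Inter>f\<in>{f. square_integrable f \<and> (\<forall>x\<in>{0<..<l}. f x = 0)}. {u. inner u (abs_L2 f) = 0})"
    by (auto simp: L2_on_iff)
  also have "closed \<dots>"
    by (intro closed_INT ballI closed_Collect_eq continuous_intros)
  finally show ?thesis .
qed

lemma abs_L2_in_L2_on:
  assumes "square_integrable f" "\<And>x. x \<notin> {0<..<l} \<Longrightarrow> f x = 0"
  shows "abs_L2 f \<in> L2_on l"
  using AE_rep_abs_L2[OF assms(1)] unfolding L2_on_def mem_Collect_eq
  by eventually_elim (use assms(2) in auto)

lemma C1c_deriv: "\<phi> \<in> C1c l \<Longrightarrow> (\<phi> has_real_derivative deriv \<phi> x) (at x)"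
  by (simp add: C1c_def DERIV_deriv_iff_real_differentiable)

lemma C1c_cont: "\<phi> \<in> C1c l \<Longrightarrow> continuous_on S \<phi>"
  by (meson C1c_deriv DERIV_isCont continuous_at_imp_continuous_on)

lemma C1c_cont_deriv: "\<phi> \<in> C1c l \<Longrightarrow> continuous_on S (deriv \<phi>)"
  by (auto simp: C1c_def intro: continuous_on_subset)

lemma C1c_support:
  assumes "\<phi> \<in> C1c l" "l > 0"
  obtains a b where "0 < a" "a < b" "b < l" "\<And>x. x \<notin> {a..b} \<Longrightarrow> \<phi> x = 0"
proof -
  \<comment> \<open>The two extra points make \<open>K\<close> nonempty and force a < b, even if
    \<phi> vanishes identically.\<close>
  define K where "K = closure {x. \<phi> x \<noteq> 0} \<union> {l/3, 2*l/3}"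
  have sub: "K \<subseteq> {0<..<l}" using assms by (auto simp: C1c_def K_def)
  have "bounded K" using sub by (metis bounded_box bounded_subset box_real(1))
  moreover have "closed K" by (simp add: K_def closed_Un)
  ultimately have K: "compact K" by (simp add: compact_eq_bounded_closed)
  have "K \<noteq> {}" by (simp add: K_def)
  obtain a where a: "a \<in> K" "\<And>x. x \<in> K \<Longrightarrow> a \<le> x"
    using compact_attains_inf[OF K \<open>K \<noteq> {}\<close>] by blast
  obtain b where b: "b \<in> K" "\<And>x. x \<in> K \<Longrightarrow> x \<le> b"
    using compact_attains_sup[OF K \<open>K \<noteq> {}\<close>] by blast
  have "l/3 \<in> K" "2*l/3 \<in> K" by (auto simp: K_def)
  then have "a \<le> l/3" "2*l/3 \<le> b" using a(2) b(2) by blast+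
  then have ab: "a < b" using assms by linarith
  have out: "\<phi> x = 0" if "x \<notin> {a..b}" for x
    using that a(2)[of x] b(2)[of x] closure_subset[of "{x. \<phi> x \<noteq> 0}"] by (auto simp: K_def)
  have "0 < a" "b < l" using a(1) b(1) sub by auto
  with ab out show ?thesis by (intro that[of a b])
qed

lemma C1cI:
  assumes "\<And>x. (\<phi> has_real_derivative \<phi>' x) (at x)" "continuous_on UNIV \<phi>'"
    and "closed K" "K \<subseteq> {0<..<l}" "\<And>x. x \<notin> K \<Longrightarrow> \<phi> x = 0"
  shows "\<phi> \<in> C1c l" "deriv \<phi> = \<phi>'"
proof -
  show d: "deriv \<phi> = \<phi>'" using assms(1) DERIV_imp_deriv by blast
  have "closure {x. \<phi> x \<noteq> 0} \<subseteq> K" using assms by (intro closure_minimal) auto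
  then show "\<phi> \<in> C1c l"
    unfolding C1c_def using assms d by (auto simp: real_differentiable_def)
qed

lemma deriv_zero_outside:
  assumes "\<And>x. x \<notin> {a..b} \<Longrightarrow> \<phi> x = 0" "x \<notin> {a..b}"
  shows "deriv \<phi> x = (0::real)"
proof -
  have "((\<lambda>x. 0) has_real_derivative 0) (at x)" by simp
  then have "(\<phi> has_real_derivative 0) (at x)"
    by (rule has_field_derivative_transform_within_open[where S="- {a..b}"]) (use assms in auto)
  then show ?thesis by (rule DERIV_imp_deriv)
qed

lemma C1c_zero:
  assumes "\<phi> \<in> C1c l" "l > 0" "x \<notin> {0<..<l}"
  shows "\<phi> x = 0" "deriv \<phi> x = 0"
proof -
  obtain a b where ab: "0 < a" "a < b" "b < l" "\<And>x. x \<notin> {a..b} \<Longrightarrow> \<phi> x = 0"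
    by (rule C1c_support[OF assms(1,2)]) blast
  have "x \<notin> {a..b}" using assms ab by auto
  with ab(4) show "\<phi> x = 0" "deriv \<phi> x = 0"
    using deriv_zero_outside[of a b \<phi> x] by blast+
qed

lemma C1c_square_integrable:
  assumes "\<phi> \<in> C1c l" "l > 0"
  shows "square_integrable \<phi>" "square_integrable (deriv \<phi>)"
  by (rule square_integrable_compact_support[of _ 0 l];
      use assms C1c_cont C1c_cont_deriv C1c_zero in auto)+

lemma C1c_diff_scale:
  assumes "\<phi> \<in> C1c l" "\<psi> \<in> C1c l"
  shows "(\<lambda>x. \<phi> x - c * \<psi> x) \<in> C1c l"
proof (rule C1cI(1))
  show "((\<lambda>x. \<phi> x - c * \<psi> x) has_real_derivative deriv \<phi> x - c * deriv \<psi> x) (at x)" for x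
    using assms by (auto intro!: derivative_eq_intros dest: C1c_deriv)
  show "continuous_on UNIV (\<lambda>x. deriv \<phi> x - c * deriv \<psi> x)"
    using assms by (intro continuous_intros C1c_cont_deriv)
  show "closed (closure {x. \<phi> x \<noteq> 0} \<union> closure {x. \<psi> x \<noteq> 0})" by (simp add: closed_Un)
  show "closure {x. \<phi> x \<noteq> 0} \<union> closure {x. \<psi> x \<noteq> 0} \<subseteq> {0<..<l}"
    using assms by (auto simp: C1c_def)
  show "\<phi> x - c * \<psi> x = 0" if "x \<notin> closure {x. \<phi> x \<noteq> 0} \<union> closure {x. \<psi> x \<noteq> 0}" for x
  proof -
    have "\<phi> x = 0" "\<psi> x = 0"
      using that closure_subset[of "{x. \<phi> x \<noteq> 0}"] closure_subset[of "{x. \<psi> x \<noteq> 0}"] by blast+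
    then show ?thesis by simp
  qed
qed

text \<open>Test functions vanish outside (0, l), so both integrals are inner products of
  \<open>L2\<close>. In this form the relation passes to limits in u and g.\<close>

lemma weak_derivative_iff:
  assumes "l > 0"
  shows "weak_derivative l u g \<longleftrightarrow> g \<in> L2_on l \<and>
    (\<forall>\<phi>\<in>C1c l. inner u (abs_L2 (deriv \<phi>)) = - inner g (abs_L2 \<phi>))"
proof -
  have "(LINT \<xi>:{0<..<l}|lborel. rep_L2 u \<xi> * deriv \<phi> \<xi>) = inner u (abs_L2 (deriv \<phi>))"
       "(LINT \<xi>:{0<..<l}|lborel. rep_L2 g \<xi> * \<phi> \<xi>) = inner g (abs_L2 \<phi>)" if "\<phi> \<in> C1c l" for \<phi>
    unfolding inner_rep_abs_L2[OF C1c_square_integrable(1)[OF that assms]] inner_rep_abs_L2[OF C1c_square_integrable(2)[OF that assms]]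
      set_lebesgue_integral_def
    by (rule Bochner_Integration.integral_cong[OF refl],
        use C1c_zero[OF that assms] in \<open>force simp: indicator_def\<close>)+
  then show ?thesis unfolding weak_derivative_def by simp
qed

section \<open>Density of the test functions\<close>

text \<open>The squared positive part is a simple C^1 function vanishing on a half-line;
  \<open>cutoff\<close> is composed of two copies of it.\<close>

lemma DERIV_max0_sq: "((\<lambda>s. (max 0 s)\<^sup>2) has_real_derivative 2 * max 0 s) (at s)" for s :: real
proof -
  consider "s < 0" | "s = 0" | "s > 0" by linarith
  then show ?thesis
  proof cases
    case 1
    have "((\<lambda>s. 0) has_real_derivative 0) (at s)" by simp
    then have "((\<lambda>s. (max 0 s)\<^sup>2) has_real_derivative 0) (at s)"
      by (rule has_field_derivative_transform_within_open[where S="{..<0}"]) (use 1 in auto)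
    with 1 show ?thesis by simp
  next
    case 2
    have "((\<lambda>h. (max 0 h)\<^sup>2 / h) \<longlongrightarrow> 0) (at (0::real))"
    proof (rule Lim_null_comparison)
      show "\<forall>\<^sub>F h in at 0. norm ((max 0 h)\<^sup>2 / h) \<le> \<bar>h\<bar>"
        by (rule always_eventually) (auto simp: max_def power2_eq_square)
      show "((\<lambda>h. \<bar>h\<bar>) \<longlongrightarrow> 0) (at (0::real))" by real_asymp
    qed
    with 2 show ?thesis by (simp add: DERIV_def)
  next
    case 3
    have "((\<lambda>s. s\<^sup>2) has_real_derivative 2 * s) (at s)" by (auto intro!: derivative_eq_intros)
    then have "((\<lambda>s. (max 0 s)\<^sup>2) has_real_derivative 2 * s) (at s)"
      by (rule has_field_derivative_transform_within_open[where S="{0<..}"]) (use 3 in auto)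
    with 3 show ?thesis by simp
  qed
qed

text \<open>With p(s) = (max 0 s)^2 this is 1 - p(1 - n p(x (l - x) - 1/n)): a C^1 function with
  values in [0, 1], zero where x (l - x) \<le> 1/n and one as soon as n p(x (l - x) - 1/n) \<ge>
  1.\<close>

definition cutoff :: "real \<Rightarrow> nat \<Rightarrow> real \<Rightarrow> real" where
  "cutoff l n x = 1 - (max 0 (1 - real n * (max 0 (x * (l - x) - 1 / n))\<^sup>2))\<^sup>2"

lemma cutoff_bounds: "0 \<le> cutoff l n x" "cutoff l n x \<le> 1"
proof -
  let ?s = "max 0 (1 - real n * (max 0 (x * (l - x) - 1 / n))\<^sup>2)"
  have "0 \<le> ?s" "?s \<le> 1" by auto
  then have "?s\<^sup>2 \<le> 1" by (simp add: power_le_one)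
  then show "0 \<le> cutoff l n x" by (simp add: cutoff_def)
  show "cutoff l n x \<le> 1" by (simp add: cutoff_def)
qed

lemma cutoff_eq_1:
  assumes "0 < x" "x < l"
  shows "\<forall>\<^sub>F n in sequentially. cutoff l n x = 1"
proof -
  \<comment> \<open>Once n \<ge> 2/d, 1/n is at most d/2; once n \<ge> 4/d^2, n (d/2)^2 is at least
    1. Together these make the outer positive part zero.\<close>
  define d where "d = x * (l - x)"
  have "d > 0" using assms by (simp add: d_def)
  have "\<forall>\<^sub>F n in sequentially. max (2/d) (4/d\<^sup>2) \<le> real n"
    using filterlim_real_sequentially unfolding filterlim_at_top by blast
  then show ?thesis using eventually_gt_at_top[of 0]
  proof eventually_elim
    case (elim n)
    have n: "2/d \<le> n" "4/d\<^sup>2 \<le> n" using elim by auto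
    have "1/n \<le> d/2" using n(1) \<open>d > 0\<close> elim(2) by (simp add: field_simps)
    then have "(d/2)\<^sup>2 \<le> (max 0 (d - 1/n))\<^sup>2" using \<open>d > 0\<close> by (intro power_mono) auto
    then have "real n * (d/2)\<^sup>2 \<le> n * (max 0 (d - 1/n))\<^sup>2" by (intro mult_left_mono) auto
    moreover have "1 \<le> real n * (d/2)\<^sup>2" using n(2) \<open>d > 0\<close> by (simp add: field_simps)
    ultimately have "max 0 (1 - real n * (max 0 (d - 1/n))\<^sup>2) = 0" by simp
    then show ?case by (simp add: cutoff_def d_def)
  qed
qed

text \<open>The support lies in the set x (l - x) \<ge> 1/n, which is closed and contained in (0,
  l); multiplication thus turns any C^1 function into a test function.\<close>

lemma cutoff_mult_C1c:
  assumes p: "\<And>x. (p has_real_derivative p' x) (at x)" and c: "continuous_on UNIV p'" and n: "n > 0" and l: "l > 0"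
  shows "(\<lambda>x. cutoff l n x * p x) \<in> C1c l"
proof -
  define a where "a x = x * (l - x) - 1 / n" for x
  define b where "b x = 1 - real n * (max 0 (a x))\<^sup>2" for x
  define b' where "b' x = - (real n * (2 * max 0 (a x) * (l - 2 * x)))" for x
  have a: "(a has_real_derivative l - 2 * x) (at x)" for x
    unfolding a_def by (auto intro!: derivative_eq_intros simp: algebra_simps)
  have b: "(b has_real_derivative b' x) (at x)" for x
    unfolding b_def b'_def
    using DERIV_diff[OF DERIV_const DERIV_cmult[OF DERIV_chain2[OF DERIV_max0_sq a]], of 1 "real n" x]
    by (simp add: mult.assoc)
  have k: "(cutoff l n has_real_derivative - (2 * max 0 (b x) * b' x)) (at x)" for x
  proof -
    have "cutoff l n = (\<lambda>x. 1 - (max 0 (b x))\<^sup>2)" by (auto simp: cutoff_def b_def a_def)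
    then show ?thesis
      using DERIV_diff[OF DERIV_const DERIV_chain2[OF DERIV_max0_sq b], of 1 x] by simp
  qed
  have cont: "continuous_on UNIV p" using p by (meson DERIV_isCont continuous_at_imp_continuous_on)
  have contk: "continuous_on UNIV (cutoff l n)" using k by (meson DERIV_isCont continuous_at_imp_continuous_on)
  show ?thesis
  proof (rule C1cI(1))
    show "((\<lambda>x. cutoff l n x * p x) has_real_derivative
            - (2 * max 0 (b x) * b' x) * p x + p' x * cutoff l n x) (at x)" for x
      by (rule DERIV_mult[OF k p])
    show "continuous_on UNIV (\<lambda>x. - (2 * max 0 (b x) * b' x) * p x + p' x * cutoff l n x)"
      unfolding b_def b'_def a_def by (intro continuous_intros cont contk c)
    show "closed {x. x * (l - x) \<ge> 1 / n}"
      by (intro closed_Collect_le continuous_intros)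
    show "{x. x * (l - x) \<ge> 1 / n} \<subseteq> {0<..<l}"
    proof
      fix x assume "x \<in> {x. x * (l - x) \<ge> 1 / n}"
      moreover have "1 / real n > 0" using n by simp
      ultimately have "x * (l - x) > 0" by (meson less_le_trans mem_Collect_eq)
      then show "x \<in> {0<..<l}" using l by (auto simp: zero_less_mult_iff)
    qed
    show "cutoff l n x * p x = 0" if "x \<notin> {x. x * (l - x) \<ge> 1 / n}" for x
      using that by (simp add: cutoff_def)
  qed
qed

lemma L2_tendsto_dominated:
  assumes "\<And>n. square_integrable (f n)" "square_integrable g" "square_integrable w"
    and "AE x in lborel. (\<lambda>n. f n x) \<longlonglongrightarrow> g x"
    and "\<And>n. AE x in lborel. \<bar>f n x - g x\<bar> \<le> w x"
  shows "(\<lambda>n. abs_L2 (f n)) \<longlonglongrightarrow> abs_L2 g"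
proof -
  have [measurable]: "g \<in> borel_measurable borel" "f n \<in> borel_measurable borel" for n
    using assms by (auto simp: square_integrable_def)
  have "(\<lambda>n. LINT x|lborel. (f n x - g x)\<^sup>2) \<longlonglongrightarrow> (LINT x|(lborel::real measure). 0)"
  proof (rule Bochner_Integration.integral_dominated_convergence)
    show "integrable lborel (\<lambda>x. (w x)\<^sup>2)" using assms by (simp add: square_integrable_def)
    show "AE x in lborel. (\<lambda>n. (f n x - g x)\<^sup>2) \<longlonglongrightarrow> 0"
      using assms(4) by eventually_elim (auto intro!: tendsto_eq_intros)
    show "AE x in lborel. norm ((f n x - g x)\<^sup>2) \<le> (w x)\<^sup>2" for n
      using assms(5)[of n] by eventually_elim (simp, metis abs_ge_zero power2_abs power_mono)
  qed measurable
  moreover have "(LINT x|lborel. (f n x - g x)\<^sup>2) = (norm (abs_L2 (f n) - abs_L2 g))\<^sup>2" for n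
    using assms by (simp add: abs_L2_diff norm_sq_abs_L2 square_integrable_diff)
  ultimately have "(\<lambda>n. (norm (abs_L2 (f n) - abs_L2 g))\<^sup>2) \<longlonglongrightarrow> 0" by simp
  then have "(\<lambda>n. sqrt ((norm (abs_L2 (f n) - abs_L2 g))\<^sup>2)) \<longlonglongrightarrow> sqrt 0"
    by (rule tendsto_real_sqrt)
  then show ?thesis by (simp add: LIM_zero_iff tendsto_norm_zero_iff)
qed

lemma square_integrable_indicator: "square_integrable (\<lambda>x. c * indicator {a<..<b} x)"
proof (rule square_integrable_scale)
  have "(\<lambda>x. (indicator {a<..<b} x)\<^sup>2) = (indicator {a<..<b} :: real \<Rightarrow> real)" by (auto simp: indicator_def)
  moreover have "emeasure lborel {a<..<b} < \<infinity>"
    by (rule emeasure_lborel_box_finite[of a b, unfolded box_real])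
  ultimately show "square_integrable (indicator {a<..<b})"
    by (simp add: square_integrable_def)
qed

text \<open>Three approximations are composed: continuous functions converging a.e., truncated to
  [-m, m]; polynomials within 1/(n+1) of these on [0, l], for differentiability; and
  \<open>cutoff\<close>, for compact support. The common bound m + 1 on (0, l) allows dominated
  convergence.\<close>

lemma bounded_approx_C1c:
  assumes l: "l > 0" and f: "f \<in> borel_measurable borel" "\<And>x. \<bar>f x\<bar> \<le> m" "\<And>x. x \<notin> {0<..<l} \<Longrightarrow> f x = 0"
  shows "\<exists>\<phi>. (\<forall>n. \<phi> n \<in> C1c l) \<and> (\<lambda>n. abs_L2 (\<phi> n)) \<longlonglongrightarrow> abs_L2 f"
proof -
  have "m \<ge> 0" using f(2)[of 0] by linarith
  have "f \<in> borel_measurable lebesgue" using f(1) by (simp add: measurable_completion)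
  then have "f measurable_on UNIV" by (simp add: measurable_on_iff_borel_measurable)
  then obtain N g where N: "negligible N" and g: "\<And>n. continuous_on UNIV (g n)"
    and lim: "\<And>x. x \<notin> N \<Longrightarrow> (\<lambda>n. g n x) \<longlonglongrightarrow> f x"
    unfolding measurable_on_def by auto
  define c where "c n x = max (-m) (min m (g n x))" for n :: nat and x :: real
  have "\<exists>p. real_polynomial_function p \<and> (\<forall>x\<in>{0..l}. \<bar>c n x - p x\<bar> < inverse (Suc n))" for n
  proof (rule Stone_Weierstrass_real_polynomial_function[of "{0..l}" "c n" "inverse (Suc n)"])
    show "continuous_on {0..l} (c n)"
      unfolding c_def by (intro continuous_intros continuous_on_subset[OF g]) auto
  qed auto
  then obtain p where p: "\<And>n. real_polynomial_function (p n)"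
    and pc: "\<And>n x. x \<in> {0..l} \<Longrightarrow> \<bar>c n x - p n x\<bar> < inverse (Suc n)" by metis
  define \<phi> where "\<phi> n x = cutoff l (Suc n) x * p n x" for n x
  have C: "\<phi> n \<in> C1c l" for n
  proof -
    obtain p' where "real_polynomial_function p'" "\<And>x. (p n has_real_derivative p' x) (at x)"
      using has_real_derivative_polynomial_function[OF p[of n]] by auto
    then show ?thesis unfolding \<phi>_def
      by (intro cutoff_mult_C1c[where p'=p']) (auto simp: continuous_on_polymonial_function real_polynomial_function_eq l)
  qed
  have bnd: "\<bar>\<phi> n x\<bar> \<le> m + 1" if "x \<in> {0<..<l}" for n x
  proof -
    have "\<bar>c n x - p n x\<bar> < inverse (Suc n)" using that by (intro pc) auto
    also have "\<dots> \<le> 1" by (simp add: field_simps)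
    finally have "\<bar>p n x\<bar> \<le> m + 1" using \<open>m \<ge> 0\<close> by (auto simp: c_def)
    then have "\<bar>cutoff l (Suc n) x\<bar> * \<bar>p n x\<bar> \<le> 1 * (m + 1)"
      using cutoff_bounds[of l "Suc n" x] \<open>m \<ge> 0\<close> by (intro mult_mono) auto
    then show ?thesis by (simp add: \<phi>_def abs_mult)
  qed
  have conv: "(\<lambda>n. \<phi> n x) \<longlonglongrightarrow> f x" if x: "x \<notin> N" for x
  proof (cases "x \<in> {0<..<l}")
    case True
    have "(\<lambda>n. c n x) \<longlonglongrightarrow> max (-m) (min m (f x))"
      unfolding c_def by (intro tendsto_intros lim x)
    also have "max (-m) (min m (f x)) = f x" using f(2)[of x] by linarith
    finally have c: "(\<lambda>n. c n x) \<longlonglongrightarrow> f x" .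
    have "(\<lambda>n. p n x - c n x) \<longlonglongrightarrow> 0"
    proof (rule Lim_null_comparison)
      show "\<forall>\<^sub>F n in sequentially. norm (p n x - c n x) \<le> inverse (Suc n)"
        using pc[of x] True by (intro always_eventually allI) (auto simp: abs_minus_commute less_imp_le)
    qed (rule LIMSEQ_inverse_real_of_nat)
    from tendsto_add[OF this c] have "(\<lambda>n. p n x) \<longlonglongrightarrow> f x" by simp
    moreover have "(\<lambda>n. cutoff l (Suc n) x) \<longlonglongrightarrow> 1"
      using cutoff_eq_1[of x l] True
      by (intro tendsto_eventually) (subst eventually_sequentially_Suc, auto)
    ultimately show ?thesis unfolding \<phi>_def
      by (auto intro!: tendsto_eq_intros)
  next
    case False
    then show ?thesis using f(3) C1c_zero[OF C l] by simp
  qed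
  have "(\<lambda>n. abs_L2 (\<phi> n)) \<longlonglongrightarrow> abs_L2 f"
  proof (rule L2_tendsto_dominated)
    show "square_integrable (\<phi> n)" for n using C1c_square_integrable(1)[OF C l] .
    show "square_integrable f"
      by (rule square_integrable_bound[OF f(1) square_integrable_indicator[of m 0 l]])
        (use f(2,3) \<open>m \<ge> 0\<close> in \<open>auto simp: indicator_def\<close>)
    show "square_integrable (\<lambda>x. (2 * m + 1) * indicator {0<..<l} x)" by (rule square_integrable_indicator)
    have "AE x in lebesgue. x \<notin> N"
      using N by (auto simp: negligible_iff_null_sets intro: AE_not_in)
    then show "AE x in lborel. (\<lambda>n. \<phi> n x) \<longlonglongrightarrow> f x"
      unfolding AE_completion_iff by eventually_elim (rule conv)
    show "AE x in lborel. \<bar>\<phi> n x - f x\<bar> \<le> (2 * m + 1) * indicator {0<..<l} x" for n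
    proof (rule AE_I2)
      fix x
      show "\<bar>\<phi> n x - f x\<bar> \<le> (2 * m + 1) * indicator {0<..<l} x"
        using f(2)[of x] f(3)[of x] bnd[of x n] C1c_zero[OF C l, of x]
        by (cases "x \<in> {0<..<l}") auto
    qed
  qed
  with C show ?thesis by blast
qed

text \<open>Truncation at height m reduces to bounded functions. The two limits are combined by
  passing to the closure, which replaces the choice of a diagonal sequence.\<close>

lemma C1c_dense:
  assumes l: "l > 0" and u: "u \<in> L2_on l"
  shows "\<exists>\<phi>. (\<forall>n. \<phi> n \<in> C1c l) \<and> (\<lambda>n. abs_L2 (\<phi> n)) \<longlonglongrightarrow> u"
proof -
  define f where "f x = rep_L2 u x * indicator {0<..<l} x" for x
  have [measurable]: "f \<in> borel_measurable borel" unfolding f_def by measurable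
  have f: "square_integrable f"
    by (rule square_integrable_bound[OF _ square_integrable_rep_L2[of u]]) (auto simp: f_def indicator_def)
  have uf: "u = abs_L2 f"
  proof (rule L2_eq_absI[OF f])
    show "AE x in lborel. rep_L2 u x = f x"
      using u unfolding L2_on_def mem_Collect_eq by eventually_elim (auto simp: f_def indicator_def)
  qed
  define t where "t m x = max (- real m) (min (real m) (f x))" for m x
  have [measurable]: "t m \<in> borel_measurable borel" for m unfolding t_def by measurable
  have tm: "square_integrable (t m)" for m
    by (rule square_integrable_bound[OF _ f]) (auto simp: t_def)
  have "(\<lambda>m. abs_L2 (t m)) \<longlonglongrightarrow> abs_L2 f"
  proof (rule L2_tendsto_dominated[OF tm f])
    show "square_integrable (\<lambda>x. \<bar>f x\<bar>)" using f by (auto simp: square_integrable_def)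
    show "AE x in lborel. (\<lambda>m. t m x) \<longlonglongrightarrow> f x"
    proof (intro AE_I2 tendsto_eventually)
      fix x
      have "\<forall>\<^sub>F n in sequentially. real n \<ge> \<bar>f x\<bar>"
        using filterlim_real_sequentially by (simp add: filterlim_at_top)
      then show "\<forall>\<^sub>F n in sequentially. t n x = f x"
        by eventually_elim (auto simp: t_def)
    qed
    show "AE x in lborel. \<bar>t n x - f x\<bar> \<le> \<bar>f x\<bar>" for n
      by (auto simp: t_def)
  qed
  then have lim: "(\<lambda>m. abs_L2 (t m)) \<longlonglongrightarrow> u" by (simp add: uf)
  have "abs_L2 (t m) \<in> closure (abs_L2 ` C1c l)" for m
  proof -
    have "\<exists>\<psi>. (\<forall>n. \<psi> n \<in> C1c l) \<and> (\<lambda>n. abs_L2 (\<psi> n)) \<longlonglongrightarrow> abs_L2 (t m)"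
      by (rule bounded_approx_C1c[OF l, of _ "real m"]) (auto simp: t_def f_def)
    then obtain \<psi> where "\<forall>n. \<psi> n \<in> C1c l" "(\<lambda>n. abs_L2 (\<psi> n)) \<longlonglongrightarrow> abs_L2 (t m)" by blast
    then show ?thesis
      unfolding closure_sequential by (intro exI[of _ "\<lambda>n. abs_L2 (\<psi> n)"]) auto
  qed
  then have "u \<in> closure (abs_L2 ` C1c l)"
    using closed_sequentially[OF closed_closure _ lim] by simp
  then obtain x where x: "\<forall>n. x n \<in> abs_L2 ` C1c l" "x \<longlonglongrightarrow> u"
    unfolding closure_sequential by blast
  have "\<exists>\<psi>\<in>C1c l. x n = abs_L2 \<psi>" for n using x(1) by auto
  then obtain \<psi> where \<psi>: "\<And>n. \<psi> n \<in> C1c l" "\<And>n. x n = abs_L2 (\<psi> n)" by metis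
  have "(\<lambda>n. abs_L2 (\<psi> n)) \<longlonglongrightarrow> u" using x(2) by (simp flip: \<psi>(2))
  with \<psi>(1) show ?thesis by blast
qed

section \<open>Primitives and weak derivatives\<close>

text \<open>The vector whose inner product with g is the integral of g over (0, x). Primitives
  thereby become linear and continuous in g, and Hoelder continuous in x, by Cauchy-Schwarz.\<close>

definition ind :: "real \<Rightarrow> L2" where "ind x = abs_L2 (indicator {0<..<x})"

definition prim :: "real \<Rightarrow> L2 \<Rightarrow> L2" where
  "prim l g = abs_L2 (\<lambda>x. indicator {0<..<l} x * inner g (ind x))"

lemma square_integrable_ind: "square_integrable (indicator {0<..<x})"
  using square_integrable_indicator[of 1 0 x] by simp

lemma ind_L2_on: "ind l \<in> L2_on l"
  unfolding ind_def by (rule abs_L2_in_L2_on[OF square_integrable_ind]) auto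

lemma norm_ind_diff: "norm (ind x - ind y) \<le> sqrt \<bar>x - y\<bar>"
proof -
  have *: "norm (ind x - ind y) \<le> sqrt \<bar>x - y\<bar>" if "x \<le> y" for x y
  proof -
    have eq: "ind x - ind y = abs_L2 (\<lambda>z. indicator {0<..<x} z - indicator {0<..<y} z)"
      unfolding ind_def by (rule abs_L2_diff[OF square_integrable_ind square_integrable_ind])
    have "(norm (ind x - ind y))\<^sup>2 = (LINT z|lborel. (indicator {0<..<x} z - indicator {0<..<y} z :: real)\<^sup>2)"
      unfolding eq by (rule norm_sq_abs_L2[OF square_integrable_diff[OF square_integrable_ind square_integrable_ind]])
    also have "\<dots> \<le> (LINT z|lborel. indicator {x..y} z)"
    proof (rule integral_mono)
      show "integrable lborel (\<lambda>z. (indicator {0<..<x} z - indicator {0<..<y} z :: real)\<^sup>2)"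
        using square_integrable_diff[OF square_integrable_ind square_integrable_ind] by (simp add: square_integrable_def)
      show "(indicator {0<..<x} z - indicator {0<..<y} z :: real)\<^sup>2 \<le> indicator {x..y} z" for z
        using that by (auto simp: indicator_def)
    qed (auto simp: emeasure_lborel_Icc_eq)
    also have "\<dots> = \<bar>x - y\<bar>" using that by simp
    finally show ?thesis by (simp add: real_le_rsqrt)
  qed
  show ?thesis
    using *[of x y] *[of y x] by (cases "x \<le> y") (auto simp: norm_minus_commute abs_minus_commute)
qed

lemma ind_0: "ind 0 = 0"
  unfolding ind_def zero_L2_def by (rule arg_cong[where f=abs_L2]) auto

lemma norm_ind_le: "0 \<le> x \<Longrightarrow> norm (ind x) \<le> sqrt x"
  using norm_ind_diff[of x 0] by (simp add: ind_0)

lemma inner_ind_le: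
  assumes "x \<in> {0..l}" shows "\<bar>inner g (ind x)\<bar> \<le> sqrt l * norm g"
proof -
  have "\<bar>inner g (ind x)\<bar> \<le> norm g * norm (ind x)" by (rule Cauchy_Schwarz_ineq2)
  also have "\<dots> \<le> norm g * sqrt l"
    using norm_ind_le[of x] assms by (intro mult_left_mono order_trans[OF norm_ind_le]) auto
  finally show ?thesis by (simp add: mult.commute)
qed

lemma continuous_inner_ind: "continuous_on S (\<lambda>x. inner g (ind x))"
proof -
  have "isCont ind x" for x
    unfolding isCont_def
  proof (rule LIM_zero_cancel, rule Lim_null_comparison)
    show "\<forall>\<^sub>F y in at x. norm (ind y - ind x) \<le> sqrt \<bar>y - x\<bar>"
      by (intro always_eventually allI norm_ind_diff)
    have "((\<lambda>y. sqrt \<bar>y - x\<bar>) \<longlongrightarrow> sqrt \<bar>x - x\<bar>) (at x)" by (intro tendsto_intros)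
    then show "((\<lambda>y. sqrt \<bar>y - x\<bar>) \<longlongrightarrow> 0) (at x)" by simp
  qed
  then have "continuous_on S ind" by (simp add: continuous_at_imp_continuous_on)
  then show ?thesis by (intro continuous_intros)
qed

lemma square_integrable_prim:
  assumes "l > 0"
  shows "square_integrable (\<lambda>x. indicator {0<..<l} x * inner g (ind x))"
proof (rule square_integrable_bound[OF _ square_integrable_indicator[of "sqrt l * norm g" 0 l]])
  have "(\<lambda>x. inner g (ind x)) \<in> borel_measurable borel"
    by (intro borel_measurable_continuous_onI continuous_inner_ind)
  then show "(\<lambda>x. indicator {0<..<l} x * inner g (ind x)) \<in> borel_measurable borel" by measurable
  show "AE x in lborel. \<bar>indicator {0<..<l} x * inner g (ind x)\<bar> \<le> \<bar>sqrt l * norm g * indicator {0<..<l} x\<bar>"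
    using inner_ind_le[of _ l g] assms by (auto simp: indicator_def abs_mult)
qed

lemma prim_L2_on: "l > 0 \<Longrightarrow> prim l g \<in> L2_on l"
  unfolding prim_def by (rule abs_L2_in_L2_on[OF square_integrable_prim]) auto

lemma AE_rep_prim: "l > 0 \<Longrightarrow> AE x in lborel. rep_L2 (prim l g) x = indicator {0<..<l} x * inner g (ind x)"
  unfolding prim_def by (rule AE_rep_abs_L2[OF square_integrable_prim])

lemma norm_prim_le:
  assumes "l > 0"
  shows "norm (prim l g) \<le> norm g * l"
proof -
  have "norm (prim l g) \<le> norm (abs_L2 (\<lambda>x. (sqrt l * norm g) * indicator {0<..<l} x))"
    unfolding prim_def
    by (rule norm_abs_L2_mono[OF square_integrable_prim[OF assms] square_integrable_indicator])
      (use inner_ind_le[of _ l g] assms in \<open>auto simp: indicator_def abs_mult\<close>)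
  also have "abs_L2 (\<lambda>x. (sqrt l * norm g) * indicator {0<..<l} x) = (sqrt l * norm g) *\<^sub>R ind l"
    unfolding ind_def by (rule abs_L2_scale[OF square_integrable_ind, symmetric])
  also have "norm \<dots> \<le> (sqrt l * norm g) * sqrt l"
    using norm_ind_le[of l] assms by (simp add: abs_mult mult_left_mono)
  also have "\<dots> = norm g * l" using assms by simp
  finally show ?thesis .
qed

lemma bounded_linear_prim:
  assumes "l > 0" shows "bounded_linear (prim l)"
proof (rule bounded_linear_intro[OF _ _ norm_prim_le[OF assms]])
  fix g h
  show "prim l (g + h) = prim l g + prim l h"
    unfolding prim_def abs_L2_add[OF square_integrable_prim[OF assms] square_integrable_prim[OF assms]]
    by (simp add: inner_add_left distrib_left)
  fix c
  show "prim l (c *\<^sub>R g) = c *\<^sub>R prim l g"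
    unfolding prim_def abs_L2_scale[OF square_integrable_prim[OF assms]] by (simp add: mult.left_commute)
qed

lemma inner_abs_ind:
  assumes R: "\<And>x. (R has_real_derivative r x) (at x)" and r: "continuous_on UNIV r" "square_integrable r"
    and "x \<ge> 0"
  shows "inner (abs_L2 r) (ind x) = R x - R 0"
proof -
  have "inner (abs_L2 r) (ind x) = (LINT y|lborel. r y * indicator {0<..<x} y)"
    unfolding ind_def by (rule inner_abs_L2[OF r(2) square_integrable_ind])
  also have "\<dots> = (LINT y|lborel. r y * indicator {0..x} y)"
  proof (rule Bochner_Integration.integral_cong_AE)
    show "AE y in lborel. r y * indicator {0<..<x} y = r y * indicator {0..x} y"
      using AE_lborel_singleton[of 0] AE_lborel_singleton[of x]
      by eventually_elim (auto simp: indicator_def)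
  qed (use r in \<open>auto simp: square_integrable_def\<close>)
  also have "\<dots> = R x - R 0"
    using r(1) by (intro integral_FTC_Icc_real R \<open>x \<ge> 0\<close>) (simp add: continuous_on_eq_continuous_at)
  finally show ?thesis .
qed

lemma C1c_inner_ind:
  assumes "\<phi> \<in> C1c l" "l > 0" "x \<ge> 0"
  shows "inner (abs_L2 (deriv \<phi>)) (ind x) = \<phi> x"
  using inner_abs_ind[OF C1c_deriv[OF assms(1)] C1c_cont_deriv[OF assms(1)] C1c_square_integrable(2)[OF assms(1,2)] assms(3)]
    C1c_zero(1)[OF assms(1,2), of 0] by simp

lemma prim_C1c:
  assumes "\<phi> \<in> C1c l" "l > 0"
  shows "prim l (abs_L2 (deriv \<phi>)) = abs_L2 \<phi>"
proof -
  have "(\<lambda>x. indicator {0<..<l} x * inner (abs_L2 (deriv \<phi>)) (ind x)) = \<phi>"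
  proof
    fix x show "indicator {0<..<l} x * inner (abs_L2 (deriv \<phi>)) (ind x) = \<phi> x"
      using C1c_inner_ind[OF assms, of x] C1c_zero(1)[OF assms, of x] by (cases "x \<in> {0<..<l}") auto
  qed
  then show ?thesis by (simp add: prim_def)
qed

lemma continuous_antiderivative:
  assumes "continuous_on UNIV (r::real \<Rightarrow> real)"
  obtains R where "\<And>x. (R has_real_derivative r x) (at x)"
proof -
  have "\<exists>F. \<forall>x::real. -\<infinity> < ereal x \<longrightarrow> ereal x < \<infinity> \<longrightarrow> (F has_vector_derivative r x) (at x)"
    using assms by (intro einterval_antiderivative) (auto simp: continuous_on_eq_continuous_at)
  then show ?thesis using that by (auto simp: has_real_derivative_iff_has_vector_derivative)
qed

text \<open>For a continuous density the primitive is classical, and the fundamental theorem applies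
  to S \<phi>, whose boundary values vanish with \<phi>. General densities are reached by
  approximation in \<open>weak_derivative_prim\<close>.\<close>

lemma inner_prim_deriv_C1c:
  assumes "\<eta> \<in> C1c l" "\<phi> \<in> C1c l" "l > 0"
  shows "inner (prim l (abs_L2 \<eta>)) (abs_L2 (deriv \<phi>)) = - inner (abs_L2 \<eta>) (abs_L2 \<phi>)"
proof -
  obtain R where R: "\<And>x. (R has_real_derivative \<eta> x) (at x)"
    using continuous_antiderivative[OF C1c_cont[OF assms(1)]] by blast
  define S where "S x = R x - R 0" for x
  have S: "(S has_real_derivative \<eta> x) (at x)" for x
    unfolding S_def using R[of x] by (auto intro!: derivative_eq_intros)
  have contS: "continuous_on UNIV S" using S by (meson DERIV_isCont continuous_at_imp_continuous_on)
  have in_ind: "inner (abs_L2 \<eta>) (ind x) = S x" if "x \<ge> 0" for x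
    unfolding S_def by (rule inner_abs_ind[OF R C1c_cont[OF assms(1)] C1c_square_integrable(1)[OF assms(1,3)] that])
  have 1: "inner (prim l (abs_L2 \<eta>)) (abs_L2 (deriv \<phi>)) = (LINT x|lborel. S x * deriv \<phi> x)"
  proof -
    have "inner (prim l (abs_L2 \<eta>)) (abs_L2 (deriv \<phi>))
      = (LINT x|lborel. indicator {0<..<l} x * inner (abs_L2 \<eta>) (ind x) * deriv \<phi> x)"
      unfolding prim_def by (rule inner_abs_L2[OF square_integrable_prim[OF assms(3)] C1c_square_integrable(2)[OF assms(2,3)]])
    also have "\<dots> = (LINT x|lborel. S x * deriv \<phi> x)"
    proof (rule Bochner_Integration.integral_cong[OF refl])
      fix x show "indicator {0<..<l} x * inner (abs_L2 \<eta>) (ind x) * deriv \<phi> x = S x * deriv \<phi> x"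
        using in_ind[of x] C1c_zero(2)[OF assms(2,3), of x] by (cases "x \<in> {0<..<l}") auto
    qed
    finally show ?thesis .
  qed
  have 2: "inner (abs_L2 \<eta>) (abs_L2 \<phi>) = (LINT x|lborel. \<eta> x * \<phi> x)"
    by (rule inner_abs_L2[OF C1c_square_integrable(1)[OF assms(1,3)] C1c_square_integrable(1)[OF assms(2,3)]])
  have z: "x \<notin> {0..l} \<Longrightarrow> \<phi> x = 0" "x \<notin> {0..l} \<Longrightarrow> deriv \<phi> x = 0" for x
    using C1c_zero[OF assms(2,3), of x] by auto
  have i1: "integrable lborel (\<lambda>x. S x * deriv \<phi> x)"
  proof -
    have "integrable lborel (\<lambda>x. indicator {0..l} x *\<^sub>R (S x * deriv \<phi> x))"
      by (intro borel_integrable_compact continuous_intros C1c_cont_deriv[OF assms(2)]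
          continuous_on_subset[OF contS]) auto
    also have "(\<lambda>x. indicator {0..l} x *\<^sub>R (S x * deriv \<phi> x)) = (\<lambda>x. S x * deriv \<phi> x)"
      by (rule ext) (use z in \<open>force simp: indicator_def\<close>)
    finally show ?thesis .
  qed
  have i2: "integrable lborel (\<lambda>x. \<eta> x * \<phi> x)"
    by (rule square_integrable_mult[OF C1c_square_integrable(1)[OF assms(1,3)] C1c_square_integrable(1)[OF assms(2,3)]])
  have "(LINT x|lborel. S x * deriv \<phi> x) + (LINT x|lborel. \<eta> x * \<phi> x)
      = (LINT x|lborel. S x * deriv \<phi> x + \<eta> x * \<phi> x)"
    using i1 i2 by simp
  also have "\<dots> = (LINT x|lborel. (S x * deriv \<phi> x + \<eta> x * \<phi> x) * indicator {0..l} x)"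
    by (rule Bochner_Integration.integral_cong[OF refl]) (use z in \<open>force simp: indicator_def\<close>)
  also have "\<dots> = S l * \<phi> l - S 0 * \<phi> 0"
  proof (rule integral_FTC_Icc_real)
    show "((\<lambda>x. S x * \<phi> x) has_real_derivative S x * deriv \<phi> x + \<eta> x * \<phi> x) (at x)" for x
      using DERIV_mult[OF S[of x] C1c_deriv[OF assms(2), of x]] by (simp add: mult.commute add.commute)
    show "isCont (\<lambda>x. S x * deriv \<phi> x + \<eta> x * \<phi> x) x" for x
    proof -
      have "continuous_on UNIV (\<lambda>x. S x * deriv \<phi> x + \<eta> x * \<phi> x)"
        by (intro continuous_intros contS C1c_cont_deriv[OF assms(2)] C1c_cont[OF assms(1)] C1c_cont[OF assms(2)])
      then show ?thesis by (simp add: continuous_on_eq_continuous_at)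
    qed
  qed (use assms in auto)
  also have "\<dots> = 0" using C1c_zero(1)[OF assms(2,3)] by simp
  finally show ?thesis unfolding 1 2 by linarith
qed

lemma weak_derivative_prim:
  assumes l: "l > 0" and g: "g \<in> L2_on l"
  shows "weak_derivative l (prim l g) g"
  unfolding weak_derivative_iff[OF l]
proof (intro conjI ballI g)
  fix \<phi> assume \<phi>: "\<phi> \<in> C1c l"
  obtain \<eta> where \<eta>: "\<And>n. \<eta> n \<in> C1c l" "(\<lambda>n. abs_L2 (\<eta> n)) \<longlonglongrightarrow> g"
    using C1c_dense[OF l g] by blast
  have "(\<lambda>n. inner (prim l (abs_L2 (\<eta> n))) (abs_L2 (deriv \<phi>))) \<longlonglongrightarrow> inner (prim l g) (abs_L2 (deriv \<phi>))"
    by (intro tendsto_intros bounded_linear.tendsto[OF bounded_linear_prim[OF l]] \<eta>)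
  moreover have "(\<lambda>n. - inner (abs_L2 (\<eta> n)) (abs_L2 \<phi>)) \<longlonglongrightarrow> - inner g (abs_L2 \<phi>)"
    by (intro tendsto_intros \<eta>)
  ultimately show "inner (prim l g) (abs_L2 (deriv \<phi>)) = - inner g (abs_L2 \<phi>)"
    using inner_prim_deriv_C1c[OF \<eta>(1) \<phi> l] LIMSEQ_unique by simp
qed

section \<open>Uniqueness of weak derivatives and the du Bois-Reymond lemma\<close>

lemma C1c_orthogonal_zero:
  assumes l: "l > 0" and u: "u \<in> L2_on l" and "\<And>\<phi>. \<phi> \<in> C1c l \<Longrightarrow> inner u (abs_L2 \<phi>) = 0"
  shows "u = 0"
proof -
  obtain \<eta> where \<eta>: "\<And>n. \<eta> n \<in> C1c l" "(\<lambda>n. abs_L2 (\<eta> n)) \<longlonglongrightarrow> u"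
    using C1c_dense[OF l u] by blast
  have "(\<lambda>n. inner u (abs_L2 (\<eta> n))) \<longlonglongrightarrow> inner u u" by (intro tendsto_intros \<eta>)
  then show ?thesis using assms(3)[OF \<eta>(1)] by (simp add: LIMSEQ_const_iff)
qed

lemma weak_derivative_unique:
  assumes l: "l > 0" and "weak_derivative l u g" "weak_derivative l u h"
  shows "g = h"
proof -
  have "g - h \<in> L2_on l" using assms subspace_diff[OF subspace_L2_on] by (auto simp: weak_derivative_iff)
  moreover have "inner (g - h) (abs_L2 \<phi>) = 0" if "\<phi> \<in> C1c l" for \<phi>
    using assms that by (simp add: weak_derivative_iff inner_diff_left)
  ultimately show ?thesis using C1c_orthogonal_zero[OF l] by force
qed

lemma wderiv_eq:
  assumes "l > 0" "weak_derivative l u g" shows "wderiv l u = g"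
  unfolding wderiv_def using assms weak_derivative_unique by blast

lemma weak_derivative_linear:
  assumes "l > 0" "weak_derivative l u g" "weak_derivative l v h"
  shows "weak_derivative l (u + v) (g + h)" "weak_derivative l (c *\<^sub>R u) (c *\<^sub>R g)"
  using assms subspace_add[OF subspace_L2_on] subspace_mul[OF subspace_L2_on]
  by (auto simp: weak_derivative_iff inner_add_left)

text \<open>The mean-zero condition says R l = R 0, so R - R 0 vanishes on both sides of the support
  of r and is itself a test function.\<close>

lemma C1c_antideriv:
  assumes l: "l > 0" and r: "r \<in> C1c l" and "inner (abs_L2 r) (ind l) = 0"
  shows "\<exists>\<phi>\<in>C1c l. deriv \<phi> = r"
proof -
  obtain R where R: "\<And>x. (R has_real_derivative r x) (at x)"
    using continuous_antiderivative[OF C1c_cont[OF r]] by blast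
  obtain a b where ab: "0 < a" "a < b" "b < l" "\<And>x. x \<notin> {a..b} \<Longrightarrow> r x = 0"
    by (rule C1c_support[OF r l]) blast
  have Rl: "R l = R 0" using inner_abs_ind[OF R C1c_cont[OF r] C1c_square_integrable(1)[OF r l], of l] assms by simp
  have const: "R x = R y" if "x \<le> y" "\<And>z. x < z \<Longrightarrow> z < y \<Longrightarrow> r z = 0" for x y
  proof (cases "x < y")
    case True
    then show ?thesis
    proof (rule DERIV_isconst_end[symmetric])
      show "continuous_on {x..y} R" using R by (meson DERIV_isCont continuous_at_imp_continuous_on)
      show "(R has_real_derivative 0) (at z)" if "x < z" "z < y" for z using R[of z] \<open>\<And>z. x < z \<Longrightarrow> z < y \<Longrightarrow> r z = 0\<close>[OF that] by simp
    qed
  qed (use that in auto)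
  have out: "R x - R 0 = 0" if "x \<notin> {a..b}" for x
  proof (cases "x < a")
    case True
    have rz: "r z = 0" if "z < a" for z using ab(4)[of z] that by simp
    have "R x = R 0"
    proof (cases "x \<le> 0")
      case True
      then show ?thesis by (rule const) (use ab(1) in \<open>simp add: rz\<close>)
    next
      case False
      then have "0 \<le> x" by simp
      then have "R 0 = R x" by (rule const) (use \<open>x < a\<close> in \<open>simp add: rz\<close>)
      then show ?thesis by simp
    qed
    then show ?thesis by simp
  next
    case False
    then have "x > b" using that by auto
    have rz: "r z = 0" if "z > b" for z using ab(4)[of z] that by simp
    have "R x = R l"
    proof (cases "x \<le> l")
      case True
      then show ?thesis by (rule const) (use \<open>x > b\<close> in \<open>simp add: rz\<close>)
    next
      case False
      then have "l \<le> x" by simp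
      then have "R l = R x" by (rule const) (use ab(3) in \<open>simp add: rz\<close>)
      then show ?thesis by simp
    qed
    then show ?thesis using Rl by simp
  qed
  have D: "((\<lambda>x. R x - R 0) has_real_derivative r x) (at x)" for x
    using R[of x] by (auto intro!: derivative_eq_intros)
  have sub: "{a..b} \<subseteq> {0<..<l}" using ab by auto
  show ?thesis
    using C1cI[OF D C1c_cont[OF r] closed_atLeastAtMost sub out] by blast
qed

lemma C1c_nonzero_mean:
  assumes l: "l > 0"
  obtains b where "b \<in> C1c l" "inner (abs_L2 b) (ind l) \<noteq> 0"
proof -
  have "\<exists>b\<in>C1c l. inner (abs_L2 b) (ind l) \<noteq> 0"
  proof (rule ccontr)
    assume "\<not> ?thesis"
    then have "ind l = 0" using C1c_orthogonal_zero[OF l ind_L2_on] by (auto simp: inner_commute)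
    then have "(norm (ind l))\<^sup>2 = 0" by simp
    moreover have "(norm (ind l))\<^sup>2 = (LINT x|lborel. indicator {0<..<l} x)"
      unfolding ind_def norm_sq_abs_L2[OF square_integrable_ind]
      by (rule Bochner_Integration.integral_cong[OF refl]) (auto simp: indicator_def)
    ultimately show False using l by simp
  qed
  then show ?thesis using that by blast
qed

text \<open>The derivatives of test functions are the test functions of mean zero. Subtracting a
  multiple of one fixed bump of mean one projects onto them; the same projection serves both the
  uniqueness of primitives and the approximation of elements of \<open>H10\<close>.\<close>

lemma C1c_deriv_mod_bump:
  assumes l: "l > 0"
  obtains b where "b \<in> C1c l" "\<And>r. r \<in> C1c l \<Longrightarrow> \<exists>\<phi>\<in>C1c l. abs_L2 (deriv \<phi>) = abs_L2 r - inner (abs_L2 r) (ind l) *\<^sub>R abs_L2 b"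
proof -
  obtain b0 where b0: "b0 \<in> C1c l" "inner (abs_L2 b0) (ind l) \<noteq> 0" by (rule C1c_nonzero_mean[OF l])
  define c where "c = inverse (inner (abs_L2 b0) (ind l))"
  \<comment> \<open>Written as a difference so that \<open>C1c_diff_scale\<close> applies to
    it.\<close>
  define b where "b x = 0 - (- c) * b0 x" for x
  have z: "(\<lambda>x. 0) \<in> C1c l"
    by (rule C1cI(1)[where \<phi>'="\<lambda>x. 0" and K="{}"]) auto
  have b: "b \<in> C1c l" unfolding b_def using C1c_diff_scale[OF z b0(1)] .
  have babs: "abs_L2 b = c *\<^sub>R abs_L2 b0"
    unfolding b_def using abs_L2_scale[OF C1c_square_integrable(1)[OF b0(1) l], of c] by simp
  have b1: "inner (abs_L2 b) (ind l) = 1" using b0(2) by (simp add: babs c_def)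
  have "\<exists>\<phi>\<in>C1c l. abs_L2 (deriv \<phi>) = abs_L2 r - inner (abs_L2 r) (ind l) *\<^sub>R abs_L2 b" if r: "r \<in> C1c l" for r
  proof -
    let ?q = "\<lambda>x. r x - inner (abs_L2 r) (ind l) * b x"
    have q: "?q \<in> C1c l" by (rule C1c_diff_scale[OF r b])
    have e: "abs_L2 ?q = abs_L2 r - inner (abs_L2 r) (ind l) *\<^sub>R abs_L2 b"
      unfolding abs_L2_scale[OF C1c_square_integrable(1)[OF b l]]
      by (rule abs_L2_diff[symmetric]) (intro square_integrable_scale C1c_square_integrable(1)[OF b l] C1c_square_integrable(1)[OF r l])+
    then have "inner (abs_L2 ?q) (ind l) = 0" by (simp add: inner_diff_left b1)
    from C1c_antideriv[OF l q this] e show ?thesis by metis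
  qed
  with b that show ?thesis by blast
qed

lemma du_Bois_Reymond:
  assumes l: "l > 0" and u: "u \<in> L2_on l" and d: "weak_derivative l u g"
  shows "\<exists>c. u = prim l g + c *\<^sub>R ind l"
proof -
  obtain b where b: "b \<in> C1c l" "\<And>r. r \<in> C1c l \<Longrightarrow> \<exists>\<phi>\<in>C1c l. abs_L2 (deriv \<phi>) = abs_L2 r - inner (abs_L2 r) (ind l) *\<^sub>R abs_L2 b"
    by (rule C1c_deriv_mod_bump[OF l]) blast
  define v where "v = u - prim l g"
  have g: "g \<in> L2_on l" using d by (simp add: weak_derivative_iff l)
  have v: "v \<in> L2_on l" unfolding v_def by (intro subspace_diff[OF subspace_L2_on] u prim_L2_on l)
  have orth: "inner v (abs_L2 (deriv \<phi>)) = 0" if "\<phi> \<in> C1c l" for \<phi>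
    using d weak_derivative_prim[OF l g] that by (simp add: weak_derivative_iff l v_def inner_diff_left)
  \<comment> \<open>\<open>v\<close> annihilates all derivatives of test functions, so <v, r> = <r,
    1> <v, b> for every test function r: \<open>v\<close> is the constant <v, b>.\<close>
  define c where "c = inner v (abs_L2 b)"
  have "v - c *\<^sub>R ind l = 0"
  proof (rule C1c_orthogonal_zero[OF l])
    show "v - c *\<^sub>R ind l \<in> L2_on l"
      by (intro subspace_diff[OF subspace_L2_on] subspace_mul[OF subspace_L2_on] v ind_L2_on)
    fix r assume "r \<in> C1c l"
    then obtain \<phi> where "\<phi> \<in> C1c l" "abs_L2 (deriv \<phi>) = abs_L2 r - inner (abs_L2 r) (ind l) *\<^sub>R abs_L2 b"
      using b(2) by blast
    then have "inner v (abs_L2 r - inner (abs_L2 r) (ind l) *\<^sub>R abs_L2 b) = 0" using orth by metis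
    then show "inner (v - c *\<^sub>R ind l) (abs_L2 r) = 0"
      by (simp add: inner_diff_left inner_diff_right c_def inner_commute)
  qed
  then show ?thesis by (intro exI[of _ c]) (simp add: v_def algebra_simps)
qed

section \<open>The space \<open>H10\<close>\<close>

text \<open>Test functions are the primitives of their derivatives, and these derivatives have mean
  zero. Both properties are continuous in L2 and so survive the closure that defines
  \<open>H10\<close>.\<close>

lemma H10_prim:
  assumes l: "l > 0" and w: "w \<in> H10 l"
  shows "w \<in> L2_on l" "weak_derivative l w (wderiv l w)" "wderiv l w \<in> L2_on l"
    "w = prim l (wderiv l w)" "inner (wderiv l w) (ind l) = 0"
proof -
  obtain g where g: "weak_derivative l w g" and wL: "w \<in> L2_on l"
    using w by (auto simp: H10_def)
  have wd: "wderiv l w = g" by (rule wderiv_eq[OF l g])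
  have "\<exists>\<phi>\<in>C1c l. sqrt ((norm (w - abs_L2 \<phi>))\<^sup>2 + (norm (g - abs_L2 (deriv \<phi>)))\<^sup>2) < inverse (Suc n)" for n
    using w wd by (auto simp: H10_def)
  then obtain \<phi> where \<phi>: "\<And>n. \<phi> n \<in> C1c l"
    "\<And>n. sqrt ((norm (w - abs_L2 (\<phi> n)))\<^sup>2 + (norm (g - abs_L2 (deriv (\<phi> n))))\<^sup>2) < inverse (Suc n)" by metis
  have lim1: "(\<lambda>n. abs_L2 (\<phi> n)) \<longlonglongrightarrow> w" and lim2: "(\<lambda>n. abs_L2 (deriv (\<phi> n))) \<longlonglongrightarrow> g"
  proof -
    have "norm (w - abs_L2 (\<phi> n)) \<le> inverse (Suc n)" "norm (g - abs_L2 (deriv (\<phi> n))) \<le> inverse (Suc n)" for n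
      using order_trans[OF real_sqrt_sum_squares_ge1 less_imp_le[OF \<phi>(2)[of n]]]
        order_trans[OF real_sqrt_sum_squares_ge2 less_imp_le[OF \<phi>(2)[of n]]] by blast+
    then have le: "norm (abs_L2 (\<phi> n) - w) \<le> inverse (Suc n)" "norm (abs_L2 (deriv (\<phi> n)) - g) \<le> inverse (Suc n)" for n
      by (simp_all only: norm_minus_commute)
    show "(\<lambda>n. abs_L2 (\<phi> n)) \<longlonglongrightarrow> w" "(\<lambda>n. abs_L2 (deriv (\<phi> n))) \<longlonglongrightarrow> g"
      by (rule LIM_zero_cancel, rule Lim_null_comparison[OF _ LIMSEQ_inverse_real_of_nat],
          rule always_eventually, use le in blast)+
  qed
  show "w \<in> L2_on l" by (rule wL)
  show "weak_derivative l w (wderiv l w)" using g wd by simp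
  then show "wderiv l w \<in> L2_on l" by (simp add: weak_derivative_iff l)
  have "(\<lambda>n. prim l (abs_L2 (deriv (\<phi> n)))) \<longlonglongrightarrow> prim l g"
    by (intro bounded_linear.tendsto[OF bounded_linear_prim[OF l]] lim2)
  then show "w = prim l (wderiv l w)"
    unfolding prim_C1c[OF \<phi>(1) l] wd using lim1 LIMSEQ_unique by blast
  have "(\<lambda>n. inner (abs_L2 (deriv (\<phi> n))) (ind l)) \<longlonglongrightarrow> inner g (ind l)"
    by (intro tendsto_intros lim2)
  moreover have "inner (abs_L2 (deriv (\<phi> n))) (ind l) = 0" for n
    using C1c_inner_ind[OF \<phi>(1) l, of l] C1c_zero[OF \<phi>(1) l, of l] l by simp
  ultimately show "inner (wderiv l w) (ind l) = 0" by (simp add: wd LIMSEQ_const_iff)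
qed

text \<open>Test functions close to g are corrected by the bump. The coefficient of the correction
  tends to <g, \<open>ind l\<close>> = 0, so the corrected functions, now derivatives of test
  functions, still converge to g.\<close>

lemma C1c_approx_H10:
  assumes l: "l > 0" and g: "g \<in> L2_on l" and z: "inner g (ind l) = 0"
  shows "\<exists>\<phi>. (\<forall>n. \<phi> n \<in> C1c l) \<and> (\<lambda>n. abs_L2 (deriv (\<phi> n))) \<longlonglongrightarrow> g \<and> (\<lambda>n. abs_L2 (\<phi> n)) \<longlonglongrightarrow> prim l g"
proof -
  obtain b where b: "b \<in> C1c l" "\<And>r. r \<in> C1c l \<Longrightarrow> \<exists>\<phi>\<in>C1c l. abs_L2 (deriv \<phi>) = abs_L2 r - inner (abs_L2 r) (ind l) *\<^sub>R abs_L2 b"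
    by (rule C1c_deriv_mod_bump[OF l]) blast
  obtain r where r: "\<And>n. r n \<in> C1c l" "(\<lambda>n. abs_L2 (r n)) \<longlonglongrightarrow> g"
    using C1c_dense[OF l g] by blast
  obtain \<phi> where \<phi>: "\<And>n. \<phi> n \<in> C1c l"
    "\<And>n. abs_L2 (deriv (\<phi> n)) = abs_L2 (r n) - inner (abs_L2 (r n)) (ind l) *\<^sub>R abs_L2 b"
    using b(2)[OF r(1)] by metis
  have "(\<lambda>n. abs_L2 (r n) - inner (abs_L2 (r n)) (ind l) *\<^sub>R abs_L2 b) \<longlonglongrightarrow> g - inner g (ind l) *\<^sub>R abs_L2 b"
    by (intro tendsto_intros r)
  then have 1: "(\<lambda>n. abs_L2 (deriv (\<phi> n))) \<longlonglongrightarrow> g" by (simp add: \<phi>(2) z)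
  from bounded_linear.tendsto[OF bounded_linear_prim[OF l] this]
  have "(\<lambda>n. abs_L2 (\<phi> n)) \<longlonglongrightarrow> prim l g" by (simp add: prim_C1c[OF \<phi>(1) l])
  with 1 \<phi>(1) show ?thesis by blast
qed

lemma prim_H10:
  assumes l: "l > 0" and g: "g \<in> L2_on l" and z: "inner g (ind l) = 0"
  shows "prim l g \<in> H10 l" "wderiv l (prim l g) = g"
proof -
  show wd: "wderiv l (prim l g) = g" by (rule wderiv_eq[OF l weak_derivative_prim[OF l g]])
  obtain \<phi> where \<phi>: "\<And>n. \<phi> n \<in> C1c l" "(\<lambda>n. abs_L2 (deriv (\<phi> n))) \<longlonglongrightarrow> g" "(\<lambda>n. abs_L2 (\<phi> n)) \<longlonglongrightarrow> prim l g"
    using C1c_approx_H10[OF assms] by blast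
  have "(\<lambda>n. sqrt ((norm (prim l g - abs_L2 (\<phi> n)))\<^sup>2 + (norm (g - abs_L2 (deriv (\<phi> n))))\<^sup>2))
     \<longlonglongrightarrow> sqrt ((norm (prim l g - prim l g))\<^sup>2 + (norm (g - g))\<^sup>2)"
    by (intro tendsto_intros \<phi>)
  then have lim: "(\<lambda>n. sqrt ((norm (prim l g - abs_L2 (\<phi> n)))\<^sup>2 + (norm (g - abs_L2 (deriv (\<phi> n))))\<^sup>2)) \<longlonglongrightarrow> 0" by simp
  have "\<exists>\<phi>\<in>C1c l. sqrt ((norm (prim l g - abs_L2 \<phi>))\<^sup>2 + (norm (wderiv l (prim l g) - abs_L2 (deriv \<phi>)))\<^sup>2) < \<epsilon>" if "\<epsilon> > 0" for \<epsilon>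
  proof -
    from order_tendstoD(2)[OF lim that] obtain n where "sqrt ((norm (prim l g - abs_L2 (\<phi> n)))\<^sup>2 + (norm (g - abs_L2 (deriv (\<phi> n))))\<^sup>2) < \<epsilon>"
      by (auto simp: eventually_sequentially)
    then show ?thesis using \<phi>(1) wd by (intro bexI[of _ "\<phi> n"]) auto
  qed
  moreover have "prim l g \<in> sobolev l 1"
    using weak_derivative_prim[OF l g] g prim_L2_on[OF l] by auto
  ultimately show "prim l g \<in> H10 l" by (simp add: H10_def)
qed

text \<open>The boundary values are carried by v alone: v is approximated by test functions together
  with its derivative, and the definition of the weak derivative of y is applied to each of
  them.\<close>

lemma H10_ibp:
  assumes l: "l > 0" and v: "v \<in> H10 l" and y: "weak_derivative l y g"
  shows "inner v g = - inner (wderiv l v) y"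
proof -
  obtain \<phi> where \<phi>: "\<And>n. \<phi> n \<in> C1c l" "(\<lambda>n. abs_L2 (deriv (\<phi> n))) \<longlonglongrightarrow> wderiv l v"
    "(\<lambda>n. abs_L2 (\<phi> n)) \<longlonglongrightarrow> prim l (wderiv l v)"
    using C1c_approx_H10[OF l H10_prim(3,5)[OF l v]] by blast
  have "(\<lambda>n. inner y (abs_L2 (deriv (\<phi> n)))) \<longlonglongrightarrow> inner y (wderiv l v)"
    by (intro tendsto_intros \<phi>)
  moreover have "(\<lambda>n. - inner g (abs_L2 (\<phi> n))) \<longlonglongrightarrow> - inner g (prim l (wderiv l v))"
    by (intro tendsto_intros \<phi>)
  moreover have "inner y (abs_L2 (deriv (\<phi> n))) = - inner g (abs_L2 (\<phi> n))" for n
    using y \<phi>(1) by (simp add: weak_derivative_iff l)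
  ultimately have "inner y (wderiv l v) = - inner g (prim l (wderiv l v))"
    using LIMSEQ_unique by simp
  then show ?thesis using H10_prim(4)[OF l v] by (simp add: inner_commute)
qed

lemma H10_AE_bound:
  assumes l: "l > 0" and w: "w \<in> H10 l"
  shows "AE x in lborel. \<bar>rep_L2 w x\<bar> \<le> sqrt l * norm (wderiv l w)"
  using AE_rep_prim[OF l, of "wderiv l w", folded H10_prim(4)[OF l w]]
proof eventually_elim
  case (elim x)
  then show ?case using inner_ind_le[of x l "wderiv l w"] l by (auto simp: indicator_def)
qed

lemma subspace_H10:
  assumes l: "l > 0" shows "subspace (H10 l)"
proof -
  interpret bounded_linear "prim l" by (rule bounded_linear_prim[OF l])
  show ?thesis
  proof (rule subspaceI)
    show "0 \<in> H10 l" using prim_H10(1)[OF l subspace_0[OF subspace_L2_on]] by (simp add: zero)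
    fix x y assume xy: "x \<in> H10 l" "y \<in> H10 l"
    note p = H10_prim[OF l xy(1)] H10_prim[OF l xy(2)]
    have "prim l (wderiv l x + wderiv l y) \<in> H10 l"
      by (intro prim_H10 l subspace_add[OF subspace_L2_on] p(3,8)) (simp add: inner_add_left p(5,10))
    then show "x + y \<in> H10 l" by (simp add: add flip: p(4,9))
    fix c
    have "prim l (c *\<^sub>R wderiv l x) \<in> H10 l"
      by (intro prim_H10 l subspace_mul[OF subspace_L2_on] p(3)) (simp add: p(5))
    then show "c *\<^sub>R x \<in> H10 l" by (simp add: scaleR flip: p(4))
  qed
qed

text \<open>The set where f and g differ inside the interval is open and null, hence empty;
  continuity extends the equality to the end points, where it is used.\<close>

lemma continuous_AE_eq_Icc:
  fixes f g :: "real \<Rightarrow> real"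
  assumes "l > 0" "continuous_on {0..l} f" "continuous_on {0..l} g"
    and "AE x in lborel. x \<in> {0<..<l} \<longrightarrow> f x = g x" and x: "x \<in> {0..l}"
  shows "f x = g x"
proof -
  define U where "U = {0<..<l} \<inter> (\<lambda>x. f x - g x) -` (- {0})"
  have "continuous_on {0<..<l} (\<lambda>x. f x - g x)"
    using assms by (intro continuous_intros) (auto intro: continuous_on_subset)
  then have "open U"
    unfolding U_def by (intro continuous_open_preimage) auto
  have "AE x in lborel. x \<notin> U"
    using assms(4) by eventually_elim (auto simp: U_def)
  then have "U \<in> null_sets lborel"
    using \<open>open U\<close> by (subst (asm) AE_iff_null_sets[symmetric]) auto
  then have "U = {}"
    using \<open>open U\<close> open_not_negligible negligible_iff_null_sets null_sets_completionI by blast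
  then have eq: "f y - g y = 0" if "y \<in> {0<..<l}" for y using that by (auto simp: U_def)
  have "f x - g x = 0"
  proof (rule continuous_constant_on_closure[where S="{0<..<l}" and f="\<lambda>x. f x - g x"])
    show "continuous_on (closure {0<..<l}) (\<lambda>x. f x - g x)"
      using assms by (simp add: continuous_on_diff)
    show "x \<in> closure {0<..<l}" using x assms(1) by simp
  qed (use eq in auto)
  then show ?thesis by simp
qed

text \<open>\<open>cont_rep\<close> is an arbitrary choice, but it agrees on all of [0, l] with the
  explicit representative \<open>G\<close>. The value at 0 gives c = 0 and the value at l the
  vanishing mean of g, which is the criterion of \<open>prim_H10\<close>. This translates end point
  conditions as in \<open>dom_A0\<close> into membership in \<open>H10\<close>.\<close>

lemma H10_of_cont_rep:
  assumes l: "l > 0" and y: "y \<in> L2_on l" and d: "weak_derivative l y g"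
    and bc: "cont_rep l y 0 = 0" "cont_rep l y l = 0"
  shows "y \<in> H10 l"
proof -
  have g: "g \<in> L2_on l" using d by (simp add: weak_derivative_iff l)
  obtain c where c: "y = prim l g + c *\<^sub>R ind l" using du_Bois_Reymond[OF l y d] by blast
  define G where "G x = inner g (ind x) + c" for x
  have G: "continuous_on {0..l} G" unfolding G_def by (intro continuous_intros continuous_inner_ind)
  have AE_G: "AE \<xi> in lborel. \<xi> \<in> {0<..<l} \<longrightarrow> rep_L2 y \<xi> = G \<xi>"
    using AE_rep_prim[OF l, of g] AE_rep_add[of "prim l g" "c *\<^sub>R ind l"] AE_rep_scale[of c "ind l"]
      AE_rep_abs_L2[OF square_integrable_ind[of l]]
    unfolding c ind_def[symmetric] by eventually_elim (auto simp: G_def)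
  have *: "continuous_on {0..l} (cont_rep l y) \<and>
     (AE \<xi> in lborel. \<xi> \<in> {0<..<l} \<longrightarrow> rep_L2 y \<xi> = cont_rep l y \<xi>)"
    unfolding cont_rep_def by (rule someI[of _ G]) (use G AE_G in blast)
  have AE2: "AE \<xi> in lborel. \<xi> \<in> {0<..<l} \<longrightarrow> cont_rep l y \<xi> = G \<xi>"
    using conjunct2[OF *] AE_G by eventually_elim auto
  have "cont_rep l y x = G x" if "x \<in> {0..l}" for x
    by (rule continuous_AE_eq_Icc[OF l conjunct1[OF *] G AE2 that])
  from this[of 0] this[of l] have "G 0 = 0" "G l = 0" using bc l by auto
  then have "c = 0" "inner g (ind l) = 0" by (auto simp: G_def ind_0)
  then show ?thesis using prim_H10(1)[OF l g] c by simp
qed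

section \<open>Semigroups on a complete subspace\<close>

text \<open>The isometry \<open>J\<close> transports the norm \<open>N\<close> to the norm of a type, where limits and integrals
  are available.\<close>

locale normed_subspace =
  fixes V :: "'a::real_vector set" and N :: "'a \<Rightarrow> real" and J :: "'a \<Rightarrow> 'b::banach"
  assumes V: "subspace V"
    and J_add: "x \<in> V \<Longrightarrow> y \<in> V \<Longrightarrow> J (x + y) = J x + J y"
    and J_scale: "x \<in> V \<Longrightarrow> J (c *\<^sub>R x) = c *\<^sub>R J x"
    and N_J: "x \<in> V \<Longrightarrow> N x = norm (J x)"
    and J_inj: "inj_on J V"
    and J_closed: "closed (J ` V)"
begin

lemma V_simps [simp]:
  "0 \<in> V" "x \<in> V \<Longrightarrow> y \<in> V \<Longrightarrow> x + y \<in> V" "x \<in> V \<Longrightarrow> y \<in> V \<Longrightarrow> x - y \<in> V" "x \<in> V \<Longrightarrow> c *\<^sub>R x \<in> V"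
  using V by (auto simp: subspace_0 subspace_add subspace_diff subspace_mul)

lemma J_zero: "J 0 = 0"
  using J_scale[of 0 0] by simp

lemma J_diff: "x \<in> V \<Longrightarrow> y \<in> V \<Longrightarrow> J (x - y) = J x - J y"
  using J_add[of x "-1 *\<^sub>R y"] J_scale[of y "-1"] V_simps(4)[of y "-1"] by simp

lemma J_sum: "finite A \<Longrightarrow> (\<And>a. a \<in> A \<Longrightarrow> f a \<in> V) \<Longrightarrow> J (sum f A) = (\<Sum>a\<in>A. J (f a))"
  by (induction A rule: finite_induct) (auto simp: J_zero J_add subspace_sum[OF V])

lemma N_nonneg: "x \<in> V \<Longrightarrow> 0 \<le> N x"
  by (simp add: N_J)

lemma N_zero: "N 0 = 0"
  by (simp add: N_J J_zero)

lemma N_add: "x \<in> V \<Longrightarrow> y \<in> V \<Longrightarrow> N (x + y) \<le> N x + N y"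
  by (simp add: N_J J_add norm_triangle_ineq)

lemma N_diff: "x \<in> V \<Longrightarrow> y \<in> V \<Longrightarrow> N (x - y) \<le> N x + N y"
  by (simp add: N_J J_diff norm_triangle_ineq4)

lemma N_scale: "x \<in> V \<Longrightarrow> N (c *\<^sub>R x) = \<bar>c\<bar> * N x"
  by (simp add: N_J J_scale)

lemma N_minus_commute: "x \<in> V \<Longrightarrow> y \<in> V \<Longrightarrow> N (x - y) = N (y - x)"
  by (simp add: N_J J_diff norm_minus_commute)

lemma N_eq_0: "x \<in> V \<Longrightarrow> N x = 0 \<Longrightarrow> x = 0"
  using J_inj inj_onD[of J V x 0] by (simp add: N_J J_zero)

lemma J_tendsto:
  assumes "\<forall>\<^sub>F i in F. f i \<in> V" "x \<in> V"
  shows "((\<lambda>i. J (f i)) \<longlongrightarrow> J x) F \<longleftrightarrow> ((\<lambda>i. N (f i - x)) \<longlongrightarrow> 0) F"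
proof -
  have "((\<lambda>i. J (f i)) \<longlongrightarrow> J x) F \<longleftrightarrow> ((\<lambda>i. norm (J (f i) - J x)) \<longlongrightarrow> 0) F"
    by (simp add: tendsto_norm_zero_iff LIM_zero_iff)
  also have "\<dots> \<longleftrightarrow> ((\<lambda>i. N (f i - x)) \<longlongrightarrow> 0) F"
    by (rule tendsto_cong) (use assms(1) in eventually_elim, simp add: N_J J_diff assms(2))
  finally show ?thesis .
qed

section \<open>Bounded operators and uniform boundedness\<close>

definition bounded_op :: "('a \<Rightarrow> 'a) \<Rightarrow> bool" where
  "bounded_op L \<longleftrightarrow> (\<forall>x\<in>V. L x \<in> V) \<and> (\<forall>x\<in>V. \<forall>y\<in>V. L (x + y) = L x + L y) \<and>
     (\<forall>c. \<forall>x\<in>V. L (c *\<^sub>R x) = c *\<^sub>R L x) \<and> (\<exists>C. \<forall>x\<in>V. N (L x) \<le> C * N x)"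

lemma bounded_op_diff: "bounded_op L \<Longrightarrow> x \<in> V \<Longrightarrow> y \<in> V \<Longrightarrow> L (x - y) = L x - L y"
proof -
  assume L: "bounded_op L" and xy: "x \<in> V" "y \<in> V"
  have "L (x + -1 *\<^sub>R y) = L x + L (-1 *\<^sub>R y)" "L (-1 *\<^sub>R y) = -1 *\<^sub>R L y"
    using L xy V_simps(4)[of y "-1"] unfolding bounded_op_def by blast+
  then show ?thesis by simp
qed

lemma bounded_op_bound:
  assumes "bounded_op L" obtains C where "C > 0" "\<And>x. x \<in> V \<Longrightarrow> N (L x) \<le> C * N x"
proof -
  obtain C where C: "\<And>x. x \<in> V \<Longrightarrow> N (L x) \<le> C * N x" using assms unfolding bounded_op_def by blast
  have "N (L x) \<le> (\<bar>C\<bar> + 1) * N x" if "x \<in> V" for x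
    using C[OF that] mult_right_mono[of C "\<bar>C\<bar> + 1" "N x"] N_nonneg[OF that] by linarith
  then show ?thesis using that[of "\<bar>C\<bar> + 1"] by auto
qed

text \<open>Nested balls: on the \<open>n\<close>-th ball some operator of the family has norm at least \<open>n\<close> throughout.\<close>

lemma uniform_boundedness:
  assumes op: "\<And>i. i \<in> K \<Longrightarrow> bounded_op (L i)"
    and pw: "\<And>x. x \<in> V \<Longrightarrow> \<exists>C. \<forall>i\<in>K. N (L i x) \<le> C"
  shows "\<exists>C. \<forall>i\<in>K. \<forall>x\<in>V. N (L i x) \<le> C * N x"
proof (rule ccontr)
  assume unb: "\<not> ?thesis"
  \<comment> \<open>A pair is a centre and a radius: \<open>Q n p p'\<close> says that p' is a ball
    inside p, of at most half the radius, on which some \<open>L i\<close> is at least n.\<close>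
  define Q where "Q n p p' \<longleftrightarrow> snd p' \<le> snd p / 2 \<and> N (fst p' - fst p) + snd p' \<le> snd p \<and>
      (\<exists>i\<in>K. \<forall>z\<in>V. N (z - fst p') \<le> snd p' \<longrightarrow> real n \<le> N (L i z))" for n :: nat and p p' :: "'a \<times> real"
  have step: "\<exists>p'. (fst p' \<in> V \<and> snd p' > 0) \<and> Q n p p'" if p: "fst p \<in> V \<and> snd p > 0" for n and p :: "'a \<times> real"
  proof -
    define c r where "c = fst p" and "r = snd p"
    have c: "c \<in> V" and r: "r > 0" using p by (auto simp: c_def r_def)
    \<comment> \<open>The factor is chosen so that, after scaling y to norm r / 2, the value of
      \<open>L i\<close> exceeds 2 (n + 1).\<close>
    obtain i y where i: "i \<in> K" and y: "y \<in> V" and big: "N (L i y) > (4 * (real n + 1) / r) * N y"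
      using unb by (meson not_le)
    note L = op[OF i, unfolded bounded_op_def]
    obtain C where C: "C > 0" "\<And>x. x \<in> V \<Longrightarrow> N (L i x) \<le> C * N x" by (rule bounded_op_bound[OF op[OF i]]) blast
    have "N y \<noteq> 0" using C(2)[OF y] big by auto
    then have Ny: "N y > 0" using N_nonneg[OF y] by simp
    define e where "e = (r / 2 / N y) *\<^sub>R y"
    have e: "e \<in> V" using y by (simp add: e_def)
    have Ne: "N e = r / 2" using Ny r y by (simp add: e_def N_scale)
    have Le: "L i e \<in> V" "L i c \<in> V" "L i (c + e) \<in> V" "L i (c - e) \<in> V" using L e c by auto
    have "N (L i e) = r / 2 / N y * N (L i y)"
      using L y Ny r by (simp add: e_def N_scale)
    also have "\<dots> > r / 2 / N y * ((4 * (real n + 1) / r) * N y)"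
      using big Ny r by (intro mult_strict_left_mono) auto
    also have "r / 2 / N y * ((4 * (real n + 1) / r) * N y) = 2 * (real n + 1)" using Ny r by simp
    finally have Nbig: "N (L i e) > 2 * real n + 2" by simp
    \<comment> \<open>The image of the centre may be small, but since 2 L e = L (c + e) - L (c - e),
      one of the points c + e and c - e has an image of norm at least n + 1.\<close>
    have "2 *\<^sub>R L i e = L i (c + e) - L i (c - e)"
      using L e c bounded_op_diff[OF op[OF i] c e] by (simp add: scaleR_2)
    then have two: "2 * N (L i e) \<le> N (L i (c + e)) + N (L i (c - e))"
      using N_diff[OF Le(3,4)] N_scale[OF Le(1), of 2] by simp
    have "N (L i (c + e)) \<ge> real n + 1 \<or> N (L i (c - e)) \<ge> real n + 1"
    proof (rule ccontr)
      assume "\<not> ?thesis"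
      then have "N (L i (c + e)) < real n + 1" "N (L i (c - e)) < real n + 1" by auto
      then show False using two Nbig by linarith
    qed
    then obtain c' where c': "c' \<in> V" "N (c' - c) = r / 2" "N (L i c') \<ge> real n + 1"
    proof
      assume "N (L i (c + e)) \<ge> real n + 1"
      then show ?thesis using that[of "c + e"] c e Ne by simp
    next
      assume "N (L i (c - e)) \<ge> real n + 1"
      moreover have "N (c - e - c) = r / 2" using N_scale[OF e, of "-1"] Ne by simp
      ultimately show ?thesis using that[of "c - e"] c e by simp
    qed
    \<comment> \<open>Radius r / 2 keeps the new ball inside the old one; radius 1 / C changes
      \<open>L i\<close> by at most 1 over the ball, which leaves n.\<close>
    define r' where "r' = min (r / 2) (1 / C)"
    have r': "r' > 0" "r' \<le> r / 2" "r' \<le> 1 / C" using r C by (auto simp: r'_def)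
    have "real n \<le> N (L i z)" if z: "z \<in> V" "N (z - c') \<le> r'" for z
    proof -
      have Lz: "L i z \<in> V" "L i c' \<in> V" using L z c' by auto
      have "N (L i z - L i c') = N (L i (z - c'))"
        using bounded_op_diff[OF op[OF i] z(1) c'(1)] by simp
      also have "\<dots> \<le> C * N (z - c')" using C z c' by simp
      also have "\<dots> \<le> C * (1 / C)" using z r' C by (intro mult_left_mono) auto
      finally have "N (L i z - L i c') \<le> 1" using C by simp
      moreover have "N (L i c') \<le> N (L i z) + N (L i z - L i c')"
        using N_diff[OF Lz(1) V_simps(3)[OF Lz]] by simp
      ultimately show ?thesis using c'(3) by linarith
    qed
    then have "Q n p (c', r')"
      unfolding Q_def using i r' c' by (auto simp flip: c_def r_def)
    then show ?thesis using c'(1) r'(1) by (intro exI[of _ "(c', r')"]) simp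
  qed
  have "\<exists>f. \<forall>n. (fst (f n) \<in> V \<and> snd (f n) > 0) \<and> Q n (f n) (f (Suc n))"
  proof (rule dependent_nat_choice[where P="\<lambda>n p. fst p \<in> V \<and> snd p > 0"])
    show "\<exists>p. fst p \<in> V \<and> snd p > (0::real)" by (rule exI[of _ "(0, 1)"]) simp
  qed (rule step)
  then obtain f where f: "\<And>n. fst (f n) \<in> V" "\<And>n. snd (f n) > 0" "\<And>n. Q n (f n) (f (Suc n))" by blast
  define c r where "c n = fst (f n)" and "r n = snd (f n)" for n
  have c: "c n \<in> V" and r: "r n > 0" for n using f by (auto simp: c_def r_def)
  have s: "r (Suc n) \<le> r n / 2" "N (c (Suc n) - c n) + r (Suc n) \<le> r n"
    and big: "\<exists>i\<in>K. \<forall>z\<in>V. N (z - c (Suc n)) \<le> r (Suc n) \<longrightarrow> real n \<le> N (L i z)" for n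
    using f(3)[of n] by (auto simp: Q_def c_def r_def)
  have nested: "N (c (n + k) - c n) + r (n + k) \<le> r n" for n k
  proof (induction k)
    case (Suc k)
    have "N (c (n + Suc k) - c n) \<le> N (c (Suc (n + k)) - c (n + k)) + N (c (n + k) - c n)"
      using N_add[of "c (Suc (n + k)) - c (n + k)" "c (n + k) - c n"] c by simp
    then show ?case using Suc s(2)[of "n + k"] by simp
  qed (simp add: N_zero)
  have rn: "r n \<le> r 0 * (1/2)^n" for n
  proof (induction n)
    case (Suc n) then show ?case using s(1)[of n] by simp
  qed simp
  have "(\<lambda>n. r 0 * (1/2)^n) \<longlonglongrightarrow> r 0 * 0"
    by (intro tendsto_intros LIMSEQ_power_zero) simp
  then have r0: "(\<lambda>n. r 0 * (1/2)^n) \<longlonglongrightarrow> 0" by simp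
  have dist: "norm (J (c m) - J (c n)) \<le> r n" if "m \<ge> n" for m n
    using nested[of n "m - n"] r[of m] that c by (simp add: N_J J_diff)
  have "Cauchy (\<lambda>n. J (c n))"
  proof (rule CauchyI')
    fix e :: real assume "0 < e"
    then obtain M where M: "\<And>n. n \<ge> M \<Longrightarrow> r 0 * (1/2)^n < e"
      using order_tendstoD(2)[OF r0] by (auto simp: eventually_sequentially)
    show "\<exists>M. \<forall>m\<ge>M. \<forall>n>m. dist (J (c m)) (J (c n)) < e"
    proof (intro exI[of _ M] allI impI)
      fix m n assume "M \<le> m" "m < n"
      then show "dist (J (c m)) (J (c n)) < e"
        using dist[of m n] rn[of m] M[of m] by (simp add: dist_norm norm_minus_commute)
    qed
  qed
  then obtain y where y: "(\<lambda>n. J (c n)) \<longlonglongrightarrow> y" by (auto simp: Cauchy_convergent_iff convergent_def)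
  then have "y \<in> J ` V" using closed_sequentially[OF J_closed _ y] c by auto
  then obtain z where z: "z \<in> V" "y = J z" by auto
  have zc: "N (z - c n) \<le> r n" for n
  proof -
    have "(\<lambda>m. norm (J (c m) - J (c n))) \<longlonglongrightarrow> norm (y - J (c n))" by (intro tendsto_intros y)
    then have "norm (y - J (c n)) \<le> r n"
      by (rule LIMSEQ_le_const2) (use dist in blast)
    then show ?thesis using z c by (simp add: N_J J_diff)
  qed
  obtain C where C: "\<And>i. i \<in> K \<Longrightarrow> N (L i z) \<le> C" using pw[OF z(1)] by blast
  obtain n where n: "real n > C" using reals_Archimedean2 by blast
  obtain i where "i \<in> K" "real n \<le> N (L i z)" using big[of n] z(1) zc[of "Suc n"] by blast
  then show False using C[of i] n by simp
qed

section \<open>Integrals of functions with values in V\<close>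

lemma riemann_sum:
  fixes a b :: real
  assumes "\<D> tagged_division_of {a..b}" "\<And>s. s \<in> {a..b} \<Longrightarrow> f s \<in> V"
  shows "(\<Sum>(x, K)\<in>\<D>. measure lborel K *\<^sub>R f x) \<in> V"
    and "J (\<Sum>(x, K)\<in>\<D>. measure lborel K *\<^sub>R f x) = (\<Sum>(x, K)\<in>\<D>. measure lborel K *\<^sub>R J (f x))"
proof -
  have D: "finite \<D>" "\<And>x K. (x, K) \<in> \<D> \<Longrightarrow> f x \<in> V"
    using assms by (auto dest: tagged_division_ofD(1) tag_in_interval)
  have v: "(case p of (x, K) \<Rightarrow> measure lborel K *\<^sub>R f x) \<in> V" if "p \<in> \<D>" for p
    using D(2) that by (cases p) auto
  show "(\<Sum>(x, K)\<in>\<D>. measure lborel K *\<^sub>R f x) \<in> V" by (intro subspace_sum[OF V] v)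
  have "J (\<Sum>(x, K)\<in>\<D>. measure lborel K *\<^sub>R f x) = (\<Sum>p\<in>\<D>. J (case p of (x, K) \<Rightarrow> measure lborel K *\<^sub>R f x))"
    by (rule J_sum[OF D(1)]) (rule v)
  also have "\<dots> = (\<Sum>(x, K)\<in>\<D>. measure lborel K *\<^sub>R J (f x))"
    by (rule sum.cong[OF refl]) (use D(2) in \<open>auto simp: J_scale\<close>)
  finally show "J (\<Sum>(x, K)\<in>\<D>. measure lborel K *\<^sub>R f x) = (\<Sum>(x, K)\<in>\<D>. measure lborel K *\<^sub>R J (f x))" .
qed

text \<open>Both are gauge integrals over the same tagged divisions, and \<open>J\<close> maps
  Riemann sums to Riemann sums isometrically.\<close>

lemma has_integral_norm_iff:
  assumes f: "\<And>s. s \<in> {a..b} \<Longrightarrow> f s \<in> V" and y: "y \<in> V"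
  shows "has_integral_norm V N f y a b \<longleftrightarrow> ((\<lambda>s. J (f s)) has_integral J y) {a..b}"
proof -
  have "N ((\<Sum>(x, K)\<in>\<D>. measure lborel K *\<^sub>R f x) - y)
      = norm ((\<Sum>(x, K)\<in>\<D>. measure lborel K *\<^sub>R J (f x)) - J y)"
    if "\<D> tagged_division_of {a..b}" for \<D>
    using riemann_sum[of \<D> a b f, OF that f] y by (simp add: N_J J_diff)
  then show ?thesis
    unfolding has_integral_norm_def has_integral[of _ _ a b, unfolded box_real] using y by simp
qed

text \<open>Argued on Riemann sums in V, because an operator on V induces a map on the range of
  \<open>J\<close> only, not a bounded linear map of the target type.\<close>

lemma has_integral_norm_op:
  assumes L: "bounded_op L" and f: "\<And>s. s \<in> {a..b} \<Longrightarrow> f s \<in> V"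
    and int: "has_integral_norm V N f y a b"
  shows "has_integral_norm V N (\<lambda>s. L (f s)) (L y) a b"
  unfolding has_integral_norm_def
proof (intro conjI allI impI)
  have y: "y \<in> V" using int by (simp add: has_integral_norm_def)
  show "L y \<in> V" using L y by (simp add: bounded_op_def)
  obtain C where C: "C > 0" "\<And>x. x \<in> V \<Longrightarrow> N (L x) \<le> C * N x" by (rule bounded_op_bound[OF L]) blast
  fix e :: real assume "e > 0"
  then have "e / C > 0" using C by simp
  moreover have "\<forall>e>0. \<exists>\<gamma>. gauge \<gamma> \<and> (\<forall>\<D>. \<D> tagged_division_of {a..b} \<and> \<gamma> fine \<D> \<longrightarrow>
      N ((\<Sum>(x, K)\<in>\<D>. measure lborel K *\<^sub>R f x) - y) < e)"
    using int unfolding has_integral_norm_def by (rule conjunct2)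
  ultimately obtain \<gamma> where g: "gauge \<gamma>" "\<forall>\<D>. \<D> tagged_division_of {a..b} \<and> \<gamma> fine \<D> \<longrightarrow>
      N ((\<Sum>(x, K)\<in>\<D>. measure lborel K *\<^sub>R f x) - y) < e / C"
    by meson
  have L0: "L 0 = 0" using bounded_op_diff[OF L V_simps(1) V_simps(1)] by simp
  have Lsum: "L (sum g A) = (\<Sum>a\<in>A. L (g a))" if "finite A" "\<And>a. a \<in> A \<Longrightarrow> g a \<in> V" for g :: "real \<times> real set \<Rightarrow> 'a" and A
    using that
  proof (induction A rule: finite_induct)
    case (insert a A)
    have "L (g a + sum g A) = L (g a) + L (sum g A)"
      using L insert subspace_sum[OF V, of A g] unfolding bounded_op_def by blast
    then show ?case using insert by simp
  qed (simp add: L0)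
  have less: "N ((\<Sum>(x, K)\<in>\<D>. measure lborel K *\<^sub>R L (f x)) - L y) < e"
    if D0: "\<D> tagged_division_of {a..b}" "\<gamma> fine \<D>" for \<D>
  proof -
    have D: "finite \<D>" "\<And>x K. (x, K) \<in> \<D> \<Longrightarrow> x \<in> {a..b}"
      using that by (auto dest: tagged_division_ofD(1) tag_in_interval)
    have v: "(case p of (x, K) \<Rightarrow> measure lborel K *\<^sub>R f x) \<in> V" if "p \<in> \<D>" for p
      using D(2) f that by (cases p) auto
    let ?S = "\<Sum>(x, K)\<in>\<D>. measure lborel K *\<^sub>R f x"
    have S: "?S \<in> V" by (intro subspace_sum[OF V] v)
    have "L ?S = (\<Sum>p\<in>\<D>. L (case p of (x, K) \<Rightarrow> measure lborel K *\<^sub>R f x))"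
      by (rule Lsum[OF D(1)]) (rule v)
    also have "\<dots> = (\<Sum>(x, K)\<in>\<D>. measure lborel K *\<^sub>R L (f x))"
      by (rule sum.cong[OF refl]) (use D(2) f L in \<open>auto simp: bounded_op_def\<close>)
    finally have "L ?S = (\<Sum>(x, K)\<in>\<D>. measure lborel K *\<^sub>R L (f x))" .
    then have "N ((\<Sum>(x, K)\<in>\<D>. measure lborel K *\<^sub>R L (f x)) - L y) = N (L (?S - y))"
      using bounded_op_diff[OF L S y] by simp
    also have "\<dots> \<le> C * N (?S - y)" using C S y by simp
    also have "\<dots> < C * (e / C)" using g(2)[rule_format, OF conjI[OF D0]] C by (intro mult_strict_left_mono) auto
    finally show ?thesis using C by simp
  qed
  show "\<exists>\<gamma>. gauge \<gamma> \<and> (\<forall>\<D>. \<D> tagged_division_of {a..b} \<and> \<gamma> fine \<D> \<longrightarrow>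
      N ((\<Sum>(x, K)\<in>\<D>. measure lborel K *\<^sub>R L (f x)) - L y) < e)"
    by (intro exI[of _ \<gamma>] conjI allI impI g(1)) (elim conjE, rule less)
qed

lemma has_integral_norm_add:
  assumes "\<And>s. s \<in> {a..b} \<Longrightarrow> f s \<in> V" "\<And>s. s \<in> {a..b} \<Longrightarrow> g s \<in> V"
    and "has_integral_norm V N f y a b" "has_integral_norm V N g z a b"
  shows "has_integral_norm V N (\<lambda>s. f s + g s) (y + z) a b"
proof -
  have yz: "y \<in> V" "z \<in> V" using assms(3,4) by (auto simp: has_integral_norm_def)
  have "((\<lambda>s. J (f s)) has_integral J y) {a..b}" "((\<lambda>s. J (g s)) has_integral J z) {a..b}"
    using assms(3,4) has_integral_norm_iff[of a b f, OF assms(1) yz(1)]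
      has_integral_norm_iff[of a b g, OF assms(2) yz(2)] by simp_all
  from has_integral_add[OF this]
  have "((\<lambda>s. J (f s + g s)) has_integral J (y + z)) {a..b}"
    unfolding J_add[OF yz] by (rule has_integral_eq[rotated]) (use assms(1,2) J_add in auto)
  moreover have "f s + g s \<in> V" if "s \<in> {a..b}" for s using assms(1,2)[OF that] by (rule V_simps)
  ultimately show ?thesis
    using has_integral_norm_iff[of a b "\<lambda>s. f s + g s" "y + z"] V_simps(2)[OF yz] by simp
qed

text \<open>Riemann sums stay in V and approximate the integral arbitrarily well, so closedness of
  the range of \<open>J\<close> puts the integral into that range.\<close>

lemma integral_in_V:
  fixes a b :: real
  assumes f: "\<And>s. s \<in> {a..b} \<Longrightarrow> f s \<in> V" and int: "((\<lambda>s. J (f s)) has_integral I) {a..b}"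
  shows "\<exists>y\<in>V. J y = I"
proof -
  have "\<exists>y\<in>J ` V. dist y I < e" if e: "e > 0" for e
  proof -
    have "\<forall>e>0. \<exists>\<gamma>. gauge \<gamma> \<and> (\<forall>\<D>. \<D> tagged_division_of {a..b} \<and> \<gamma> fine \<D> \<longrightarrow>
      norm ((\<Sum>(x, K)\<in>\<D>. measure lborel K *\<^sub>R J (f x)) - I) < e)"
      using int unfolding box_real(2)[symmetric] has_integral by assumption
    then obtain \<gamma> where g: "gauge \<gamma>" "\<forall>\<D>. \<D> tagged_division_of {a..b} \<and> \<gamma> fine \<D> \<longrightarrow>
      norm ((\<Sum>(x, K)\<in>\<D>. measure lborel K *\<^sub>R J (f x)) - I) < e"
      using e by meson
    obtain \<D> where D0: "\<D> tagged_division_of {a..b}" "\<gamma> fine \<D>"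
      using fine_division_exists_real[OF g(1)] by blast
    have "(\<Sum>(x, K)\<in>\<D>. measure lborel K *\<^sub>R f x) \<in> V"
      "J (\<Sum>(x, K)\<in>\<D>. measure lborel K *\<^sub>R f x) = (\<Sum>(x, K)\<in>\<D>. measure lborel K *\<^sub>R J (f x))"
      using riemann_sum[of \<D> a b f, OF D0(1) f] by simp_all
    then show ?thesis using g(2)[rule_format, OF conjI[OF D0]]
      by (intro bexI[of _ "J (\<Sum>(x, K)\<in>\<D>. measure lborel K *\<^sub>R f x)"] imageI) (simp_all add: dist_norm)
  qed
  then have "I \<in> J ` V" using closed_approachable[OF J_closed] by blast
  then show ?thesis by auto
qed

end

lemma vector_derivative_at_right:
  fixes G :: "real \<Rightarrow> 'b::real_normed_vector"
  assumes G: "(G has_vector_derivative D) (at c within {0..K})" and c: "0 \<le> c" "c < K"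
  shows "((\<lambda>t. (1 / t) *\<^sub>R (G (c + t) - G c)) \<longlongrightarrow> D) (at_right 0)"
proof (rule tendstoI)
  fix e :: real assume "e > 0"
  then have "e / 2 > 0" by simp
  then obtain d where d: "d > 0" "\<And>y. y \<in> {0..K} \<Longrightarrow> \<bar>y - c\<bar> < d \<Longrightarrow>
      norm (G y - G c - (y - c) *\<^sub>R D) \<le> e / 2 * \<bar>y - c\<bar>"
    using G unfolding has_vector_derivative_def has_derivative_within_alt real_norm_def by blast
  have "\<forall>\<^sub>F t in at_right 0. t \<in> {0<..<min d (K - c)}"
    by (rule eventually_at_right_real) (use d c in auto)
  then show "\<forall>\<^sub>F t in at_right 0. dist ((1 / t) *\<^sub>R (G (c + t) - G c)) D < e"
  proof eventually_elim
    case (elim t)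
    have t: "t > 0" "t < d" "c + t \<in> {0..K}" using elim c by auto
    have "(1 / t) *\<^sub>R (G (c + t) - G c) - D = (1 / t) *\<^sub>R (G (c + t) - G c - t *\<^sub>R D)"
      using t by (simp add: scaleR_diff_right)
    then have "dist ((1 / t) *\<^sub>R (G (c + t) - G c)) D = (1 / t) * norm (G (c + t) - G c - t *\<^sub>R D)"
      using t by (simp add: dist_norm)
    also have "\<dots> \<le> (1 / t) * (e / 2 * t)" using d(2)[OF t(3)] t by (intro mult_left_mono) auto
    also have "\<dots> < e" using t \<open>e > 0\<close> by simp
    finally show ?case .
  qed
qed

locale semigroup_on = normed_subspace V N J
  for V :: "'a::real_vector set" and N and J :: "'a \<Rightarrow> 'b::banach" +
  fixes T :: "real \<Rightarrow> 'a \<Rightarrow> 'a"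
  assumes T: "strongly_continuous_semigroup V N T"
begin

lemma T_in [simp]: "t \<ge> 0 \<Longrightarrow> x \<in> V \<Longrightarrow> T t x \<in> V"
  and T_add: "t \<ge> 0 \<Longrightarrow> x \<in> V \<Longrightarrow> y \<in> V \<Longrightarrow> T t (x + y) = T t x + T t y"
  and T_scale: "t \<ge> 0 \<Longrightarrow> x \<in> V \<Longrightarrow> T t (c *\<^sub>R x) = c *\<^sub>R T t x"
  and T_0: "x \<in> V \<Longrightarrow> T 0 x = x"
  and T_T: "s \<ge> 0 \<Longrightarrow> t \<ge> 0 \<Longrightarrow> x \<in> V \<Longrightarrow> T (s + t) x = T s (T t x)"
  and T_cont0: "x \<in> V \<Longrightarrow> ((\<lambda>t. N (T t x - x)) \<longlongrightarrow> 0) (at_right 0)"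
  using T by (auto simp: strongly_continuous_semigroup_def)

lemma T_op: "t \<ge> 0 \<Longrightarrow> bounded_op (T t)"
  using T by (auto simp: strongly_continuous_semigroup_def bounded_op_def)

lemma T_diff: "t \<ge> 0 \<Longrightarrow> x \<in> V \<Longrightarrow> y \<in> V \<Longrightarrow> T t (x - y) = T t x - T t y"
  using bounded_op_diff[OF T_op] .

section \<open>Local boundedness and strong continuity\<close>

lemma T_small:
  assumes "x \<in> V" "e > 0"
  obtains d where "d > 0" "\<And>t. 0 \<le> t \<Longrightarrow> t < d \<Longrightarrow> N (T t x - x) < e"
proof -
  obtain d where d: "d > 0" "\<And>t. 0 < t \<Longrightarrow> t < d \<Longrightarrow> N (T t x - x) < e"
    using order_tendstoD(2)[OF T_cont0[OF assms(1)] assms(2)]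
    unfolding eventually_at_right_field by auto
  have "N (T t x - x) < e" if "0 \<le> t" "t < d" for t
    using d(2)[of t] that assms by (cases "t = 0") (auto simp: T_0 N_zero)
  with d(1) that show ?thesis by blast
qed

text \<open>Otherwise there are times \<tau> n tending to 0 at which the operator bound n fails.
  Each orbit stays bounded along these times by right continuity at 0, which contradicts uniform
  boundedness.\<close>

lemma T_locally_bounded:
  "\<exists>d>0. \<exists>M. \<forall>t\<in>{0..d}. \<forall>x\<in>V. N (T t x) \<le> M * N x"
proof (rule ccontr)
  assume "\<not> ?thesis"
  then have "\<forall>n. \<exists>t\<in>{0..inverse (real (Suc n))}. \<exists>x\<in>V. \<not> N (T t x) \<le> real n * N x"
    by (metis inverse_positive_iff_positive of_nat_0_less_iff zero_less_Suc)
  then obtain \<tau> where \<tau>: "\<And>n. \<tau> n \<in> {0..inverse (real (Suc n))}"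
    "\<And>n. \<exists>x\<in>V. \<not> N (T (\<tau> n) x) \<le> real n * N x" by metis
  have "\<exists>C. \<forall>n\<in>UNIV. \<forall>x\<in>V. N (T (\<tau> n) x) \<le> C * N x"
  proof (rule uniform_boundedness)
    show "bounded_op (T (\<tau> n))" for n using \<tau>(1)[of n] by (intro T_op) auto
    fix x assume x: "x \<in> V"
    obtain d where d: "d > 0" "\<And>t. 0 \<le> t \<Longrightarrow> t < d \<Longrightarrow> N (T t x - x) < 1"
      by (rule T_small[OF x]) (auto intro: that)
    obtain n0 where n0: "inverse (real (Suc n0)) < d" using reals_Archimedean[OF d(1)] by blast
    \<comment> \<open>From index \<open>n0\<close> on the orbit is within 1 of x; the sum takes care
      of the finitely many earlier times.\<close>
    define C where "C = N x + 1 + (\<Sum>n<n0. N (T (\<tau> n) x))"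
    have Tn: "T (\<tau> n) x \<in> V" for n using \<tau>(1)[of n] x by auto
    have sn: "0 \<le> (\<Sum>n<n0. N (T (\<tau> n) x))" by (intro sum_nonneg N_nonneg Tn)
    have "N (T (\<tau> n) x) \<le> C" for n
    proof (cases "n < n0")
      case True
      then have "N (T (\<tau> n) x) \<le> (\<Sum>n<n0. N (T (\<tau> n) x))"
        using Tn by (intro member_le_sum) (auto intro: N_nonneg)
      then show ?thesis using N_nonneg[OF x] by (simp add: C_def)
    next
      case False
      then have "inverse (real (Suc n)) \<le> inverse (real (Suc n0))" by simp
      then have "\<tau> n < d" "0 \<le> \<tau> n" using \<tau>(1)[of n] n0 unfolding atLeastAtMost_iff by linarith+
      then have "N (T (\<tau> n) x - x) < 1" using d by simp
      moreover have "N (T (\<tau> n) x) \<le> N (T (\<tau> n) x - x) + N x"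
        using N_add[OF V_simps(3)[OF Tn[of n] x] x] by simp
      ultimately show ?thesis using sn by (simp add: C_def)
    qed
    then show "\<exists>C. \<forall>n\<in>UNIV. N (T (\<tau> n) x) \<le> C" by blast
  qed
  then obtain C where C: "\<And>n x. x \<in> V \<Longrightarrow> N (T (\<tau> n) x) \<le> C * N x" by blast
  obtain n where "real n > C" using reals_Archimedean2 by blast
  moreover obtain x where "x \<in> V" "\<not> N (T (\<tau> n) x) \<le> real n * N x" using \<tau>(2) by blast
  ultimately show False using C[of x n] mult_right_mono[of C "real n" "N x"] N_nonneg[of x] by linarith
qed

lemma T_bounded_on:
  obtains M where "M > 0" "\<And>t x. 0 \<le> t \<Longrightarrow> t \<le> K \<Longrightarrow> x \<in> V \<Longrightarrow> N (T t x) \<le> M * N x"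
proof -
  obtain d M0 where d: "d > 0" and M0: "\<And>t x. t \<in> {0..d} \<Longrightarrow> x \<in> V \<Longrightarrow> N (T t x) \<le> M0 * N x"
    using T_locally_bounded by blast
  \<comment> \<open>At least 1, so that the bounds \<open>M ^ Suc n\<close> increase with n and
    cover shorter times as well.\<close>
  define M where "M = max 1 M0"
  have M: "N (T t x) \<le> M * N x" if "t \<in> {0..d}" "x \<in> V" for t x
    using M0[OF that] mult_right_mono[of M0 M "N x"] N_nonneg[OF that(2)] by (simp add: M_def)
  have "M \<ge> 1" by (simp add: M_def)
  have *: "\<forall>t x. 0 \<le> t \<longrightarrow> t \<le> real n * d \<longrightarrow> x \<in> V \<longrightarrow> N (T t x) \<le> M ^ Suc n * N x" for n
  proof (induction n)
    case 0
    then show ?case using M d by auto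
  next
    case (Suc n)
    show ?case
    proof (intro allI impI)
      fix t x assume t: "0 \<le> t" "t \<le> real (Suc n) * d" and x: "x \<in> V"
      show "N (T t x) \<le> M ^ Suc (Suc n) * N x"
      proof (cases "t \<le> d")
        case True
        then have "N (T t x) \<le> M * N x" using M t x by auto
        also have "\<dots> \<le> M ^ Suc (Suc n) * N x"
          using \<open>M \<ge> 1\<close> N_nonneg[OF x] power_increasing[of 1 "Suc (Suc n)" M] by (intro mult_right_mono) auto
        finally show ?thesis .
      next
        case False
        have "T t x = T d (T (t - d) x)" using T_T[of d "t - d" x] d False x by simp
        then have "N (T t x) \<le> M * N (T (t - d) x)" using M[of d "T (t - d) x"] d False x by simp
        also have "\<dots> \<le> M * (M ^ Suc n * N x)"
          using Suc[rule_format, of "t - d" x] False t x \<open>M \<ge> 1\<close> by (intro mult_left_mono) (auto simp: algebra_simps)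
        finally show ?thesis by (simp add: mult.assoc)
      qed
    qed
  qed
  obtain n where "K < real n * d" using reals_Archimedean3[OF d] by blast
  then show ?thesis using that[of "M ^ Suc n"] *[of n] \<open>M \<ge> 1\<close> by force
qed

text \<open>Only right continuity at 0 is given. Factoring out the smaller time, T b x - T a x = T a
  (T (b - a) x - x), reduces both sides of a point to it, with the local bound controlling T
  a.\<close>

lemma T_continuous:
  assumes x: "x \<in> V" shows "continuous_on {0..} (\<lambda>t. J (T t x))"
  unfolding continuous_on_iff
proof (intro ballI allI impI)
  fix s e :: real assume s: "s \<in> {0..}" and e: "e > 0"
  obtain M where M: "M > 0" "\<And>t x. 0 \<le> t \<Longrightarrow> t \<le> s + 1 \<Longrightarrow> x \<in> V \<Longrightarrow> N (T t x) \<le> M * N x"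
    by (rule T_bounded_on[of "s + 1"]) blast
  obtain d where d: "d > 0" "\<And>t. 0 \<le> t \<Longrightarrow> t < d \<Longrightarrow> N (T t x - x) < e / M"
    by (rule T_small[OF x, of "e / M"]) (use e M in \<open>auto intro: that\<close>)
  have key: "N (T b x - T a x) < e" if "0 \<le> a" "a \<le> b" "b < a + d" "a \<le> s + 1" for a b
  proof -
    have "T b x - T a x = T a (T (b - a) x - x)"
      using that x T_T[of a "b - a" x] T_diff[of a "T (b - a) x" x] by simp
    then have "N (T b x - T a x) \<le> M * N (T (b - a) x - x)"
      using M(2)[of a "T (b - a) x - x"] that x by simp
    also have "\<dots> < M * (e / M)" using d(2)[of "b - a"] that M by (intro mult_strict_left_mono) auto
    finally show ?thesis using M by simp
  qed
  show "\<exists>d>0. \<forall>s'\<in>{0..}. dist s' s < d \<longrightarrow> dist (J (T s' x)) (J (T s x)) < e"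
  proof (intro exI[of _ "min d 1"] conjI ballI impI)
    fix s' :: real assume s': "s' \<in> {0..}" "dist s' s < min d 1"
    have "dist (J (T s' x)) (J (T s x)) = N (T s' x - T s x)"
      using s s' x by (simp add: dist_norm N_J J_diff)
    also have "\<dots> < e"
      using key[of s s'] key[of s' s] s s' N_minus_commute[of "T s' x" "T s x"] x
      by (cases "s \<le> s'") (auto simp: dist_real_def)
    finally show "dist (J (T s' x)) (J (T s x)) < e" .
  qed (use d in auto)
qed

text \<open>\<open>Y h\<close> is the integral of \<open>T s x\<close> over [0, h]. Its averages
  converge to x, and T t (Y h) - Y h is the integral over [h, h + t] minus that over [0, t], whose
  quotient by t converges to T h x - x. This is the standard supply of elements of the
  domain.\<close>

lemma T_integral:
  assumes x: "x \<in> V"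
  obtains Y where "\<And>h. h > 0 \<Longrightarrow> Y h \<in> V"
    "\<And>h. h > 0 \<Longrightarrow> ((\<lambda>t. N ((1 / t) *\<^sub>R (T t (Y h) - Y h) - (T h x - x))) \<longlongrightarrow> 0) (at_right 0)"
    "((\<lambda>h. N ((1 / h) *\<^sub>R Y h - x)) \<longlongrightarrow> 0) (at_right 0)"
proof -
  define g where "g = (\<lambda>s. J (T s x))"
  define G where "G u = integral {0..u} g" for u
  have g: "continuous_on {0..K} g" for K
    using T_continuous[OF x] unfolding g_def by (rule continuous_on_subset) auto
  have int: "(g has_integral G h) {0..h}" for h
    unfolding G_def by (rule integrable_integral[OF integrable_continuous_real[OF g]])
  have "\<exists>y\<in>V. J y = G h" for h
    using int[of h] x unfolding g_def by (intro integral_in_V) auto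
  then obtain Y where Y: "\<And>h. Y h \<in> V" "\<And>h. J (Y h) = G h" by metis
  have deriv: "(G has_vector_derivative g c) (at c within {0..K})" if "c \<in> {0..K}" for c K
    unfolding G_def by (rule integral_has_vector_derivative[OF g that])
  have right: "((\<lambda>t. (1 / t) *\<^sub>R (G (c + t) - G c)) \<longlongrightarrow> g c) (at_right 0)" if "c \<ge> 0" for c
    by (rule vector_derivative_at_right[OF deriv[of c "c + 1"]]) (use that in auto)
  have G0: "G 0 = 0" by (simp add: G_def)
  have g0: "g 0 = J x" using x by (simp add: g_def T_0)
  have 1: "((\<lambda>h. N ((1 / h) *\<^sub>R Y h - x)) \<longlongrightarrow> 0) (at_right 0)"
  proof -
    have "((\<lambda>h. J ((1 / h) *\<^sub>R Y h)) \<longlongrightarrow> J x) (at_right 0)"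
      using right[of 0] by (simp add: G0 g0 J_scale Y)
    then show ?thesis by (subst (asm) J_tendsto) (auto simp: Y x)
  qed
  have 2: "((\<lambda>t. N ((1 / t) *\<^sub>R (T t (Y h) - Y h) - (T h x - x))) \<longlongrightarrow> 0) (at_right 0)" if h: "h > 0" for h
  proof -
    \<comment> \<open>\<open>T t\<close> is moved under the integral, where it shifts the orbit by
      t; the primitive \<open>G\<close> evaluates the shifted integral.\<close>
    have JT: "J (T t (Y h)) = G (h + t) - G t" if t: "t > 0" for t
    proof -
      have "has_integral_norm V N (\<lambda>s. T s x) (Y h) 0 h"
        by (subst has_integral_norm_iff) (use x Y int[of h] in \<open>auto simp: g_def\<close>)
      then have "has_integral_norm V N (\<lambda>s. T t (T s x)) (T t (Y h)) 0 h"
        by (rule has_integral_norm_op[OF T_op, rotated 2]) (use t x in auto)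
      then have "((\<lambda>s. J (T t (T s x))) has_integral J (T t (Y h))) {0..h}"
        by (subst (asm) has_integral_norm_iff) (use t x Y in auto)
      moreover have "J (T t (T s x)) = g (s + t)" if "s \<in> {0..h}" for s
        using T_T[of t s x] that t x by (simp add: g_def add.commute)
      ultimately have a: "((\<lambda>s. g (s + t)) has_integral J (T t (Y h))) {0..h}"
        by (rule has_integral_eq[rotated])
      have b: "((\<lambda>s. g (s + t)) has_integral G (h + t) - G (0 + t)) {0..h}"
      proof (rule fundamental_theorem_of_calculus)
        fix s assume s: "s \<in> {0..h}"
        have "((\<lambda>s. s + t) has_vector_derivative 1) (at s within {0..h})"
          by (auto intro!: derivative_eq_intros)
        moreover have "(G has_vector_derivative g (s + t)) (at (s + t) within (\<lambda>s. s + t) ` {0..h})"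
          by (rule has_vector_derivative_within_subset[OF deriv[of _ "h + t"]]) (use s t in auto)
        ultimately have "(G \<circ> (\<lambda>s. s + t) has_vector_derivative 1 *\<^sub>R g (s + t)) (at s within {0..h})"
          by (rule vector_diff_chain_within)
        then show "((\<lambda>s. G (s + t)) has_vector_derivative g (s + t)) (at s within {0..h})"
          by (simp add: o_def)
      qed (use h in simp)
      show ?thesis using has_integral_unique[OF a b] by simp
    qed
    have "((\<lambda>t. (1 / t) *\<^sub>R (G (h + t) - G h) - (1 / t) *\<^sub>R (G (0 + t) - G 0)) \<longlongrightarrow> g h - g 0) (at_right 0)"
      using h by (intro tendsto_diff right) auto
    moreover have "\<forall>\<^sub>F t in at_right 0. (1 / t) *\<^sub>R (G (h + t) - G h) - (1 / t) *\<^sub>R (G (0 + t) - G 0)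
        = J ((1 / t) *\<^sub>R (T t (Y h) - Y h))"
      unfolding eventually_at_right_field
      by (intro exI[of _ 1]) (auto simp: J_scale J_diff JT Y G0 algebra_simps)
    ultimately have "((\<lambda>t. J ((1 / t) *\<^sub>R (T t (Y h) - Y h))) \<longlongrightarrow> g h - g 0) (at_right 0)"
      by (rule Lim_transform_eventually)
    moreover have "g h - g 0 = J (T h x - x)" using x h by (simp add: g_def J_diff T_0)
    ultimately have *: "((\<lambda>t. J ((1 / t) *\<^sub>R (T t (Y h) - Y h))) \<longlongrightarrow> J (T h x - x)) (at_right 0)" by simp
    have "\<forall>\<^sub>F t in at_right 0. (1 / t) *\<^sub>R (T t (Y h) - Y h) \<in> V"
      unfolding eventually_at_right_field by (intro exI[of _ 1]) (auto simp: Y)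
    then show ?thesis using * x h by (subst (asm) J_tendsto) auto
  qed
  show ?thesis by (rule that[OF Y(1) 2 1])
qed

text \<open>The variation of constants formula is restarted at time t: x (t + h) - T h (x t) is the
  integral of T (t + h - s) (f s) over [t, t + h], where the integrand is close to
  \<open>fp\<close>. The comparison is with T h (x t) rather than with x t because the orbit of x t
  may fail to be differentiable.\<close>

lemma mild_step:
  assumes x0: "x0 \<in> V" and f: "\<And>s. s \<ge> 0 \<Longrightarrow> f s \<in> V" and fp: "fp \<in> V"
    and mild: "\<And>t. t \<ge> 0 \<Longrightarrow> \<exists>y. has_integral_norm V N (\<lambda>s. T (t - s) (f s)) y 0 t \<and> x t = T t x0 + y"
    and lim: "((\<lambda>s. N (f s - fp)) \<longlongrightarrow> 0) (at_right t)" and t: "t \<ge> 0"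
  shows "((\<lambda>h. N ((1 / h) *\<^sub>R (x (t + h) - T h (x t)) - fp)) \<longlongrightarrow> 0) (at_right 0)"
proof -
  obtain y where y: "\<And>t. t \<ge> 0 \<Longrightarrow> has_integral_norm V N (\<lambda>s. T (t - s) (f s)) (y t) 0 t"
    "\<And>t. t \<ge> 0 \<Longrightarrow> x t = T t x0 + y t" using mild by metis
  have yV: "y t \<in> V" if "t \<ge> 0" for t using y(1)[OF that] by (simp add: has_integral_norm_def)
  obtain M where M: "M > 0" "\<And>r x. 0 \<le> r \<Longrightarrow> r \<le> 1 \<Longrightarrow> x \<in> V \<Longrightarrow> N (T r x) \<le> M * N x"
    by (rule T_bounded_on[of 1]) blast
  have main: "\<forall>\<^sub>F h in at_right 0. N ((1 / h) *\<^sub>R (x (t + h) - T h (x t)) - fp) \<le> e" if e: "e > 0" for e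
  proof -
    \<comment> \<open>Half of e is for T r (f s - fp), where T r enlarges by at most the factor M,
      and half for T r fp - fp.\<close>
    have "e / 2 / M > 0" using e M by simp
    then obtain d1 where d1: "d1 > t" "\<And>s. t < s \<Longrightarrow> s < d1 \<Longrightarrow> N (f s - fp) < e / 2 / M"
      using order_tendstoD(2)[OF lim] unfolding eventually_at_right_field by blast
    obtain d2 where d2: "d2 > 0" "\<And>r. 0 \<le> r \<Longrightarrow> r < d2 \<Longrightarrow> N (T r fp - fp) < e / 2"
      by (rule T_small[OF fp, of "e / 2"]) (use e in \<open>auto intro: that\<close>)
    have "\<forall>\<^sub>F h in at_right 0. h \<in> {0<..<min (d1 - t) (min d2 1)}"
      by (rule eventually_at_right_real) (use d1 d2 in auto)
    then show ?thesis
    proof eventually_elim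
      case (elim h)
      have h: "0 < h" "h < d1 - t" "h < d2" "h < 1" using elim by auto
      define g where "g = (\<lambda>s. J (T (t + h - s) (f s)))"
      have "has_integral_norm V N (\<lambda>s. T (t + h - s) (f s)) (y (t + h)) 0 (t + h)"
        using t h by (intro y(1)) simp
      then have int1: "(g has_integral J (y (t + h))) {0..t + h}"
        using t h f yV unfolding g_def by (subst (asm) has_integral_norm_iff) auto
      have "has_integral_norm V N (\<lambda>s. T h (T (t - s) (f s))) (T h (y t)) 0 t"
        by (rule has_integral_norm_op[OF T_op _ y(1)[OF t]]) (use f h in auto)
      then have "((\<lambda>s. J (T h (T (t - s) (f s)))) has_integral J (T h (y t))) {0..t}"
        using f h yV t by (subst (asm) has_integral_norm_iff) auto
      moreover have "J (T h (T (t - s) (f s))) = g s" if "s \<in> {0..t}" for s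
        using T_T[of h "t - s" "f s"] that h f by (simp add: g_def algebra_simps)
      ultimately have int2: "(g has_integral J (T h (y t))) {0..t}"
        by (rule has_integral_eq[rotated])
      have "g integrable_on {t..t + h}"
        by (rule integrable_subinterval_real[OF has_integral_integrable[OF int1]]) (use t in auto)
      then obtain I where I: "(g has_integral I) {t..t + h}" by blast
      have "(g has_integral J (T h (y t)) + I) {0..t + h}"
        by (rule has_integral_combine[OF _ _ int2 I]) (use t h in auto)
      then have "J (y (t + h)) = J (T h (y t)) + I" using has_integral_unique[OF int1] by simp
      moreover have "x (t + h) - T h (x t) = y (t + h) - T h (y t)"
        using y(2)[of "t + h"] y(2)[OF t] T_T[of h t x0] T_add[of h "T t x0" "y t"] t h x0 yV[OF t]
        by (simp add: add.commute)
      ultimately have JI: "J (x (t + h) - T h (x t)) = I"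
        using yV t h by (simp add: J_diff)
      have xV: "x (t + h) - T h (x t) \<in> V" using y(2) yV x0 t h by simp
      have "((\<lambda>s. g s - J fp) has_integral I - measure lborel {t..t + h} *\<^sub>R J fp) {t..t + h}"
        by (intro has_integral_diff I has_integral_const_real)
      then have "norm (I - measure lborel {t..t + h} *\<^sub>R J fp) \<le> e * measure lborel {t..t + h}"
        unfolding box_real(2)[symmetric]
      proof (rule has_integral_bound_spike_finite[rotated 2, where S="{t}"])
        \<comment> \<open>The point s = t is exempted, since the right limit of f says nothing about
          f t.\<close>
        fix s assume "s \<in> cbox t (t + h) - {t}"
        then have s: "t < s" "s \<le> t + h" by auto
        define r where "r = t + h - s"
        have r: "0 \<le> r" "r < h" using s by (auto simp: r_def)
        have fs: "f s \<in> V" using f s t by simp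
        have "N (T r (f s) - fp) \<le> N (T r (f s - fp)) + N (T r fp - fp)"
          using N_add[of "T r (f s - fp)" "T r fp - fp"] r fs fp T_diff[of r "f s" fp] by simp
        also have "N (T r (f s - fp)) \<le> M * N (f s - fp)" using M(2) r h fs fp by simp
        also have "M * N (f s - fp) \<le> M * (e / 2 / M)"
          using d1(2)[of s] s h M by (intro mult_left_mono) auto
        also have "N (T r fp - fp) \<le> e / 2" using d2(2)[of r] r h by simp
        finally have "N (T r (f s) - fp) \<le> e" using M by simp
        then show "norm (g s - J fp) \<le> e"
          using r fs fp by (simp add: g_def r_def[symmetric] N_J J_diff)
      qed (use e in auto)
      then have Ib: "norm (I - h *\<^sub>R J fp) \<le> e * h" using h by simp
      have "N ((1 / h) *\<^sub>R (x (t + h) - T h (x t)) - fp) = (1 / h) * norm (I - h *\<^sub>R J fp)"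
      proof -
        have "N ((1 / h) *\<^sub>R (x (t + h) - T h (x t)) - fp) = norm ((1 / h) *\<^sub>R I - J fp)"
          using xV fp by (simp add: N_J J_diff J_scale JI)
        also have "(1 / h) *\<^sub>R I - J fp = (1 / h) *\<^sub>R (I - h *\<^sub>R J fp)"
          using h by (simp add: scaleR_diff_right)
        finally show ?thesis using h by simp
      qed
      also have "\<dots> \<le> (1 / h) * (e * h)" using Ib h by (intro mult_left_mono) auto
      finally show ?case using h by simp
    qed
  qed
  show ?thesis
  proof (rule tendstoI)
    fix e :: real assume "e > 0"
    then have "\<forall>\<^sub>F h in at_right 0. N ((1 / h) *\<^sub>R (x (t + h) - T h (x t)) - fp) \<le> e / 2" by (intro main) simp
    moreover have "\<forall>\<^sub>F h in at_right 0. (1 / h) *\<^sub>R (x (t + h) - T h (x t)) - fp \<in> V"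
      unfolding eventually_at_right_field by (intro exI[of _ 1]) (use y(2) yV x0 t fp in auto)
    ultimately show "\<forall>\<^sub>F h in at_right 0. dist (N ((1 / h) *\<^sub>R (x (t + h) - T h (x t)) - fp)) 0 < e"
      by eventually_elim (use N_nonneg \<open>e > 0\<close> in \<open>auto simp: dist_real_def\<close>)
  qed
qed

end

section \<open>A differential inequality\<close>

text \<open>Comparison with \<open>m\<close>, the solution of m' = K - c m + c e started at g 0 + e.
  If g crossed m, the two would agree at the last time of g \<le> m, but there m increases strictly
  faster than g is allowed to. Letting e tend to 0 removes the slack.\<close>

lemma dini_exponential_bound:
  fixes g :: "real \<Rightarrow> real"
  assumes cont: "continuous_on {0..} g" and c: "c > 0"
    and dini: "\<And>t \<eta>. t \<ge> 0 \<Longrightarrow> \<eta> > 0 \<Longrightarrow> \<forall>\<^sub>F h in at_right 0. g (t + h) \<le> g t + h * (K - c * g t + \<eta>)"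
    and t: "t \<ge> 0"
  shows "g t \<le> exp (- c * t) * (g 0 - K / c) + K / c"
proof (rule field_le_epsilon)
  fix e :: real assume e: "e > 0"
  define m where "m s = exp (- c * s) * (g 0 - K / c) + K / c + e" for s
  have m_deriv: "(m has_real_derivative K - c * m s + c * e) (at s)" for s
    unfolding m_def using c by (auto intro!: derivative_eq_intros simp: algebra_simps)
  have m_cont: "continuous_on S m" for S
    using m_deriv by (meson DERIV_isCont continuous_at_imp_continuous_on)
  \<comment> \<open>Times up to which the comparison holds throughout. It still holds at the
    supremum by continuity, and beyond it unless the supremum is t.\<close>
  define B where "B = {s\<in>{0..t}. \<forall>r\<in>{0..s}. g r \<le> m r}"
  have "0 \<in> B" using t e by (simp add: B_def m_def)
  have Bbdd: "bdd_above B" by (auto simp: B_def bdd_above_def)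
  define s where "s = Sup B"
  have s: "0 \<le> s" "s \<le> t"
  proof -
    show "0 \<le> s" unfolding s_def by (rule cSup_upper[OF \<open>0 \<in> B\<close> Bbdd])
    show "s \<le> t" unfolding s_def
    proof (rule cSup_least)
      show "B \<noteq> {}" using \<open>0 \<in> B\<close> by blast
    qed (simp add: B_def)
  qed
  have below: "g r \<le> m r" if r: "0 \<le> r" "r < s" for r
  proof -
    have "B \<noteq> {}" using \<open>0 \<in> B\<close> by blast
    then obtain b where "b \<in> B" "r < b" using less_cSup_iff[OF _ Bbdd, of r] r unfolding s_def by blast
    then show ?thesis using r by (auto simp: B_def)
  qed
  have at_s: "g s \<le> m s"
  proof (cases "s = 0")
    case True
    then show ?thesis using e by (simp add: m_def)
  next
    case False
    then have "s > 0" using s by simp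
    have "continuous_on (closure {0..<s}) (\<lambda>r. m r - g r)"
      using \<open>s > 0\<close> by (intro continuous_intros m_cont continuous_on_subset[OF cont]) auto
    moreover have "s \<in> closure {0..<s}" using \<open>s > 0\<close> by simp
    ultimately have "m s - g s \<ge> 0"
      by (rule continuous_ge_on_closure) (use below in auto)
    then show ?thesis by simp
  qed
  have "s = t"
  proof (rule ccontr)
    assume "s \<noteq> t"
    then have "s < t" using s by simp
    have "\<forall>\<^sub>F h in at_right 0. g (s + h) \<le> m (s + h)"
    proof (cases "g s = m s")
      case True
      \<comment> \<open>The slack c e is halved: one half is given up in the difference quotient of
        \<open>m\<close>, the other is the \<eta> granted to \<open>g\<close>.\<close>
      have "((\<lambda>h. (m (s + h) - m s) / h) \<longlongrightarrow> K - c * m s + c * e) (at_right 0)"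
        using m_deriv[of s] unfolding DERIV_def by (rule tendsto_mono[OF at_le, rotated]) simp
      then have "\<forall>\<^sub>F h in at_right 0. K - c * m s + c * e - c * e / 2 < (m (s + h) - m s) / h"
        by (rule order_tendstoD) (use c e in simp)
      moreover have "\<forall>\<^sub>F h in at_right 0. g (s + h) \<le> g s + h * (K - c * g s + c * e / 2)"
        by (rule dini) (use s c e in auto)
      moreover have "\<forall>\<^sub>F h in at_right (0::real). h > 0" by (simp add: eventually_at_right_less)
      ultimately show ?thesis
      proof eventually_elim
        case (elim h)
        have "h * (K - c * m s + c * e / 2) < m (s + h) - m s"
          using elim(1,3) by (simp add: field_simps)
        then show ?case using elim(2) True by simp
      qed
    next
      case False
      then have "g s - m s < 0" using at_s by simp
      have "continuous_on {s..} (\<lambda>r. g r - m r)"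
        by (intro continuous_intros m_cont continuous_on_subset[OF cont]) (use s in auto)
      then have "((\<lambda>r. g r - m r) \<longlongrightarrow> g s - m s) (at s within {s..})"
        by (auto simp: continuous_on_def)
      then have "((\<lambda>r. g r - m r) \<longlongrightarrow> g s - m s) (at_right s)"
        by (rule tendsto_within_subset) auto
      from order_tendstoD(2)[OF this \<open>g s - m s < 0\<close>]
      have "\<forall>\<^sub>F r in at_right s. g r \<le> m r" by eventually_elim simp
      then show ?thesis
        by (subst (asm) at_right_to_0) (simp add: eventually_filtermap add.commute)
    qed
    then obtain b where b: "b > 0" "\<And>h. 0 < h \<Longrightarrow> h < b \<Longrightarrow> g (s + h) \<le> m (s + h)"
      unfolding eventually_at_right_field by auto
    define d where "d = min (b / 2) (t - s)"
    have d: "0 < d" "d < b" "s + d \<le> t" using b \<open>s < t\<close> by (auto simp: d_def)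
    have "g r \<le> m r" if "r \<in> {0..s + d}" for r
      using below[of r] at_s b(2)[of "r - s"] that d by (cases "r < s"; cases "r = s") auto
    then have "s + d \<in> B" using d s by (auto simp: B_def)
    then have "s + d \<le> s" unfolding s_def by (rule cSup_upper[OF _ Bbdd])
    then show False using d by simp
  qed
  then show "g t \<le> exp (- c * t) * (g 0 - K / c) + K / c + e" using at_s by (simp add: m_def)
qed

section \<open>Contraction in an equivalent inner product\<close>

text \<open>\<open>gen\<close> characterises D by the right derivative of orbits at 0, so invariance
  and density of D are derived rather than assumed. \<open>q\<close> is the equivalent inner
  product, here bounded above by \<open>N\<close>; its lower bound belongs to the concrete
  form.\<close>

locale generator_on = semigroup_on V N J T
  for V :: "'a::real_vector set" and N and J :: "'a \<Rightarrow> 'b::banach" and T +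
  fixes D :: "'a set" and A :: "'a \<Rightarrow> 'a" and q :: "'a \<Rightarrow> 'a \<Rightarrow> real"
  assumes gen: "generates V N D A T"
    and D_A: "x \<in> D \<Longrightarrow> x \<in> V \<and> A x \<in> V"
    and q_sym: "x \<in> V \<Longrightarrow> y \<in> V \<Longrightarrow> q x y = q y x"
    and q_add: "x \<in> V \<Longrightarrow> y \<in> V \<Longrightarrow> z \<in> V \<Longrightarrow> q (x + y) z = q x z + q y z"
    and q_scale: "x \<in> V \<Longrightarrow> y \<in> V \<Longrightarrow> q (c *\<^sub>R x) y = c * q x y"
    and q_bound: "\<exists>C. \<forall>x\<in>V. \<forall>y\<in>V. \<bar>q x y\<bar> \<le> C * N x * N y"
begin

lemma generator_iff:
  "x \<in> V \<Longrightarrow> y \<in> V \<Longrightarrow> ((\<lambda>t. N ((1 / t) *\<^sub>R (T t x - x) - y)) \<longlongrightarrow> 0) (at_right 0) \<longleftrightarrow> x \<in> D \<and> A x = y"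
  using gen by (auto simp: generates_def)

lemma q_boundE:
  obtains C where "C > 0" "\<And>x y. x \<in> V \<Longrightarrow> y \<in> V \<Longrightarrow> \<bar>q x y\<bar> \<le> C * N x * N y"
proof -
  obtain C where C: "\<And>x y. x \<in> V \<Longrightarrow> y \<in> V \<Longrightarrow> \<bar>q x y\<bar> \<le> C * N x * N y" using q_bound by blast
  have "\<bar>q x y\<bar> \<le> (\<bar>C\<bar> + 1) * N x * N y" if "x \<in> V" "y \<in> V" for x y
  proof -
    have "C * (N x * N y) \<le> (\<bar>C\<bar> + 1) * (N x * N y)"
      using that N_nonneg by (intro mult_right_mono) auto
    then show ?thesis using C[OF that] by (simp add: mult.assoc)
  qed
  then show ?thesis using that[of "\<bar>C\<bar> + 1"] by auto
qed

lemma q_expand: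
  assumes "x \<in> V" "y \<in> V"
  shows "q (x + y) (x + y) = q x x + 2 * q x y + q y y"
  using assms by (simp add: q_add q_sym[of x "x + y"] q_sym[of y "x + y"] q_sym[of y x])

lemma q_scale_right: "x \<in> V \<Longrightarrow> y \<in> V \<Longrightarrow> q x (c *\<^sub>R y) = c * q x y"
  using q_scale[of y x c] q_sym[of x y] q_sym[of x "c *\<^sub>R y"] by simp

lemma q_add_right: "x \<in> V \<Longrightarrow> y \<in> V \<Longrightarrow> z \<in> V \<Longrightarrow> q x (y + z) = q x y + q x z"
  using q_add[of y z x] by (simp add: q_sym[of x])

lemma q_tendsto:
  assumes f: "\<forall>\<^sub>F i in F. f i \<in> V" and w: "w \<in> V" and lim: "((\<lambda>i. N (f i - w)) \<longlongrightarrow> 0) F"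
  shows "((\<lambda>i. q (f i) (f i)) \<longlongrightarrow> q w w) F"
proof (rule LIM_zero_cancel)
  obtain C where C: "C > 0" "\<And>x y. x \<in> V \<Longrightarrow> y \<in> V \<Longrightarrow> \<bar>q x y\<bar> \<le> C * N x * N y" by (rule q_boundE) blast
  have bound: "\<forall>\<^sub>F i in F. norm (q (f i) (f i) - q w w) \<le> 2 * (C * N w * N (f i - w)) + C * N (f i - w) * N (f i - w)"
    using f
  proof eventually_elim
    case (elim i)
    have d: "f i - w \<in> V" using elim w by simp
    have "q (f i) (f i) - q w w = 2 * q w (f i - w) + q (f i - w) (f i - w)"
      using q_expand[OF w d] by simp
    then show ?case using C(2)[OF w d] C(2)[OF d d] by simp
  qed
  have "((\<lambda>i. 2 * (C * N w * N (f i - w)) + C * N (f i - w) * N (f i - w)) \<longlongrightarrow> 2 * (C * N w * 0) + C * 0 * 0) F"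
    by (intro tendsto_intros lim)
  then show "((\<lambda>i. q (f i) (f i) - q w w) \<longlongrightarrow> 0) F"
    using Lim_null_comparison[OF bound] by simp
qed

lemma q_continuous:
  assumes f: "\<And>s. s \<in> S \<Longrightarrow> f s \<in> V" and c: "continuous_on S (\<lambda>s. J (f s))"
  shows "continuous_on S (\<lambda>s. q (f s) (f s))"
  unfolding continuous_on_def
proof
  fix s assume s: "s \<in> S"
  have ev: "\<forall>\<^sub>F r in at s within S. f r \<in> V" using f by (auto simp: eventually_at_filter)
  have "((\<lambda>r. J (f r)) \<longlongrightarrow> J (f s)) (at s within S)" using c s by (simp add: continuous_on_def)
  then have "((\<lambda>r. N (f r - f s)) \<longlongrightarrow> 0) (at s within S)" using J_tendsto[OF ev f[OF s]] by simp
  then show "((\<lambda>s. q (f s) (f s)) \<longlongrightarrow> q (f s) (f s)) (at s within S)" by (rule q_tendsto[OF ev f[OF s]])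
qed

text \<open>Right-hand Taylor estimate, in the one-sided form that
  \<open>dini_exponential_bound\<close> takes as hypothesis.\<close>

lemma q_first_order:
  assumes z: "z \<in> V" and a: "a \<in> V" and xh: "\<forall>\<^sub>F h in at_right 0. x h \<in> V"
    and lim: "((\<lambda>h. N ((1 / h) *\<^sub>R (x h - z) - a)) \<longlongrightarrow> 0) (at_right 0)" and e: "e > 0"
  shows "\<forall>\<^sub>F h in at_right 0. q (x h) (x h) \<le> q z z + h * (2 * q z a + e)"
proof -
  obtain C where C: "C > 0" "\<And>x y. x \<in> V \<Longrightarrow> y \<in> V \<Longrightarrow> \<bar>q x y\<bar> \<le> C * N x * N y" by (rule q_boundE) blast
  define r where "r h = N ((1 / h) *\<^sub>R (x h - z) - a)" for h
  have lim: "(r \<longlongrightarrow> 0) (at_right 0)" using lim unfolding r_def .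
  have "((\<lambda>h. 2 * (C * N z * r h) + h * (C * (N a + r h) * (N a + r h))) \<longlongrightarrow>
      2 * (C * N z * 0) + 0 * (C * (N a + 0) * (N a + 0))) (at_right 0)"
    by (intro tendsto_intros lim)
  then have "\<forall>\<^sub>F h in at_right 0. 2 * (C * N z * r h) + h * (C * (N a + r h) * (N a + r h)) < e"
    by (rule order_tendstoD) (use e in simp)
  moreover have "\<forall>\<^sub>F h in at_right (0::real). h > 0" by (simp add: eventually_at_right_less)
  ultimately show ?thesis using xh
  proof eventually_elim
    case (elim h)
    define d where "d = (1 / h) *\<^sub>R (x h - z)"
    have d: "d \<in> V" using elim z by (simp add: d_def)
    have xd: "x h = z + h *\<^sub>R d" using elim by (simp add: d_def)
    have r: "r h = N (d - a)" by (simp add: r_def d_def)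
    have "q (x h) (x h) = q z z + 2 * (h * q z d) + h * (h * q d d)"
      unfolding xd using d z by (simp add: q_expand q_scale q_scale_right)
    moreover have "q z d \<le> q z a + C * N z * r h"
    proof -
      have "q z d = q z a + q z (d - a)" using q_add_right[of z a "d - a"] z a d by simp
      then show ?thesis using C(2)[of z "d - a"] z a d r by simp
    qed
    moreover have "q d d \<le> C * (N a + r h) * (N a + r h)"
    proof -
      have "N d \<le> N a + r h" using N_add[of a "d - a"] a d r by simp
      then have "N d * N d \<le> (N a + r h) * (N a + r h)" using N_nonneg[OF d] by (intro mult_mono) auto
      then have "C * (N d * N d) \<le> C * ((N a + r h) * (N a + r h))" using C by (intro mult_left_mono) auto
      then show ?thesis using C(2)[OF d d] by (simp add: mult.assoc)
    qed
    ultimately have "q (x h) (x h) \<le> q z z + 2 * (h * (q z a + C * N z * r h)) + h * (h * (C * (N a + r h) * (N a + r h)))"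
      using elim(2) by (smt (verit) mult_left_mono)
    also have "\<dots> = q z z + h * (2 * q z a + (2 * (C * N z * r h) + h * (C * (N a + r h) * (N a + r h))))"
      by (simp add: algebra_simps)
    also have "\<dots> \<le> q z z + h * (2 * q z a + e)"
      using elim by (intro add_left_mono mult_left_mono) auto
    finally show ?case .
  qed
qed

text \<open>\<open>T t\<close> commutes with \<open>T h\<close>, so the difference quotient of the
  orbit of T t x at 0 is T t applied to that of x.\<close>

lemma T_right_derivative:
  assumes x: "x \<in> D" and t: "t \<ge> 0"
  shows "T t x \<in> D \<and> A (T t x) = T t (A x)"
proof -
  have xV: "x \<in> V" "A x \<in> V" using D_A[OF x] by auto
  have lim: "((\<lambda>h. N ((1 / h) *\<^sub>R (T h x - x) - A x)) \<longlongrightarrow> 0) (at_right 0)"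
    using generator_iff[OF xV] x by simp
  obtain C where C: "C > 0" "\<And>x. x \<in> V \<Longrightarrow> N (T t x) \<le> C * N x" by (rule bounded_op_bound[OF T_op[OF t]]) blast
  have "((\<lambda>h. N ((1 / h) *\<^sub>R (T h (T t x) - T t x) - T t (A x))) \<longlongrightarrow> 0) (at_right 0)"
  proof (rule Lim_null_comparison)
    have "((\<lambda>h. C * N ((1 / h) *\<^sub>R (T h x - x) - A x)) \<longlongrightarrow> C * 0) (at_right 0)"
      by (intro tendsto_intros lim)
    then show "((\<lambda>h. C * N ((1 / h) *\<^sub>R (T h x - x) - A x)) \<longlongrightarrow> 0) (at_right 0)" by simp
    have "\<forall>\<^sub>F h in at_right (0::real). h > 0" by (simp add: eventually_at_right_less)
    then show "\<forall>\<^sub>F h in at_right 0. norm (N ((1 / h) *\<^sub>R (T h (T t x) - T t x) - T t (A x)))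
        \<le> C * N ((1 / h) *\<^sub>R (T h x - x) - A x)"
    proof eventually_elim
      case (elim h)
      have v: "T h x - x \<in> V" "(1 / h) *\<^sub>R (T h x - x) - A x \<in> V" using xV elim by auto
      have "T h (T t x) = T t (T h x)"
        using T_T[of h t x] T_T[of t h x] elim t xV by (simp add: add.commute)
      then have "(1 / h) *\<^sub>R (T h (T t x) - T t x) - T t (A x) = T t ((1 / h) *\<^sub>R (T h x - x) - A x)"
        using elim t xV v by (simp add: T_diff T_scale)
      then show ?case using C(2)[OF v(2)] N_nonneg[of "T t ((1 / h) *\<^sub>R (T h x - x) - A x)"] t v by simp
    qed
  qed
  then show ?thesis using generator_iff[of "T t x" "T t (A x)"] t xV by simp
qed

text \<open>The values of \<open>A\<close> on the integrated orbits are recorded along with the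
  approximation: their first component later yields w' = v for arbitrary states.\<close>

lemma D_dense:
  assumes x: "x \<in> V"
  obtains Y where "\<And>h. h > 0 \<Longrightarrow> Y h \<in> D" "\<And>h. h > 0 \<Longrightarrow> A (Y h) = T h x - x"
    "((\<lambda>h. N ((1 / h) *\<^sub>R Y h - x)) \<longlongrightarrow> 0) (at_right 0)"
proof -
  obtain Y where Y: "\<And>h. h > 0 \<Longrightarrow> Y h \<in> V"
    "\<And>h. h > 0 \<Longrightarrow> ((\<lambda>t. N ((1 / t) *\<^sub>R (T t (Y h) - Y h) - (T h x - x))) \<longlongrightarrow> 0) (at_right 0)"
    "((\<lambda>h. N ((1 / h) *\<^sub>R Y h - x)) \<longlongrightarrow> 0) (at_right 0)" by (rule T_integral[OF x]) blast
  have "Y h \<in> D \<and> A (Y h) = T h x - x" if "h > 0" for h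
    using generator_iff[of "Y h" "T h x - x"] Y(1,2)[OF that] x that by simp
  with Y(3) show ?thesis by (intro that[of Y]) auto
qed

lemma D_scale:
  assumes "x \<in> D" shows "c *\<^sub>R x \<in> D"
proof -
  have xV: "x \<in> V" "A x \<in> V" using D_A[OF assms] by auto
  have "((\<lambda>h. N ((1 / h) *\<^sub>R (T h x - x) - A x)) \<longlongrightarrow> 0) (at_right 0)"
    using generator_iff[OF xV] assms by simp
  then have "((\<lambda>h. \<bar>c\<bar> * N ((1 / h) *\<^sub>R (T h x - x) - A x)) \<longlongrightarrow> \<bar>c\<bar> * 0) (at_right 0)"
    by (intro tendsto_intros)
  moreover have "\<forall>\<^sub>F h in at_right 0. \<bar>c\<bar> * N ((1 / h) *\<^sub>R (T h x - x) - A x)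
      = N ((1 / h) *\<^sub>R (T h (c *\<^sub>R x) - c *\<^sub>R x) - c *\<^sub>R A x)"
    unfolding eventually_at_right_field
  proof (intro exI[of _ 1] conjI allI impI)
    fix h :: real assume h: "0 < h" "h < 1"
    have "(1 / h) *\<^sub>R (T h (c *\<^sub>R x) - c *\<^sub>R x) - c *\<^sub>R A x = c *\<^sub>R ((1 / h) *\<^sub>R (T h x - x) - A x)"
      using h xV by (simp add: T_scale scaleR_diff_right mult.commute)
    then show "\<bar>c\<bar> * N ((1 / h) *\<^sub>R (T h x - x) - A x) = N ((1 / h) *\<^sub>R (T h (c *\<^sub>R x) - c *\<^sub>R x) - c *\<^sub>R A x)"
      using h xV N_scale[of "(1 / h) *\<^sub>R (T h x - x) - A x" c] by simp
  qed simp
  ultimately have "((\<lambda>h. N ((1 / h) *\<^sub>R (T h (c *\<^sub>R x) - c *\<^sub>R x) - c *\<^sub>R A x)) \<longlongrightarrow> \<bar>c\<bar> * 0) (at_right 0)"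
    by (rule Lim_transform_eventually)
  then show ?thesis using generator_iff[of "c *\<^sub>R x" "c *\<^sub>R A x"] xV by simp
qed

text \<open>On D the right derivative of q along the orbit is 2 q (T t x) (A (T t x)), bounded by -
  c q, and the differential inequality applies with K = 0. Both sides are continuous in
  \<open>N\<close>, so density of D gives the rest.\<close>

lemma q_contraction:
  assumes diss: "\<And>x. x \<in> D \<Longrightarrow> 2 * q x (A x) \<le> - c * q x x" and c: "c > 0"
    and x: "x \<in> V" and t: "t \<ge> 0"
  shows "q (T t x) (T t x) \<le> exp (- c * t) * q x x"
proof -
  have on_D: "q (T t x) (T t x) \<le> exp (- c * t) * q x x" if x: "x \<in> D" for x
  proof -
    have xV: "x \<in> V" "A x \<in> V" using D_A[OF x] by auto
    have "q (T t x) (T t x) \<le> exp (- c * t) * (q (T 0 x) (T 0 x) - 0 / c) + 0 / c"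
    proof (rule dini_exponential_bound[where g="\<lambda>t. q (T t x) (T t x)", OF _ c _ t])
      show "continuous_on {0..} (\<lambda>t. q (T t x) (T t x))"
        by (rule q_continuous[OF _ T_continuous[OF xV(1)]]) (use xV in auto)
      fix s \<eta> :: real assume s: "s \<ge> 0" and \<eta>: "\<eta> > 0"
      define z where "z = T s x"
      have z: "z \<in> D" using T_right_derivative[OF x s] by (simp add: z_def)
      have zV: "z \<in> V" "A z \<in> V" using D_A[OF z] by auto
      have "\<forall>\<^sub>F h in at_right 0. q (T h z) (T h z) \<le> q z z + h * (2 * q z (A z) + \<eta>)"
      proof (rule q_first_order[OF zV _ _ \<eta>])
        show "\<forall>\<^sub>F h in at_right 0. T h z \<in> V"
          unfolding eventually_at_right_field by (intro exI[of _ 1]) (use zV in auto)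
        show "((\<lambda>h. N ((1 / h) *\<^sub>R (T h z - z) - A z)) \<longlongrightarrow> 0) (at_right 0)"
          using generator_iff[OF zV] z by simp
      qed
      moreover have "\<forall>\<^sub>F h in at_right (0::real). h > 0" by (simp add: eventually_at_right_less)
      ultimately show "\<forall>\<^sub>F h in at_right 0. q (T (s + h) x) (T (s + h) x) \<le>
          q (T s x) (T s x) + h * (0 - c * q (T s x) (T s x) + \<eta>)"
      proof eventually_elim
        case (elim h)
        have "T (s + h) x = T h z" using T_T[of h s x] elim s xV by (simp add: z_def add.commute)
        moreover have "h * (2 * q z (A z) + \<eta>) \<le> h * (0 - c * q z z + \<eta>)"
          using diss[OF z] elim by (intro mult_left_mono) auto
        ultimately show ?case using elim(1) by (simp add: z_def)
      qed
    qed
    then show ?thesis using xV by (simp add: T_0)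
  qed
  obtain Y where Y: "\<And>h. h > 0 \<Longrightarrow> Y h \<in> D" "((\<lambda>h. N ((1 / h) *\<^sub>R Y h - x)) \<longlongrightarrow> 0) (at_right 0)"
    by (rule D_dense[OF x]) blast
  define y where "y n = (1 / inverse (real (Suc n))) *\<^sub>R Y (inverse (real (Suc n)))" for n
  have yD: "y n \<in> D" for n unfolding y_def by (intro D_scale Y) simp
  have yV: "y n \<in> V" for n using D_A[OF yD] by simp
  have "filterlim (\<lambda>n. inverse (real (Suc n))) (at_right 0) sequentially"
    by (rule tendsto_imp_filterlim_at_right[OF LIMSEQ_inverse_real_of_nat]) simp
  from filterlim_compose[OF Y(2) this]
  have ylim: "(\<lambda>n. N (y n - x)) \<longlonglongrightarrow> 0" unfolding y_def .
  have Tlim: "(\<lambda>n. N (T t (y n) - T t x)) \<longlonglongrightarrow> 0"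
  proof -
    obtain C where C: "C > 0" "\<And>x. x \<in> V \<Longrightarrow> N (T t x) \<le> C * N x" by (rule bounded_op_bound[OF T_op[OF t]]) blast
    have "norm (N (T t (y n) - T t x)) \<le> C * N (y n - x)" for n
      using C(2)[OF V_simps(3)[OF yV[of n] x]] t x yV[of n] N_nonneg[of "T t (y n) - T t x"] by (simp add: T_diff)
    then have ev: "\<forall>\<^sub>F n in sequentially. norm (N (T t (y n) - T t x)) \<le> C * N (y n - x)"
      by (intro always_eventually allI)
    have "(\<lambda>n. C * N (y n - x)) \<longlonglongrightarrow> C * 0" by (intro tendsto_intros ylim)
    then have "(\<lambda>n. C * N (y n - x)) \<longlonglongrightarrow> 0" by simp
    then show ?thesis by (rule Lim_null_comparison[OF ev])
  qed
  have l1: "(\<lambda>n. q (T t (y n)) (T t (y n))) \<longlonglongrightarrow> q (T t x) (T t x)"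
    by (rule q_tendsto[OF _ _ Tlim]) (use t x yV in auto)
  have l2: "(\<lambda>n. exp (- c * t) * q (y n) (y n)) \<longlonglongrightarrow> exp (- c * t) * q x x"
    by (intro tendsto_intros q_tendsto[OF _ x ylim] always_eventually allI yV)
  show ?thesis
    by (rule LIMSEQ_le[OF l1 l2]) (use on_D[OF yD] in blast)
qed

text \<open>For x outside the domain, q along the orbit of x need not have a derivative at time 0.
  The contraction bound takes its place, since only an upper estimate is asked for.\<close>

lemma q_mild_step:
  assumes contr: "\<And>h. h \<ge> 0 \<Longrightarrow> q (T h x) (T h x) \<le> exp (- c * h) * q x x"
    and c: "c > 0" and pos: "q x x \<ge> 0" and x: "x \<in> V" and p: "p \<in> V"
    and y: "\<And>h. h > 0 \<Longrightarrow> y h \<in> V"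
    and lim: "((\<lambda>h. N ((1 / h) *\<^sub>R (y h - T h x) - p)) \<longlongrightarrow> 0) (at_right 0)" and e: "e > 0"
  shows "\<forall>\<^sub>F h in at_right 0. q (y h) (y h) \<le> q x x + h * (- c * q x x + 2 * q x p + e)"
proof -
  obtain C where C: "C > 0" "\<And>x y. x \<in> V \<Longrightarrow> y \<in> V \<Longrightarrow> \<bar>q x y\<bar> \<le> C * N x * N y" by (rule q_boundE) blast
  define r where "r h = N ((1 / h) *\<^sub>R (y h - T h x) - p)" for h
  define m where "m h = N (T h x - x)" for h
  have r: "(r \<longlongrightarrow> 0) (at_right 0)" using lim unfolding r_def .
  have m: "(m \<longlongrightarrow> 0) (at_right 0)" using T_cont0[OF x] unfolding m_def .
  \<comment> \<open>All remainders divided by h: the second-order term of the exponential, the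
    replacement of T h x by x and of the quotient by p in the mixed term, and the square of the
    quotient.\<close>
  define R where "R h = h * c\<^sup>2 * q x x + 2 * (C * m h * (N p + r h) + C * N x * r h) + h * (C * ((N p + r h) * (N p + r h)))" for h
  have "(R \<longlongrightarrow> 0 * c\<^sup>2 * q x x + 2 * (C * 0 * (N p + 0) + C * N x * 0) + 0 * (C * ((N p + 0) * (N p + 0)))) (at_right 0)"
    unfolding R_def by (intro tendsto_intros r m)
  then have "\<forall>\<^sub>F h in at_right 0. R h < e"
    by (rule order_tendstoD) (use e in simp)
  moreover have "\<forall>\<^sub>F h in at_right (0::real). h > 0" by (simp add: eventually_at_right_less)
  ultimately show ?thesis
  proof eventually_elim
    case (elim h)
    define d where "d = (1 / h) *\<^sub>R (y h - T h x)"
    have Th: "T h x \<in> V" "T h x - x \<in> V" using elim x by auto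
    have d: "d \<in> V" "d - p \<in> V" using elim y Th p by (simp_all add: d_def)
    have yd: "y h = T h x + h *\<^sub>R d" using elim by (simp add: d_def)
    have rd: "r h = N (d - p)" by (simp add: r_def d_def)
    have Nd: "N d \<le> N p + r h" using N_add[OF p d(2)] rd by simp
    have "q (y h) (y h) = q (T h x) (T h x) + 2 * (h * q (T h x) d) + h * (h * q d d)"
      unfolding yd using d Th by (simp add: q_expand q_scale q_scale_right)
    moreover have "q (T h x) (T h x) \<le> q x x + h * (- c * q x x + h * c\<^sup>2 * q x x)"
    proof -
      have ch: "c * h > 0" using elim c by simp
      have "exp (- c * h) = 1 / exp (c * h)" by (simp add: exp_minus field_simps)
      also have "\<dots> \<le> 1 / (1 + c * h)"
        using ch by (intro divide_left_mono exp_ge_add_one_self) auto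
      also have "\<dots> \<le> 1 - c * h + (c * h)\<^sup>2"
      proof -
        have "1 \<le> 1 + (c * h) ^ 3" using ch by simp
        also have "\<dots> = (1 - c * h + (c * h)\<^sup>2) * (1 + c * h)"
          by (simp add: algebra_simps power2_eq_square power3_eq_cube)
        finally show ?thesis using ch by (simp add: pos_divide_le_eq)
      qed
      finally have "exp (- c * h) * q x x \<le> (1 - c * h + (c * h)\<^sup>2) * q x x"
        using pos by (rule mult_right_mono)
      then show ?thesis using contr[of h] elim by (simp add: algebra_simps power2_eq_square)
    qed
    moreover have "q (T h x) d \<le> q x p + (C * m h * (N p + r h) + C * N x * r h)"
    proof -
      have "q (T h x) d = q (T h x - x) d + (q x p + q x (d - p))"
        using q_add[of "T h x - x" x d] q_add_right[of x p "d - p"] Th d x p by simp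
      moreover have "q (T h x - x) d \<le> C * m h * (N p + r h)"
      proof -
        have "C * m h * N d \<le> C * m h * (N p + r h)"
          using Nd C N_nonneg[OF Th(2)] by (intro mult_left_mono) (auto simp: m_def)
        then show ?thesis using C(2)[OF Th(2) d(1)] by (simp add: m_def)
      qed
      ultimately show ?thesis using C(2)[OF x d(2)] rd by simp
    qed
    moreover have "q d d \<le> C * ((N p + r h) * (N p + r h))"
    proof -
      have "N d * N d \<le> (N p + r h) * (N p + r h)" using Nd N_nonneg[OF d(1)] by (intro mult_mono) auto
      then have "C * (N d * N d) \<le> C * ((N p + r h) * (N p + r h))" using C by (intro mult_left_mono) auto
      then show ?thesis using C(2)[OF d(1) d(1)] by (simp add: mult.assoc)
    qed
    ultimately have "q (y h) (y h) \<le> q x x + h * (- c * q x x + h * c\<^sup>2 * q x x)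
        + 2 * (h * (q x p + (C * m h * (N p + r h) + C * N x * r h))) + h * (h * (C * ((N p + r h) * (N p + r h))))"
      using elim(2) by (smt (verit) mult_left_mono)
    also have "\<dots> = q x x + h * (- c * q x x + 2 * q x p + R h)"
      by (simp add: R_def algebra_simps)
    also have "\<dots> \<le> q x x + h * (- c * q x x + 2 * q x p + e)"
      using elim by (intro add_left_mono mult_left_mono) auto
    finally show ?case .
  qed
qed

end

section \<open>The cubic nonlinearity\<close>

definition ess_le :: "L2 \<Rightarrow> real \<Rightarrow> bool" where
  "ess_le w M \<longleftrightarrow> (AE x in lborel. \<bar>rep_L2 w x\<bar> \<le> M)"

text \<open>Outside the essentially bounded functions the cube need not be square integrable, and
  \<open>abs_L2\<close> says nothing there; hence the premise \<open>ess_le\<close> in the lemmas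
  about it.\<close>

definition cube :: "L2 \<Rightarrow> L2" where "cube w = abs_L2 (\<lambda>\<xi>. rep_L2 w \<xi> ^ 3)"

definition quartic :: "L2 \<Rightarrow> real" where "quartic w = inner (cube w) w"

lemma square_integrable_cube:
  assumes "ess_le w M" shows "square_integrable (\<lambda>x. rep_L2 w x ^ 3)"
proof (rule square_integrable_bound[OF _ square_integrable_scale[OF square_integrable_rep_L2, of "M\<^sup>2"]])
  show "AE x in lborel. \<bar>rep_L2 w x ^ 3\<bar> \<le> \<bar>M\<^sup>2 * rep_L2 w x\<bar>"
    using assms unfolding ess_le_def
  proof eventually_elim
    case (elim x)
    then have "\<bar>rep_L2 w x\<bar>\<^sup>2 \<le> M\<^sup>2" by (intro power_mono) auto
    then have "\<bar>rep_L2 w x\<bar>\<^sup>2 * \<bar>rep_L2 w x\<bar> \<le> M\<^sup>2 * \<bar>rep_L2 w x\<bar>" by (intro mult_right_mono) auto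
    then show ?case by (simp add: abs_mult power2_eq_square power3_eq_cube)
  qed
qed measurable

lemma inner_cube:
  assumes "ess_le w M" shows "inner (cube w) v = (LINT x|lborel. rep_L2 w x ^ 3 * rep_L2 v x)"
  using inner_abs_L2[OF square_integrable_cube[OF assms] square_integrable_rep_L2[of v]] by (simp add: cube_def abs_L2_rep)

lemma cube_L2_on:
  assumes "ess_le w M" "w \<in> L2_on l" shows "cube w \<in> L2_on l"
proof -
  have "AE x in lborel. x \<notin> {0<..<l} \<longrightarrow> rep_L2 w x = 0" using assms(2) by (simp add: L2_on_def)
  moreover have "AE x in lborel. rep_L2 (cube w) x = rep_L2 w x ^ 3"
    unfolding cube_def by (rule AE_rep_abs_L2[OF square_integrable_cube[OF assms(1)]])
  ultimately show ?thesis unfolding L2_on_def mem_Collect_eq by eventually_elim auto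
qed

lemma cube_lipschitz:
  assumes "ess_le w M" "ess_le v M"
  shows "norm (cube w - cube v) \<le> 3 * M\<^sup>2 * norm (w - v)"
proof -
  let ?f = "\<lambda>x. rep_L2 w x - rep_L2 v x"
  have f: "square_integrable ?f" by (rule square_integrable_diff[OF square_integrable_rep_L2 square_integrable_rep_L2])
  have "norm (cube w - cube v) = norm (abs_L2 (\<lambda>x. rep_L2 w x ^ 3 - rep_L2 v x ^ 3))"
    unfolding cube_def by (simp add: abs_L2_diff square_integrable_cube[OF assms(1)] square_integrable_cube[OF assms(2)])
  also have "\<dots> \<le> norm (abs_L2 (\<lambda>x. 3 * M\<^sup>2 * ?f x))"
  proof (rule norm_abs_L2_mono[OF square_integrable_diff[OF square_integrable_cube[OF assms(1)] square_integrable_cube[OF assms(2)]] square_integrable_scale[OF f]])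
    show "AE x in lborel. \<bar>rep_L2 w x ^ 3 - rep_L2 v x ^ 3\<bar> \<le> \<bar>3 * M\<^sup>2 * ?f x\<bar>"
      using assms unfolding ess_le_def
    proof eventually_elim
      case (elim x)
      let ?a = "rep_L2 w x" and ?b = "rep_L2 v x"
      have "\<bar>?a\<^sup>2 + ?a * ?b + ?b\<^sup>2\<bar> \<le> \<bar>?a\<bar> * \<bar>?a\<bar> + \<bar>?a\<bar> * \<bar>?b\<bar> + \<bar>?b\<bar> * \<bar>?b\<bar>"
        using abs_triangle_ineq[of "?a\<^sup>2 + ?a * ?b" "?b\<^sup>2"] abs_triangle_ineq[of "?a\<^sup>2" "?a * ?b"]
        by (simp add: abs_mult power2_eq_square)
      also have "\<dots> \<le> M * M + M * M + M * M"
        using elim by (intro add_mono mult_mono) auto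
      finally have "\<bar>?a\<^sup>2 + ?a * ?b + ?b\<^sup>2\<bar> \<le> 3 * M\<^sup>2" by (simp add: power2_eq_square)
      then have "\<bar>?a\<^sup>2 + ?a * ?b + ?b\<^sup>2\<bar> * \<bar>?a - ?b\<bar> \<le> 3 * M\<^sup>2 * \<bar>?a - ?b\<bar>" by (rule mult_right_mono) simp
      moreover have "?a ^ 3 - ?b ^ 3 = (?a\<^sup>2 + ?a * ?b + ?b\<^sup>2) * (?a - ?b)"
        by (simp add: algebra_simps power2_eq_square power3_eq_cube)
      ultimately show ?case by (simp add: abs_mult)
    qed
  qed
  also have "abs_L2 (\<lambda>x. 3 * M\<^sup>2 * ?f x) = (3 * M\<^sup>2) *\<^sub>R (w - v)"
    using abs_L2_scale[OF f, of "3 * M\<^sup>2"] abs_L2_diff[OF square_integrable_rep_L2 square_integrable_rep_L2, of w v] by (simp add: abs_L2_rep)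
  finally show ?thesis by simp
qed

lemma quartic_nonneg:
  assumes "ess_le w M" shows "0 \<le> quartic w"
proof -
  have "0 \<le> y ^ 3 * y" for y :: real
    using zero_le_even_power[of 4 y] by (simp add: power4_eq_xxxx power3_eq_cube)
  then show ?thesis unfolding quartic_def inner_cube[OF assms] by (intro integral_nonneg_AE) auto
qed

lemma quartic_le:
  assumes "ess_le w M" shows "quartic w \<le> M\<^sup>2 * (norm w)\<^sup>2"
proof -
  have "quartic w \<le> (LINT x|lborel. M\<^sup>2 * (rep_L2 w x)\<^sup>2)"
    unfolding quartic_def inner_cube[OF assms]
  proof (rule integral_mono_AE)
    show "integrable lborel (\<lambda>x. rep_L2 w x ^ 3 * rep_L2 w x)"
      by (rule square_integrable_mult[OF square_integrable_cube[OF assms] square_integrable_rep_L2])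
    show "AE x in lborel. rep_L2 w x ^ 3 * rep_L2 w x \<le> M\<^sup>2 * (rep_L2 w x)\<^sup>2"
      using assms unfolding ess_le_def
    proof eventually_elim
      case (elim x)
      then have "\<bar>rep_L2 w x\<bar>\<^sup>2 \<le> M\<^sup>2" by (intro power_mono) auto
      then have "(rep_L2 w x)\<^sup>2 * (rep_L2 w x)\<^sup>2 \<le> M\<^sup>2 * (rep_L2 w x)\<^sup>2" by (intro mult_right_mono) auto
      then show ?case by (simp add: power2_eq_square power3_eq_cube algebra_simps)
    qed
  qed (use integrable_rep_L2_sq in auto)
  then show ?thesis by (simp add: norm_sq_rep_L2)
qed

text \<open>Taylor expansion of s^4 with exact remainder (b^2 + 2 a b + 3 a^2) (b - a)^2, whose
  first factor is at most 6 M^2. The remainder is measured in L2, so the quartic integral can be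
  differentiated along curves whose quotients converge in L2 only.\<close>

lemma quartic_expand:
  assumes "ess_le w M" "ess_le v M"
  shows "quartic v \<le> quartic w + 4 * inner (cube w) (v - w) + 6 * M\<^sup>2 * (norm (v - w))\<^sup>2"
proof -
  let ?a = "rep_L2 w" and ?b = "rep_L2 v" and ?d = "rep_L2 (v - w)"
  note i = square_integrable_mult[OF square_integrable_cube[OF assms(1)] square_integrable_rep_L2]
  have "quartic v \<le> (LINT x|lborel. ?a x ^ 3 * ?a x + 4 * (?a x ^ 3 * ?d x) + 6 * M\<^sup>2 * (?d x)\<^sup>2)"
    unfolding quartic_def inner_cube[OF assms(2)]
  proof (rule integral_mono_AE)
    show "integrable lborel (\<lambda>x. ?b x ^ 3 * ?b x)"
      by (rule square_integrable_mult[OF square_integrable_cube[OF assms(2)] square_integrable_rep_L2])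
    show "integrable lborel (\<lambda>x. ?a x ^ 3 * ?a x + 4 * (?a x ^ 3 * ?d x) + 6 * M\<^sup>2 * (?d x)\<^sup>2)"
      by (intro Bochner_Integration.integrable_add integrable_mult_right i integrable_rep_L2_sq)
    show "AE x in lborel. ?b x ^ 3 * ?b x \<le> ?a x ^ 3 * ?a x + 4 * (?a x ^ 3 * ?d x) + 6 * M\<^sup>2 * (?d x)\<^sup>2"
      using assms[unfolded ess_le_def] AE_rep_diff[of v w]
    proof eventually_elim
      case (elim x)
      have "\<bar>?a x\<bar> * \<bar>?a x\<bar> \<le> M * M" "\<bar>?b x\<bar> * \<bar>?b x\<bar> \<le> M * M" "\<bar>?a x\<bar> * \<bar>?b x\<bar> \<le> M * M"
        using elim by (intro mult_mono; simp)+
      then have "?b x * ?b x + 2 * (?a x * ?b x) + 3 * (?a x * ?a x) \<le> 6 * M\<^sup>2"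
        using abs_ge_self[of "?a x * ?b x"] by (simp add: abs_mult power2_eq_square)
      then have "(?b x * ?b x + 2 * (?a x * ?b x) + 3 * (?a x * ?a x)) * (?b x - ?a x)\<^sup>2 \<le> 6 * M\<^sup>2 * (?b x - ?a x)\<^sup>2"
        by (rule mult_right_mono) simp
      moreover have "?b x ^ 3 * ?b x = ?a x ^ 3 * ?a x + 4 * (?a x ^ 3 * (?b x - ?a x))
          + (?b x * ?b x + 2 * (?a x * ?b x) + 3 * (?a x * ?a x)) * (?b x - ?a x)\<^sup>2"
        by (simp add: algebra_simps power2_eq_square power3_eq_cube)
      ultimately show ?case using elim(3) by simp
    qed
  qed
  also have "\<dots> = quartic w + 4 * inner (cube w) (v - w) + 6 * M\<^sup>2 * (norm (v - w))\<^sup>2"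
    unfolding quartic_def inner_cube[OF assms(1)] norm_sq_rep_L2
    using i[of w] i[of "v - w"] integrable_rep_L2_sq[of "v - w"] by simp
  finally show ?thesis .
qed

section \<open>The state space\<close>

definition D2 :: "real \<Rightarrow> L2 \<Rightarrow> L2" where "D2 l w = wderiv l (wderiv l w)"

definition H2H10 :: "real \<Rightarrow> L2 set" where "H2H10 l = sobolev l 2 \<inter> H10 l"

lemma H2H10_iff:
  assumes l: "l > 0"
  shows "w \<in> H2H10 l \<longleftrightarrow> w \<in> H10 l \<and> (\<exists>h. weak_derivative l (wderiv l w) h)"
proof
  assume w: "w \<in> H2H10 l"
  then obtain g h where "weak_derivative l w g" "weak_derivative l g h"
    by (auto simp: H2H10_def numeral_2_eq_2)
  then show "w \<in> H10 l \<and> (\<exists>h. weak_derivative l (wderiv l w) h)"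
    using w wderiv_eq[OF l] by (auto simp: H2H10_def)
next
  assume "w \<in> H10 l \<and> (\<exists>h. weak_derivative l (wderiv l w) h)"
  then obtain h where w: "w \<in> H10 l" and h: "weak_derivative l (wderiv l w) h" by blast
  then have "h \<in> L2_on l" by (simp add: weak_derivative_iff l)
  then have "wderiv l w \<in> sobolev l 1" using h H10_prim(3)[OF l w] by auto
  then have "w \<in> sobolev l 2" using H10_prim(1,2)[OF l w] by (auto simp: numeral_2_eq_2)
  then show "w \<in> H2H10 l" using w by (simp add: H2H10_def)
qed

lemma H2H10_D2:
  assumes l: "l > 0" and w: "w \<in> H2H10 l"
  shows "w \<in> H10 l" "weak_derivative l (wderiv l w) (D2 l w)" "D2 l w \<in> L2_on l" "w \<in> L2_on l"
proof -
  obtain h where h: "w \<in> H10 l" "weak_derivative l (wderiv l w) h" using w H2H10_iff[OF l] by blast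
  then have "D2 l w = h" unfolding D2_def by (intro wderiv_eq[OF l])
  with h show "w \<in> H10 l" "weak_derivative l (wderiv l w) (D2 l w)" "D2 l w \<in> L2_on l" "w \<in> L2_on l"
    using H10_prim(1)[OF l h(1)] by (auto simp: weak_derivative_iff l)
qed

lemma wderiv_linear:
  assumes l: "l > 0" and w: "w \<in> H10 l" and v: "v \<in> H10 l"
  shows "wderiv l (w + v) = wderiv l w + wderiv l v" "wderiv l (c *\<^sub>R w) = c *\<^sub>R wderiv l w"
  by (intro wderiv_eq[OF l] weak_derivative_linear[OF l H10_prim(2)[OF l w] H10_prim(2)[OF l v]])+

lemma H2H10_linear:
  assumes l: "l > 0" and w: "w \<in> H2H10 l" and v: "v \<in> H2H10 l"
  shows "w + v \<in> H2H10 l" "c *\<^sub>R w \<in> H2H10 l" "D2 l (w + v) = D2 l w + D2 l v" "D2 l (c *\<^sub>R w) = c *\<^sub>R D2 l w"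
proof -
  note W = H2H10_D2[OF l w] and V = H2H10_D2[OF l v]
  have 1: "weak_derivative l (wderiv l (w + v)) (D2 l w + D2 l v)"
    unfolding wderiv_linear(1)[OF l W(1) V(1)] by (rule weak_derivative_linear[OF l W(2) V(2)])
  have 2: "weak_derivative l (wderiv l (c *\<^sub>R w)) (c *\<^sub>R D2 l w)"
    unfolding wderiv_linear(2)[OF l W(1) V(1)] by (rule weak_derivative_linear[OF l W(2) V(2)])
  show "w + v \<in> H2H10 l"
    using 1 subspace_add[OF subspace_H10[OF l] W(1) V(1)] H2H10_iff[OF l] by blast
  show "c *\<^sub>R w \<in> H2H10 l"
    using 2 subspace_mul[OF subspace_H10[OF l] W(1)] H2H10_iff[OF l] by blast
  show "D2 l (w + v) = D2 l w + D2 l v" using wderiv_eq[OF l 1] by (simp add: D2_def)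
  show "D2 l (c *\<^sub>R w) = c *\<^sub>R D2 l w" using wderiv_eq[OF l 2] by (simp add: D2_def)
qed

lemma H2H10_zero:
  assumes l: "l > 0" shows "0 \<in> H2H10 l" "D2 l 0 = 0"
proof -
  have z: "weak_derivative l 0 0" using subspace_0[OF subspace_L2_on] by (simp add: weak_derivative_iff l)
  have w: "wderiv l 0 = 0" by (rule wderiv_eq[OF l z])
  show "0 \<in> H2H10 l" using z w subspace_0[OF subspace_H10[OF l]] H2H10_iff[OF l] by auto
  show "D2 l 0 = 0" by (simp add: D2_def w)
qed

lemma norm_wderiv_sq_le:
  assumes l: "l > 0" and w: "w \<in> H2H10 l"
  shows "(norm (wderiv l w))\<^sup>2 \<le> norm w * norm (D2 l w)"
proof -
  note W = H2H10_D2[OF l w]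
  have "inner w (D2 l w) = - inner (wderiv l w) (wderiv l w)" by (rule H10_ibp[OF l W(1,2)])
  then have "(norm (wderiv l w))\<^sup>2 = - inner w (D2 l w)" by (simp add: power2_norm_eq_inner)
  also have "\<dots> \<le> norm w * norm (D2 l w)" using Cauchy_Schwarz_ineq2[of w "D2 l w"] by simp
  finally show ?thesis .
qed

lemma weak_derivative_limit:
  assumes l: "l > 0" and "\<And>n. weak_derivative l (u n) (g n)" "u \<longlonglongrightarrow> u'" "g \<longlonglongrightarrow> g'"
  shows "weak_derivative l u' g'"
  unfolding weak_derivative_iff[OF l]
proof (intro conjI ballI)
  have g: "g n \<in> L2_on l" for n using assms(2)[of n] by (simp add: weak_derivative_iff l)
  show "g' \<in> L2_on l" using closed_sequentially[OF closed_L2_on _ assms(4)] g by blast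
  fix \<phi> assume \<phi>: "\<phi> \<in> C1c l"
  have "(\<lambda>n. inner (u n) (abs_L2 (deriv \<phi>))) \<longlonglongrightarrow> inner u' (abs_L2 (deriv \<phi>))"
    by (intro tendsto_intros assms)
  moreover have "(\<lambda>n. - inner (g n) (abs_L2 \<phi>)) \<longlonglongrightarrow> - inner g' (abs_L2 \<phi>)"
    by (intro tendsto_intros assms)
  moreover have "inner (u n) (abs_L2 (deriv \<phi>)) = - inner (g n) (abs_L2 \<phi>)" for n
    using assms(2)[of n] \<phi> by (simp add: weak_derivative_iff l)
  ultimately show "inner u' (abs_L2 (deriv \<phi>)) = - inner g' (abs_L2 \<phi>)" using LIMSEQ_unique by simp
qed

text \<open>Convergence is given for w and w'' only; that of w' comes from the interpolation
  inequality applied to differences. The limit of the w' still has mean zero, which keeps the limit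
  of the w in \<open>H10\<close>.\<close>

lemma H2H10_closed:
  assumes l: "l > 0" and w: "\<And>n. w n \<in> H2H10 l" and lw: "w \<longlonglongrightarrow> w'" and lh: "(\<lambda>n. D2 l (w n)) \<longlonglongrightarrow> h"
  shows "w' \<in> H2H10 l" "D2 l w' = h"
proof -
  define g where "g n = wderiv l (w n)" for n
  note W = H2H10_D2[OF l w]
  note P = H10_prim[OF l W(1)]
  have diff: "(norm (g m - g n))\<^sup>2 \<le> norm (w m - w n) * norm (D2 l (w m) - D2 l (w n))" for m n
  proof -
    have m: "w m + (-1) *\<^sub>R w n \<in> H2H10 l" "(-1) *\<^sub>R w n \<in> H2H10 l"
      by (rule H2H10_linear(1)[OF l w H2H10_linear(2)[OF l w w]], rule H2H10_linear(2)[OF l w w])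
    have "wderiv l (w m + (-1) *\<^sub>R w n) = g m - g n"
      unfolding g_def wderiv_linear(1)[OF l W(1) H2H10_D2(1)[OF l m(2)]] wderiv_linear(2)[OF l W(1) W(1)] by simp
    moreover have "D2 l (w m + (-1) *\<^sub>R w n) = D2 l (w m) - D2 l (w n)"
      using H2H10_linear(3)[OF l w m(2)] H2H10_linear(4)[OF l w w, of "-1"] by simp
    ultimately show ?thesis using norm_wderiv_sq_le[OF l m(1)] by simp
  qed
  have "Cauchy g"
    unfolding Cauchy_iff
  proof (intro allI impI)
    fix e :: real assume e: "e > 0"
    obtain M1 where M1: "\<forall>m\<ge>M1. \<forall>n\<ge>M1. norm (w m - w n) < e"
      using LIMSEQ_imp_Cauchy[OF lw] e unfolding Cauchy_iff by blast
    obtain M2 where M2: "\<forall>m\<ge>M2. \<forall>n\<ge>M2. norm (D2 l (w m) - D2 l (w n)) < e"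
      using LIMSEQ_imp_Cauchy[OF lh] e unfolding Cauchy_iff by blast
    have "norm (g m - g n) < e" if "m \<ge> max M1 M2" "n \<ge> max M1 M2" for m n
    proof -
      have "(norm (g m - g n))\<^sup>2 \<le> norm (w m - w n) * norm (D2 l (w m) - D2 l (w n))" by (rule diff)
      also have "\<dots> < e * e" using M1 M2 that e by (intro mult_strict_mono) auto
      finally show ?thesis using e by (simp add: power2_eq_square power_less_imp_less_base[of _ 2] flip: power2_eq_square)
    qed
    then show "\<exists>M. \<forall>m\<ge>M. \<forall>n\<ge>M. norm (g m - g n) < e" by blast
  qed
  then obtain g' where lg: "g \<longlonglongrightarrow> g'" by (auto simp: Cauchy_convergent_iff convergent_def)
  have g'L: "g' \<in> L2_on l" using closed_sequentially[OF closed_L2_on _ lg] P(3) by (auto simp: g_def)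
  have "(\<lambda>n. inner (g n) (ind l)) \<longlonglongrightarrow> inner g' (ind l)" by (intro tendsto_intros lg)
  then have z: "inner g' (ind l) = 0" using P(5) by (simp add: g_def LIMSEQ_const_iff)
  have "(\<lambda>n. prim l (g n)) \<longlonglongrightarrow> prim l g'" by (rule bounded_linear.tendsto[OF bounded_linear_prim[OF l] lg])
  then have w': "w' = prim l g'" using lw LIMSEQ_unique unfolding g_def P(4)[symmetric] by blast
  have wd: "w' \<in> H10 l" "wderiv l w' = g'" using prim_H10[OF l g'L z] w' by auto
  have wk: "weak_derivative l g' h"
    by (rule weak_derivative_limit[OF l _ lg lh]) (simp add: g_def W(2))
  show "w' \<in> H2H10 l" using H2H10_iff[OF l] wd wk by blast
  show "D2 l w' = h" using wderiv_eq[OF l wk] by (simp add: D2_def wd)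
qed

text \<open>Two integrations by parts. The boundary terms disappear in one because y vanishes at the
  end points, in the other because z'' does, by the last two conditions in
  \<open>dom_A0\<close>.\<close>

lemma inner_fourth_derivative:
  assumes l: "l > 0" and z: "z \<in> dom_A0 l" and y: "y \<in> H2H10 l"
  shows "inner y (A0 l z) = inner (D2 l y) (D2 l z)" "A0 l z \<in> L2_on l"
proof -
  have "z \<in> sobolev l (Suc (Suc (Suc (Suc 0))))" using z by (simp add: dom_A0_def eval_nat_numeral)
  then obtain z1 z2 z3 z4 where z1: "weak_derivative l z z1" and z2: "weak_derivative l z1 z2" "z2 \<in> L2_on l"
    and z3: "weak_derivative l z2 z3" and z4: "weak_derivative l z3 z4" "z4 \<in> L2_on l" by auto
  have d: "wderiv l z = z1" "wderiv l z1 = z2" "wderiv l z2 = z3" "wderiv l z3 = z4"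
    using wderiv_eq[OF l] z1 z2 z3 z4 by blast+
  have A: "A0 l z = z4" by (simp add: A0_def eval_nat_numeral d)
  have D: "(wderiv l ^^ 2) z = z2" "D2 l z = z2" by (simp_all add: D2_def eval_nat_numeral d)
  have "z2 \<in> H10 l"
    by (rule H10_of_cont_rep[OF l z2(2) z3]) (use z D in \<open>auto simp: dom_A0_def\<close>)
  from H10_ibp[OF l this H2H10_D2(2)[OF l y]]
  have "inner z2 (D2 l y) = - inner z3 (wderiv l y)" by (simp add: d)
  moreover have "inner y z4 = - inner (wderiv l y) z3"
    by (rule H10_ibp[OF l H2H10_D2(1)[OF l y] z4(1)])
  ultimately show "inner y (A0 l z) = inner (D2 l y) (D2 l z)" by (simp add: A D inner_commute)
  show "A0 l z \<in> L2_on l" by (simp add: A z4)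
qed

lemma state_space_iff: "(w, v) \<in> state_space l \<longleftrightarrow> w \<in> H2H10 l \<and> v \<in> L2_on l"
  by (simp add: state_space_def H2H10_def)

lemma state_norm_sq:
  assumes l: "l > 0" and w: "w \<in> H2H10 l" and v: "v \<in> L2_on l"
    and pos: "0 \<le> E * I" "0 \<le> k" "0 \<le> \<rho> * a"
  shows "state_norm E I \<rho> a l k (w, v) = sqrt (E * I * (norm (D2 l w))\<^sup>2 + k * (norm w)\<^sup>2 + \<rho> * a * (norm v)\<^sup>2)"
proof -
  note W = H2H10_D2[OF l w]
  let ?f = "\<lambda>\<xi>. E * I * (rep_L2 (D2 l w) \<xi>)\<^sup>2 + k * (rep_L2 w \<xi>)\<^sup>2 + \<rho> * a * (rep_L2 v \<xi>)\<^sup>2"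
  have "(LINT \<xi>:{0..l}|lborel. ?f \<xi>) = (LINT \<xi>|lborel. ?f \<xi>)"
    unfolding set_lebesgue_integral_def
  proof (rule Bochner_Integration.integral_cong_AE)
    show "AE \<xi> in lborel. indicator {0..l} \<xi> *\<^sub>R ?f \<xi> = ?f \<xi>"
      using W(3)[unfolded L2_on_def mem_Collect_eq] W(4)[unfolded L2_on_def mem_Collect_eq] v[unfolded L2_on_def mem_Collect_eq]
      by eventually_elim (auto simp: indicator_def)
  qed measurable
  also have "\<dots> = E * I * (norm (D2 l w))\<^sup>2 + k * (norm w)\<^sup>2 + \<rho> * a * (norm v)\<^sup>2"
    by (simp add: norm_sq_rep_L2 integrable_rep_L2_sq)
  moreover have "(wderiv l ^^ 2) w = D2 l w" by (simp add: D2_def eval_nat_numeral)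
  ultimately show ?thesis by (simp add: state_norm_def)
qed

section \<open>The railway track\<close>

locale railway =
  fixes E I \<rho> a l k \<alpha> \<mu> C\<^sub>d :: real and T :: "real \<Rightarrow> L2 \<times> L2 \<Rightarrow> L2 \<times> L2"
  assumes pos: "0 < E" "0 < I" "0 < \<rho>" "0 < a" "0 < l" "0 < k" "0 < \<alpha>" "0 < \<mu>" "0 \<le> C\<^sub>d"
    and gen: "generates (state_space l) (state_norm E I \<rho> a l k)
           (dom_A E I l C\<^sub>d) (op_A E I \<rho> a l k \<mu> C\<^sub>d) T"
begin

section \<open>The state space as a complete normed space\<close>

abbreviation "X \<equiv> state_space l"
abbreviation "N \<equiv> state_norm E I \<rho> a l k"

abbreviation "\<D> \<equiv> dom_A E I l C\<^sub>d"
abbreviation "\<A> \<equiv> op_A E I \<rho> a l k \<mu> C\<^sub>d"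
abbreviation "\<F> \<equiv> op_F \<rho> a \<alpha>"
abbreviation "\<B> \<equiv> op_B \<rho> a"

text \<open>The weights make the norm of the product type equal to \<open>state_norm\<close> on the
  state space.\<close>

definition J :: "L2 \<times> L2 \<Rightarrow> L2 \<times> L2 \<times> L2" where
  "J = (\<lambda>(w, v). (sqrt (E * I) *\<^sub>R D2 l w, sqrt k *\<^sub>R w, sqrt (\<rho> * a) *\<^sub>R v))"

lemma EI: "0 < E * I" and s: "0 < \<rho> * a" and l: "0 < l"
  using pos by auto

lemma X_iff: "x \<in> X \<longleftrightarrow> fst x \<in> H2H10 l \<and> snd x \<in> L2_on l"
  by (cases x) (simp add: state_space_iff)

lemma N_sq:
  assumes "x \<in> X"
  shows "(N x)\<^sup>2 = E * I * (norm (D2 l (fst x)))\<^sup>2 + k * (norm (fst x))\<^sup>2 + \<rho> * a * (norm (snd x))\<^sup>2"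
  using state_norm_sq[OF l, of "fst x" "snd x" E I k \<rho> a] assms EI s pos(6) by (simp add: X_iff)

lemma norm_J: "norm (J x) = sqrt (E * I * (norm (D2 l (fst x)))\<^sup>2 + k * (norm (fst x))\<^sup>2 + \<rho> * a * (norm (snd x))\<^sup>2)"
  using EI s pos(6) by (cases x) (simp add: J_def norm_Pair power_mult_distrib add.assoc)

text \<open>A limit of triples (w'', w, v), after rescaling, is again of this shape because taking
  the second derivative on \<open>H2H10\<close> is a closed operator.\<close>

lemma closed_J: "closed (J ` X)"
  unfolding closed_sequential_limits
proof (intro allI impI)
  fix z b assume zb: "(\<forall>n. z n \<in> J ` X) \<and> z \<longlonglongrightarrow> b"
  then have "\<forall>n. \<exists>x\<in>X. z n = J x" by auto
  then obtain x where x: "\<And>n. x n \<in> X" "\<And>n. z n = J (x n)" by metis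
  have z: "z = (\<lambda>n. (sqrt (E * I) *\<^sub>R D2 l (fst (x n)), sqrt k *\<^sub>R fst (x n), sqrt (\<rho> * a) *\<^sub>R snd (x n)))"
    by (rule ext) (simp add: x(2) J_def split_beta)
  have lim: "z \<longlonglongrightarrow> b" using zb by simp
  have "(\<lambda>n. fst (z n)) \<longlonglongrightarrow> fst b" "(\<lambda>n. fst (snd (z n))) \<longlonglongrightarrow> fst (snd b)" "(\<lambda>n. snd (snd (z n))) \<longlonglongrightarrow> snd (snd b)"
    by (intro tendsto_intros lim)+
  then have "(\<lambda>n. sqrt (E * I) *\<^sub>R D2 l (fst (x n))) \<longlonglongrightarrow> fst b" "(\<lambda>n. sqrt k *\<^sub>R fst (x n)) \<longlonglongrightarrow> fst (snd b)"
    "(\<lambda>n. sqrt (\<rho> * a) *\<^sub>R snd (x n)) \<longlonglongrightarrow> snd (snd b)"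
    by (simp_all add: z)
  note unscaled = this
  have scaled: "f \<longlonglongrightarrow> inverse c *\<^sub>R y" if "(\<lambda>n. c *\<^sub>R f n) \<longlonglongrightarrow> y" "c > 0" for c y and f :: "nat \<Rightarrow> L2"
    using tendsto_scaleR[OF tendsto_const[of "inverse c"] that(1)] that(2) by simp
  have lims: "(\<lambda>n. D2 l (fst (x n))) \<longlonglongrightarrow> inverse (sqrt (E * I)) *\<^sub>R fst b"
    "(\<lambda>n. fst (x n)) \<longlonglongrightarrow> inverse (sqrt k) *\<^sub>R fst (snd b)"
    "(\<lambda>n. snd (x n)) \<longlonglongrightarrow> inverse (sqrt (\<rho> * a)) *\<^sub>R snd (snd b)"
    using scaled[OF unscaled(1)] scaled[OF unscaled(2)] scaled[OF unscaled(3)] pos by simp_all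
  have xw: "fst (x n) \<in> H2H10 l" for n using x by (simp add: X_iff)
  note H = H2H10_closed[OF l xw lims(2,1)]
  have "snd (x n) \<in> L2_on l" for n using x by (simp add: X_iff)
  then have v: "inverse (sqrt (\<rho> * a)) *\<^sub>R snd (snd b) \<in> L2_on l"
    using closed_sequentially[OF closed_L2_on _ lims(3)] by blast
  have "b = J (inverse (sqrt k) *\<^sub>R fst (snd b), inverse (sqrt (\<rho> * a)) *\<^sub>R snd (snd b))"
    using pos by (simp add: J_def H)
  moreover have "(inverse (sqrt k) *\<^sub>R fst (snd b), inverse (sqrt (\<rho> * a)) *\<^sub>R snd (snd b)) \<in> X"
    using H v by (simp add: X_iff)
  ultimately show "b \<in> J ` X" by blast
qed

sublocale normed_subspace X N J
proof
  show "subspace X"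
    using H2H10_linear(1,2)[OF l] H2H10_zero[OF l] subspace_L2_on[of l]
    unfolding subspace_def by (auto simp: X_iff)
  fix x y :: "L2 \<times> L2" assume x: "x \<in> X"
  show "J (c *\<^sub>R x) = c *\<^sub>R J x" for c
    using H2H10_linear(4)[OF l, of "fst x" "fst x" c] x by (simp add: J_def split_beta X_iff)
  show "N x = norm (J x)"
    using state_norm_sq[OF l, of "fst x" "snd x" E I k \<rho> a] x EI s pos(6) by (simp add: X_iff norm_J)
  assume y: "y \<in> X"
  show "J (x + y) = J x + J y"
    using H2H10_linear(3)[OF l, of "fst x" "fst y"] x y by (simp add: J_def split_beta X_iff scaleR_add_right)
next
  show "inj_on J X"
    using pos by (auto simp: inj_on_def J_def split_beta prod_eq_iff)
  show "closed (J ` X)" by (rule closed_J)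
qed

text \<open>One constant for all three components: \<kappa>^2 dominates each of 1 / (E I), 1 / k and
  1 / (\<rho> a).\<close>

definition \<kappa> :: real where "\<kappa> = sqrt (1 / (E * I) + 1 / k + 1 / (\<rho> * a))"

lemma \<kappa>_pos: "\<kappa> > 0"
  using EI s pos(6) by (simp add: \<kappa>_def add_pos_pos)

lemma norm_le_N:
  assumes "x \<in> X"
  shows "norm (D2 l (fst x)) \<le> \<kappa> * N x" "norm (fst x) \<le> \<kappa> * N x" "norm (snd x) \<le> \<kappa> * N x"
proof -
  have *: "y \<le> \<kappa> * N x" if y: "0 \<le> y" "c * y\<^sup>2 \<le> (N x)\<^sup>2" "c > 0" "1 / c \<le> \<kappa>\<^sup>2" for y c
  proof -
    have "y\<^sup>2 \<le> 1 / c * (N x)\<^sup>2" using y by (simp add: field_simps)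
    also have "\<dots> \<le> \<kappa>\<^sup>2 * (N x)\<^sup>2" using y by (intro mult_right_mono) auto
    finally have "y\<^sup>2 \<le> (\<kappa> * N x)\<^sup>2" by (simp add: power_mult_distrib)
    then show ?thesis by (rule power2_le_imp_le) (use \<kappa>_pos N_nonneg[OF assms] in simp)
  qed
  have k2: "\<kappa>\<^sup>2 = 1 / (E * I) + 1 / k + 1 / (\<rho> * a)"
    using EI s pos(6) by (simp add: \<kappa>_def add_nonneg_nonneg)
  have nn: "0 \<le> 1 / (E * I)" "0 \<le> 1 / k" "0 \<le> 1 / (\<rho> * a)" using EI s pos(6) by simp_all
  have p: "0 \<le> E * I * (norm (D2 l (fst x)))\<^sup>2" "0 \<le> k * (norm (fst x))\<^sup>2" "0 \<le> \<rho> * a * (norm (snd x))\<^sup>2"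
    using EI s pos(6) by simp_all
  show "norm (D2 l (fst x)) \<le> \<kappa> * N x"
    by (rule *[of _ "E * I"]) (use N_sq[OF assms] p nn EI k2 norm_ge_zero[of "D2 l (fst x)"] in linarith)+
  show "norm (fst x) \<le> \<kappa> * N x"
    by (rule *[of _ k]) (use N_sq[OF assms] p nn pos(6) k2 norm_ge_zero[of "fst x"] in linarith)+
  show "norm (snd x) \<le> \<kappa> * N x"
    by (rule *[of _ "\<rho> * a"]) (use N_sq[OF assms] p nn s k2 norm_ge_zero[of "snd x"] in linarith)+
qed

text \<open>Constant of the embedding into bounded functions: |w| is at most sqrt l times the norm
  of w' almost everywhere, and that norm is at most \<kappa> N.\<close>

definition m :: real where "m = sqrt l * \<kappa>"

lemma m_pos: "m > 0" using l \<kappa>_pos by (simp add: m_def)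

text \<open>Stated for any upper bound r of the norm, so that a single bound serves all states near
  a given one.\<close>

lemma ess_le_N:
  assumes "x \<in> X" "N x \<le> r" shows "ess_le (fst x) (m * r)"
proof -
  have w: "fst x \<in> H2H10 l" using assms by (simp add: X_iff)
  have "(norm (wderiv l (fst x)))\<^sup>2 \<le> norm (fst x) * norm (D2 l (fst x))" by (rule norm_wderiv_sq_le[OF l w])
  also have "\<dots> \<le> (\<kappa> * N x) * (\<kappa> * N x)"
    using norm_le_N[OF assms(1)] \<kappa>_pos N_nonneg[OF assms(1)] by (intro mult_mono) auto
  finally have "(norm (wderiv l (fst x)))\<^sup>2 \<le> (\<kappa> * N x)\<^sup>2" by (simp add: power2_eq_square)
  then have "norm (wderiv l (fst x)) \<le> \<kappa> * N x"
    by (rule power2_le_imp_le) (use \<kappa>_pos N_nonneg[OF assms(1)] in simp)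
  also have "\<dots> \<le> \<kappa> * r" using \<kappa>_pos assms(2) by simp
  finally have "sqrt l * norm (wderiv l (fst x)) \<le> m * r" using l by (simp add: m_def mult.assoc)
  then show ?thesis
    using H10_AE_bound[OF l H2H10_D2(1)[OF l w]] unfolding ess_le_def by (auto elim: eventually_mono)
qed

lemma N_snd:
  assumes "b \<in> L2_on l" shows "(0, b) \<in> X" "N (0, b) = sqrt (\<rho> * a) * norm b"
  using assms H2H10_zero[OF l] N_J[of "(0, b)"] s by (auto simp: X_iff norm_J real_sqrt_mult)

text \<open>The bound \<open>\<epsilon> \<le> \<mu> / (2 \<rho> a)\<close> lets the damping \<open>\<mu>\<close> absorb the indefinite term \<open>\<epsilon> \<rho> a \<parallel>v\<parallel>\<^sup>2\<close> in the
  dissipation, and \<open>\<epsilon>\<^sup>2 \<le> k / (4 \<rho> a)\<close> makes \<open>q\<close> equivalent to the energy.\<close>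

definition \<epsilon> :: real where "\<epsilon> = min (\<mu> / (2 * (\<rho> * a))) (sqrt (k / (4 * (\<rho> * a))))"

lemma \<epsilon>: "\<epsilon> > 0" "\<epsilon> * (\<rho> * a) \<le> \<mu> / 2" "4 * \<epsilon>\<^sup>2 * (\<rho> * a) \<le> k"
proof -
  show e: "\<epsilon> > 0" using pos by (simp add: \<epsilon>_def)
  have "\<epsilon> \<le> \<mu> / (2 * (\<rho> * a))" by (simp add: \<epsilon>_def)
  then have "\<epsilon> * (\<rho> * a) \<le> \<mu> / (2 * (\<rho> * a)) * (\<rho> * a)" using s by (intro mult_right_mono) auto
  then show "\<epsilon> * (\<rho> * a) \<le> \<mu> / 2" using pos by simp
  have "\<epsilon>\<^sup>2 \<le> (sqrt (k / (4 * (\<rho> * a))))\<^sup>2" using e by (intro power_mono) (auto simp: \<epsilon>_def)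
  also have "\<dots> = k / (4 * (\<rho> * a))" using s pos(6) by simp
  finally have "4 * (\<rho> * a) * \<epsilon>\<^sup>2 \<le> 4 * (\<rho> * a) * (k / (4 * (\<rho> * a)))" using s by (intro mult_left_mono) auto
  then show "4 * \<epsilon>\<^sup>2 * (\<rho> * a) \<le> k" using pos by (simp add: mult.commute mult.left_commute)
qed

text \<open>The bilinear form whose diagonal is Q; the mixed pairing appears in both orders for
  symmetry.\<close>

definition q :: "L2 \<times> L2 \<Rightarrow> L2 \<times> L2 \<Rightarrow> real" where
  "q x y = E * I * inner (D2 l (fst x)) (D2 l (fst y)) + k * inner (fst x) (fst y) + \<rho> * a * inner (snd x) (snd y)
     + \<epsilon> * (\<rho> * a * inner (fst x) (snd y) + \<rho> * a * inner (snd x) (fst y)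
          + \<mu> * inner (fst x) (fst y) + C\<^sub>d * inner (D2 l (fst x)) (D2 l (fst y)))"

lemma q_lower:
  assumes x: "x \<in> X" shows "(N x)\<^sup>2 / 2 \<le> q x x"
proof -
  let ?w = "norm (fst x)" and ?v = "norm (snd x)" and ?h = "norm (D2 l (fst x))"
  have combine: "n / 2 \<le> Q" if "Q = n + p + r" "0 \<le> r" "- t \<le> p" "t \<le> n / 2" for n p r t Q :: real
    using that by linarith
  have "q x x = (N x)\<^sup>2 + 2 * \<epsilon> * (\<rho> * a) * inner (fst x) (snd x) + \<epsilon> * (\<mu> * ?w\<^sup>2 + C\<^sub>d * ?h\<^sup>2)"
    unfolding N_sq[OF x] q_def
    by (simp add: power2_norm_eq_inner inner_commute[of "snd x" "fst x"] algebra_simps)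
  moreover have "0 \<le> \<epsilon> * (\<mu> * ?w\<^sup>2 + C\<^sub>d * ?h\<^sup>2)" using \<epsilon>(1) pos by (intro mult_nonneg_nonneg add_nonneg_nonneg) auto
  moreover have "2 * \<epsilon> * (\<rho> * a) * inner (fst x) (snd x) \<ge> - ((k * ?w\<^sup>2 + \<rho> * a * ?v\<^sup>2) / 2)"
  proof -
    have "2 * \<epsilon> * (\<rho> * a) * \<bar>inner (fst x) (snd x)\<bar> \<le> 2 * \<epsilon> * (\<rho> * a) * (?w * ?v)"
      using \<epsilon>(1) s by (intro mult_left_mono Cauchy_Schwarz_ineq2) auto
    \<comment> \<open>Young's inequality with the weight 2 \<epsilon> on w, so that the coefficient
      of |w|^2 is half of 4 \<epsilon>^2 \<rho> a, hence at most k / 2.\<close>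
    also have "\<dots> \<le> (\<rho> * a) / 2 * ((2 * \<epsilon> * ?w)\<^sup>2 + ?v\<^sup>2)"
    proof -
      have "2 * (2 * \<epsilon> * ?w) * ?v \<le> (2 * \<epsilon> * ?w)\<^sup>2 + ?v\<^sup>2" by (rule sum_squares_bound)
      from mult_left_mono[OF this, of "\<rho> * a / 2"] show ?thesis using s by (simp add: algebra_simps)
    qed
    also have "\<dots> = (4 * \<epsilon>\<^sup>2 * (\<rho> * a) * ?w\<^sup>2 + \<rho> * a * ?v\<^sup>2) / 2"
      by (simp add: power_mult_distrib algebra_simps)
    also have "\<dots> \<le> (k * ?w\<^sup>2 + \<rho> * a * ?v\<^sup>2) / 2"
      by (intro divide_right_mono add_right_mono mult_right_mono \<epsilon>(3)) simp_all
    finally have up: "2 * \<epsilon> * (\<rho> * a) * \<bar>inner (fst x) (snd x)\<bar> \<le> (k * ?w\<^sup>2 + \<rho> * a * ?v\<^sup>2) / 2" .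
    have "0 \<le> 2 * \<epsilon> * (\<rho> * a)" using \<epsilon>(1) s by simp
    then have "\<bar>2 * \<epsilon> * (\<rho> * a) * inner (fst x) (snd x)\<bar> \<le> (k * ?w\<^sup>2 + \<rho> * a * ?v\<^sup>2) / 2"
      using up unfolding abs_mult[of "2 * \<epsilon> * (\<rho> * a)"] by (simp only: abs_of_nonneg)
    from abs_le_D2[OF this] show ?thesis by (subst minus_le_iff)
  qed
  moreover have "(k * ?w\<^sup>2 + \<rho> * a * ?v\<^sup>2) / 2 \<le> (N x)\<^sup>2 / 2"
    unfolding N_sq[OF x] using EI by simp
  ultimately show ?thesis by (rule combine)
qed

section \<open>Dissipation on the domain of the generator\<close>

lemma dom_A_X:
  assumes "x \<in> \<D>"
  shows "x \<in> X" "\<A> x \<in> X"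
    "snd x \<in> H2H10 l" "(E * I) *\<^sub>R fst x + C\<^sub>d *\<^sub>R snd x \<in> dom_A0 l"
proof -
  show x: "x \<in> X" and v: "snd x \<in> H2H10 l" and z: "(E * I) *\<^sub>R fst x + C\<^sub>d *\<^sub>R snd x \<in> dom_A0 l"
    using assms by (auto simp: dom_A_def H2H10_def)
  have w: "fst x \<in> H2H10 l" using x by (simp add: X_iff)
  show "\<A> x \<in> X"
    using v inner_fourth_derivative(2)[OF l z v] H2H10_D2(4)[OF l v] H2H10_D2(4)[OF l w]
    unfolding X_iff op_A_def split_beta fst_conv snd_conv
    by (intro conjI subspace_diff[OF subspace_L2_on] subspace_mul[OF subspace_L2_on] subspace_add[OF subspace_L2_on])
qed

lemma q_dissipative:
  assumes "x \<in> \<D>"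
  shows "q x (\<A> x) \<le> - \<epsilon> * (N x)\<^sup>2"
proof -
  define w v where "w = fst x" and "v = snd x"
  define z where "z = (E * I) *\<^sub>R w + C\<^sub>d *\<^sub>R v"
  note X = dom_A_X[OF assms]
  have w: "w \<in> H2H10 l" and v: "v \<in> H2H10 l" using X by (simp_all add: X_iff w_def v_def)
  have z: "z \<in> dom_A0 l" using X(4) by (simp add: z_def w_def v_def)
  have zD: "D2 l z = (E * I) *\<^sub>R D2 l w + C\<^sub>d *\<^sub>R D2 l v"
    unfolding z_def using H2H10_linear[OF l w v] H2H10_linear[OF l v v]
      H2H10_linear(3)[OF l H2H10_linear(2)[OF l w v, of "E * I"] H2H10_linear(2)[OF l v v, of C\<^sub>d]] by simp
  define b where "b = snd (\<A> x)"
  have A: "fst (\<A> x) = v" by (simp add: op_A_def split_beta v_def)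
  \<comment> \<open>Weak form of the second component of A x. It is used with y = v for the energy
    and with y = w for the cross term; v is admissible because on the domain it lies in
    \<open>H2H10\<close>.\<close>
  have b: "\<rho> * a * inner y b = - inner (D2 l y) (D2 l z) - \<mu> * inner y v - k * inner y w" if "y \<in> H2H10 l" for y
  proof -
    have "(\<rho> * a) *\<^sub>R b = - A0 l z - (\<mu> *\<^sub>R v + k *\<^sub>R w)"
      using pos by (simp add: b_def op_A_def split_beta w_def v_def z_def scaleR_diff_right)
    then have "\<rho> * a * inner y b = inner y (- A0 l z - (\<mu> *\<^sub>R v + k *\<^sub>R w))"
      by (metis inner_scaleR_right)
    also have "\<dots> = - inner (D2 l y) (D2 l z) - \<mu> * inner y v - k * inner y w"
      by (simp add: inner_diff_right inner_add_right inner_fourth_derivative(1)[OF l z that])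
    finally show ?thesis .
  qed
  have "q x (\<A> x) = E * I * inner (D2 l w) (D2 l v) + k * inner w v + \<rho> * a * inner v b
     + \<epsilon> * (\<rho> * a * inner w b + \<rho> * a * inner v v + \<mu> * inner w v + C\<^sub>d * inner (D2 l w) (D2 l v))"
    by (simp add: q_def A flip: w_def v_def b_def)
  also have "\<dots> = - C\<^sub>d * (norm (D2 l v))\<^sup>2 - (\<mu> - \<epsilon> * (\<rho> * a)) * (norm v)\<^sup>2
      - \<epsilon> * (E * I * (norm (D2 l w))\<^sup>2 + k * (norm w)\<^sup>2)"
    unfolding b[OF w] b[OF v] zD power2_norm_eq_inner
    by (simp add: inner_add_right inner_commute algebra_simps)
  also have "\<dots> \<le> - (\<epsilon> * (\<rho> * a)) * (norm v)\<^sup>2 - \<epsilon> * (E * I * (norm (D2 l w))\<^sup>2 + k * (norm w)\<^sup>2)"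
  proof -
    have "0 \<le> C\<^sub>d * (norm (D2 l v))\<^sup>2" using pos by simp
    moreover have half: "r \<le> p - r" if "r \<le> p / 2" for r p :: real using that by linarith
    have "\<epsilon> * (\<rho> * a) * (norm v)\<^sup>2 \<le> (\<mu> - \<epsilon> * (\<rho> * a)) * (norm v)\<^sup>2"
      by (intro mult_right_mono half \<epsilon>(2)) simp
    ultimately show ?thesis by simp
  qed
  also have "\<dots> = - \<epsilon> * (N x)\<^sup>2" unfolding N_sq[OF X(1)] w_def v_def by (simp add: algebra_simps)
  finally show ?thesis .
qed

sublocale generator_on X N J T \<D> \<A> q
proof
  show "strongly_continuous_semigroup X N T" using gen by (simp add: generates_def)
  show "generates X N (\<D>) (\<A>) T" by (rule gen)
  show "x \<in> \<D> \<Longrightarrow> x \<in> X \<and> \<A> x \<in> X" for x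
    using dom_A_X by blast
  fix x y z :: "L2 \<times> L2" and c :: real assume x: "x \<in> X" and y: "y \<in> X"
  show "q x y = q y x" by (simp add: q_def inner_commute algebra_simps)
  show "q (c *\<^sub>R x) y = c * q x y"
    using H2H10_linear(4)[OF l, of "fst x" "fst x" c] x by (simp add: q_def X_iff algebra_simps)
  show "q (x + y) z = q x z + q y z"
    using H2H10_linear(3)[OF l, of "fst x" "fst y"] x y by (simp add: q_def X_iff inner_add_left algebra_simps)
next
  have "\<bar>q x y\<bar> \<le> ((E * I + k + \<rho> * a + \<epsilon> * (2 * (\<rho> * a) + \<mu> + C\<^sub>d)) * \<kappa>\<^sup>2) * N x * N y" if x: "x \<in> X" and y: "y \<in> X" for x y
  proof -
    let ?B = "\<kappa>\<^sup>2 * N x * N y"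
    have b: "\<bar>inner u v\<bar> \<le> ?B" if "norm u \<le> \<kappa> * N x" "norm v \<le> \<kappa> * N y" for u v :: L2
    proof -
      have "\<bar>inner u v\<bar> \<le> norm u * norm v" by (rule Cauchy_Schwarz_ineq2)
      also have "\<dots> \<le> (\<kappa> * N x) * (\<kappa> * N y)" using that \<kappa>_pos N_nonneg[OF x] by (intro mult_mono) auto
      finally show ?thesis by (simp add: power2_eq_square mult.assoc mult.left_commute)
    qed
    have c: "\<bar>r * inner u v\<bar> \<le> r * ?B" if "norm u \<le> \<kappa> * N x" "norm v \<le> \<kappa> * N y" "r \<ge> 0" for u v :: L2 and r
      unfolding abs_mult using b[OF that(1,2)] that(3) by (simp add: mult_left_mono)
    note n = norm_le_N[OF x] norm_le_N[OF y]
    have p: "0 \<le> E * I" "0 \<le> k" "0 \<le> \<rho> * a" "0 \<le> \<mu>" "0 \<le> C\<^sub>d" using EI s pos by auto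
    have 1: "\<bar>\<rho> * a * inner (fst x) (snd y) + \<rho> * a * inner (snd x) (fst y)
          + \<mu> * inner (fst x) (fst y) + C\<^sub>d * inner (D2 l (fst x)) (D2 l (fst y))\<bar> \<le> (2 * (\<rho> * a) + \<mu> + C\<^sub>d) * ?B"
      using c[OF n(2) n(6) p(3)] c[OF n(3) n(5) p(3)] c[OF n(2) n(5) p(4)] c[OF n(1) n(4) p(5)]
      unfolding distrib_right by linarith
    have "\<bar>\<epsilon> * (\<rho> * a * inner (fst x) (snd y) + \<rho> * a * inner (snd x) (fst y)
          + \<mu> * inner (fst x) (fst y) + C\<^sub>d * inner (D2 l (fst x)) (D2 l (fst y)))\<bar> \<le> \<epsilon> * ((2 * (\<rho> * a) + \<mu> + C\<^sub>d) * ?B)"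
      using mult_left_mono[OF 1, of \<epsilon>] \<epsilon>(1) by (simp add: abs_mult)
    with c[OF n(1) n(4) p(1)] c[OF n(2) n(5) p(2)] c[OF n(3) n(6) p(3)]
    have "\<bar>q x y\<bar> \<le> E * I * ?B + k * ?B + \<rho> * a * ?B + \<epsilon> * ((2 * (\<rho> * a) + \<mu> + C\<^sub>d) * ?B)"
      unfolding q_def by linarith
    then show ?thesis by (simp add: algebra_simps)
  qed
  then show "\<exists>C. \<forall>x\<in>X. \<forall>y\<in>X. \<bar>q x y\<bar> \<le> C * N x * N y" by blast
qed

text \<open>The factor is forced: the derivative of \<alpha> / 2 times the integral of w^4 is 2
  \<alpha> <w^3, v>, the opposite of what the nonlinearity contributes to the derivative of q
  through the pairing with v.\<close>

definition lyapunov :: "L2 \<times> L2 \<Rightarrow> real" where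
  "lyapunov x = q x x + \<alpha> / 2 * quartic (fst x)"

lemma q_nonneg: "x \<in> X \<Longrightarrow> 0 \<le> q x x"
  by (rule order_trans[OF _ q_lower]) simp_all

lemma quartic_state_nonneg: "x \<in> X \<Longrightarrow> 0 \<le> quartic (fst x)"
  using quartic_nonneg[OF ess_le_N[OF _ order_refl]] .

lemma lyapunov_lower: "x \<in> X \<Longrightarrow> (N x)\<^sup>2 / 2 \<le> lyapunov x"
  using q_lower[of x] quartic_state_nonneg[of x] pos(7) unfolding lyapunov_def
  by (simp add: add_increasing2)

lemma lyapunov_upper:
  obtains C C' where "C > 0" "C' > 0" "\<And>x. x \<in> X \<Longrightarrow> lyapunov x \<le> C * (N x)\<^sup>2 + C' * (N x) ^ 4"
proof -
  obtain C where C: "C > 0" "\<And>x y. x \<in> X \<Longrightarrow> y \<in> X \<Longrightarrow> \<bar>q x y\<bar> \<le> C * N x * N y" by (rule q_boundE) blast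
  have "lyapunov x \<le> C * (N x)\<^sup>2 + (\<alpha> / 2 * m\<^sup>2 * \<kappa>\<^sup>2) * (N x) ^ 4" if x: "x \<in> X" for x
  proof -
    have "quartic (fst x) \<le> (m * N x)\<^sup>2 * (norm (fst x))\<^sup>2" by (rule quartic_le[OF ess_le_N[OF x order_refl]])
    also have "\<dots> \<le> (m * N x)\<^sup>2 * (\<kappa> * N x)\<^sup>2" using norm_le_N(2)[OF x] by (intro mult_left_mono power_mono) auto
    also have "\<dots> = m\<^sup>2 * \<kappa>\<^sup>2 * (N x) ^ 4" by (simp add: power_mult_distrib power4_eq_xxxx power2_eq_square)
    finally have "\<alpha> / 2 * quartic (fst x) \<le> \<alpha> / 2 * (m\<^sup>2 * \<kappa>\<^sup>2 * (N x) ^ 4)"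
      using pos(7) by (intro mult_left_mono) auto
    moreover have "q x x \<le> C * (N x)\<^sup>2" using C(2)[OF x x] by (simp add: power2_eq_square mult.assoc)
    ultimately show ?thesis by (simp add: lyapunov_def mult.assoc)
  qed
  moreover have "\<alpha> / 2 * m\<^sup>2 * \<kappa>\<^sup>2 > 0" using pos(7) m_pos \<kappa>_pos by simp
  ultimately show ?thesis using that[of C "\<alpha> / 2 * m\<^sup>2 * \<kappa>\<^sup>2"] C(1) by blast
qed

section \<open>Nonlinearity and input as a forcing term\<close>

lemma op_F_eq: "\<F> x = (0, - (\<alpha> / (\<rho> * a)) *\<^sub>R cube (fst x))"
  by (simp add: op_F_def split_beta cube_def)

lemma op_F_X:
  assumes "x \<in> X" shows "\<F> x \<in> X"
proof -
  have "cube (fst x) \<in> L2_on l"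
    by (rule cube_L2_on[OF ess_le_N[OF assms order_refl]]) (use assms H2H10_D2(4)[OF l] in \<open>auto simp: X_iff\<close>)
  then show ?thesis unfolding op_F_eq by (intro N_snd subspace_mul[OF subspace_L2_on])
qed

lemma op_B_X: "b \<in> L2_on l \<Longrightarrow> \<B> b \<in> X"
  unfolding op_B_def by (intro N_snd subspace_mul[OF subspace_L2_on])

lemma T_rate:
  obtains c where "c > 0" "\<And>x t. x \<in> X \<Longrightarrow> t \<ge> 0 \<Longrightarrow> q (T t x) (T t x) \<le> exp (- c * t) * q x x"
proof -
  obtain C where C: "C > 0" "\<And>x y. x \<in> X \<Longrightarrow> y \<in> X \<Longrightarrow> \<bar>q x y\<bar> \<le> C * N x * N y" by (rule q_boundE) blast
  \<comment> \<open>As q x x \<le> C (N x)^2, the dissipation 2 \<epsilon> (N x)^2 is at least c q x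
    x.\<close>
  define c where "c = 2 * \<epsilon> / C"
  have c: "c > 0" using C \<epsilon>(1) by (simp add: c_def)
  have "2 * q x (\<A> x) \<le> - c * q x x" if x: "x \<in> \<D>" for x
  proof -
    have "q x x \<le> C * (N x)\<^sup>2"
      using C(2)[OF dom_A_X(1)[OF x] dom_A_X(1)[OF x]] by (simp add: power2_eq_square mult.assoc)
    then have "c * q x x \<le> c * (C * (N x)\<^sup>2)" using c by (intro mult_left_mono) auto
    also have "\<dots> = 2 * (\<epsilon> * (N x)\<^sup>2)" using C by (simp add: c_def)
    finally show ?thesis using q_dissipative[OF x] by simp
  qed
  with q_contraction[OF _ c] c that show ?thesis by blast
qed

text \<open>The difference quotients of w converge in L2 only. The premise on \<open>N (y h)\<close>
  provides a common essential bound, and with it the remainder of \<open>quartic_expand\<close> is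
  of second order in h.\<close>

lemma quartic_first_order:
  assumes x: "x \<in> X" and y: "\<And>h. h > 0 \<Longrightarrow> y h \<in> X"
    and d: "((\<lambda>h. norm ((1 / h) *\<^sub>R (fst (y h) - fst x) - v)) \<longlongrightarrow> 0) (at_right 0)"
    and b: "\<forall>\<^sub>F h in at_right 0. N (y h) \<le> N x + 1" and e: "e > 0"
  shows "\<forall>\<^sub>F h in at_right 0. quartic (fst (y h)) \<le> quartic (fst x) + h * (4 * inner (cube (fst x)) v + e)"
proof -
  define M where "M = m * (N x + 1)"
  define r where "r h = norm ((1 / h) *\<^sub>R (fst (y h) - fst x) - v)" for h
  have r: "(r \<longlongrightarrow> 0) (at_right 0)" using d unfolding r_def .
  have wM: "ess_le (fst x) M" unfolding M_def by (rule ess_le_N[OF x]) simp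
  have "((\<lambda>h. 4 * (norm (cube (fst x)) * r h) + h * (6 * M\<^sup>2 * (norm v + r h)\<^sup>2)) \<longlongrightarrow>
      4 * (norm (cube (fst x)) * 0) + 0 * (6 * M\<^sup>2 * (norm v + 0)\<^sup>2)) (at_right 0)"
    by (intro tendsto_intros r)
  then have "\<forall>\<^sub>F h in at_right 0. 4 * (norm (cube (fst x)) * r h) + h * (6 * M\<^sup>2 * (norm v + r h)\<^sup>2) < e"
    by (rule order_tendstoD) (use e in simp)
  moreover have "\<forall>\<^sub>F h in at_right (0::real). h > 0" by (simp add: eventually_at_right_less)
  ultimately show ?thesis using b
  proof eventually_elim
    case (elim h)
    define \<delta> where "\<delta> = (1 / h) *\<^sub>R (fst (y h) - fst x)"
    have \<delta>: "fst (y h) - fst x = h *\<^sub>R \<delta>" using elim by (simp add: \<delta>_def)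
    have r\<delta>: "r h = norm (\<delta> - v)" by (simp add: r_def \<delta>_def)
    have "ess_le (fst (y h)) M" unfolding M_def by (rule ess_le_N[OF y[OF elim(2)] elim(3)])
    from quartic_expand[OF wM this]
    have "quartic (fst (y h)) \<le> quartic (fst x) + h * (4 * inner (cube (fst x)) \<delta> + h * (6 * M\<^sup>2 * (norm \<delta>)\<^sup>2))"
      unfolding \<delta> by (simp add: power_mult_distrib algebra_simps power2_eq_square)
    also have "\<dots> \<le> quartic (fst x) + h * (4 * inner (cube (fst x)) v + e)"
    proof -
      have "inner (cube (fst x)) \<delta> = inner (cube (fst x)) v + inner (cube (fst x)) (\<delta> - v)"
        by (simp add: inner_diff_right)
      then have 1: "inner (cube (fst x)) \<delta> \<le> inner (cube (fst x)) v + norm (cube (fst x)) * r h"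
        using norm_cauchy_schwarz[of "cube (fst x)" "\<delta> - v"] r\<delta> by simp
      have "norm \<delta> \<le> norm v + r h" using norm_triangle_ineq[of v "\<delta> - v"] r\<delta> by simp
      then have "h * (6 * M\<^sup>2 * (norm \<delta>)\<^sup>2) \<le> h * (6 * M\<^sup>2 * (norm v + r h)\<^sup>2)"
        using elim by (intro mult_left_mono power_mono) auto
      with 1 elim(1) have "4 * inner (cube (fst x)) \<delta> + h * (6 * M\<^sup>2 * (norm \<delta>)\<^sup>2) \<le> 4 * inner (cube (fst x)) v + e"
        by linarith
      then show ?thesis using elim(2) by (intro add_left_mono mult_left_mono) auto
    qed
    finally show ?case .
  qed
qed

text \<open>The first component of \<open>T h x - x\<close> is the second component of the integral of \<open>T s x\<close> over
  \<open>[0, h]\<close>; this is where \<open>w' = v\<close> enters without \<open>x\<close> being in the domain of the generator.\<close>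

lemma fst_right_derivative:
  assumes x: "x \<in> X" and y: "\<And>h. h > 0 \<Longrightarrow> y h \<in> X" and p: "p \<in> X" "fst p = 0"
    and lim: "((\<lambda>h. N ((1 / h) *\<^sub>R (y h - T h x) - p)) \<longlongrightarrow> 0) (at_right 0)"
  shows "((\<lambda>h. norm ((1 / h) *\<^sub>R (fst (y h) - fst x) - snd x)) \<longlongrightarrow> 0) (at_right 0)"
proof -
  obtain Y where Y: "\<And>h. h > 0 \<Longrightarrow> Y h \<in> \<D>"
    "\<And>h. h > 0 \<Longrightarrow> \<A> (Y h) = T h x - x"
    "((\<lambda>h. N ((1 / h) *\<^sub>R Y h - x)) \<longlongrightarrow> 0) (at_right 0)" by (rule D_dense[OF x]) blast
  show ?thesis
  proof (rule Lim_null_comparison)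
    have "((\<lambda>h. \<kappa> * N ((1 / h) *\<^sub>R Y h - x) + \<kappa> * N ((1 / h) *\<^sub>R (y h - T h x) - p)) \<longlongrightarrow> \<kappa> * 0 + \<kappa> * 0) (at_right 0)"
      by (intro tendsto_intros lim Y(3))
    then show "((\<lambda>h. \<kappa> * N ((1 / h) *\<^sub>R Y h - x) + \<kappa> * N ((1 / h) *\<^sub>R (y h - T h x) - p)) \<longlongrightarrow> 0) (at_right 0)" by simp
    have "\<forall>\<^sub>F h in at_right (0::real). h > 0" by (simp add: eventually_at_right_less)
    then show "\<forall>\<^sub>F h in at_right 0. norm (norm ((1 / h) *\<^sub>R (fst (y h) - fst x) - snd x))
        \<le> \<kappa> * N ((1 / h) *\<^sub>R Y h - x) + \<kappa> * N ((1 / h) *\<^sub>R (y h - T h x) - p)"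
    proof eventually_elim
      case (elim h)
      let ?u = "(1 / h) *\<^sub>R Y h - x" and ?d = "(1 / h) *\<^sub>R (y h - T h x) - p"
      have V: "?u \<in> X" "?d \<in> X" using dom_A_X(1)[OF Y(1)[OF elim]] x y[OF elim] p elim by auto
      have "snd (Y h) = fst (\<A> (Y h))" by (simp add: op_A_def split_beta)
      then have sY: "snd (Y h) = fst (T h x) - fst x" using Y(2)[OF elim] by simp
      have "(1 / h) *\<^sub>R (fst (y h) - fst x) - snd x = snd ?u + fst ?d"
        by (simp add: sY p scaleR_diff_right)
      then have "norm ((1 / h) *\<^sub>R (fst (y h) - fst x) - snd x) \<le> norm (snd ?u) + norm (fst ?d)"
        by (metis norm_triangle_ineq)
      also have "\<dots> \<le> \<kappa> * N ?u + \<kappa> * N ?d" by (intro add_mono norm_le_N V)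
      finally show ?case by simp
    qed
  qed
qed

text \<open>The forcing has no first component, so of q only the pairings of its second component
  with v and, with factor \<epsilon>, with w survive; their weight \<rho> a cancels the
  denominators.\<close>

lemma q_forcing:
  assumes "x \<in> X"
  shows "q x (\<F> x + \<B> b) =
    inner (snd x) b - \<alpha> * inner (cube (fst x)) (snd x) + \<epsilon> * (inner (fst x) b - \<alpha> * quartic (fst x))"
proof -
  define f where "f = - (\<alpha> / (\<rho> * a)) *\<^sub>R cube (fst x) + (1 / (\<rho> * a)) *\<^sub>R b"
  have e: "\<F> x + \<B> b = (0, f)" by (simp add: op_F_eq op_B_def f_def)
  have f: "\<rho> * a * inner y f = inner y b - \<alpha> * inner y (cube (fst x))" for y
    using pos by (simp add: f_def inner_add_right inner_diff_right distrib_left right_diff_distrib)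
  then show ?thesis
    unfolding e q_def by (simp add: H2H10_zero[OF l] quartic_def inner_commute[of "cube (fst x)"])
qed

text \<open>The products 2 \<alpha> <w^3, v> cancel. Half of the decay c q pays for the input by
  Young's inequality, leaving the rate c / 2 for q; the quartic integral, weighted by \<alpha> / 2
  in \<open>lyapunov\<close>, comes with - 2 \<epsilon> \<alpha>, that is with rate 4
  \<epsilon>.\<close>

lemma lyapunov_decay:
  assumes c: "c > 0" and x: "x \<in> X" and b: "norm b \<le> S"
  shows "- c * q x x + 2 * q x (\<F> x + \<B> b) + \<alpha> / 2 * (4 * inner (cube (fst x)) (snd x))
    \<le> 4 * ((1 + \<epsilon>) * \<kappa>)\<^sup>2 / c * S\<^sup>2 - min (c / 2) (4 * \<epsilon>) * lyapunov x"
proof -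
  define n where "n = N x"
  define \<kappa>1 where "\<kappa>1 = (1 + \<epsilon>) * \<kappa>"
  have n: "n \<ge> 0" using N_nonneg[OF x] by (simp add: n_def)
  have S: "S \<ge> 0" using b norm_ge_zero[of b] by linarith
  have ib: "inner u b \<le> \<kappa> * n * S" if "norm u \<le> \<kappa> * N x" for u
  proof -
    have "inner u b \<le> norm u * norm b" by (rule norm_cauchy_schwarz)
    also have "\<dots> \<le> \<kappa> * n * S" using that b \<kappa>_pos n by (intro mult_mono) (auto simp: n_def)
    finally show ?thesis .
  qed
  have "2 * inner (snd x) b + 2 * \<epsilon> * inner (fst x) b \<le> 2 * (\<kappa> * n * S) + 2 * \<epsilon> * (\<kappa> * n * S)"
    using ib[OF norm_le_N(3)[OF x]] ib[OF norm_le_N(2)[OF x]] \<epsilon>(1) by (intro add_mono mult_left_mono) auto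
  also have "\<dots> = 2 * \<kappa>1 * n * S" by (simp add: \<kappa>1_def algebra_simps)
  also have "\<dots> \<le> c / 4 * n\<^sup>2 + 4 * \<kappa>1\<^sup>2 / c * S\<^sup>2"
  proof -
    \<comment> \<open>Weighted so that, after division by 4 c, the state contributes c n^2 / 4,
      which is at most c / 2 times q x x since q x x \<ge> n^2 / 2.\<close>
    have "2 * (c * n) * (4 * \<kappa>1 * S) \<le> (c * n)\<^sup>2 + (4 * \<kappa>1 * S)\<^sup>2" by (rule sum_squares_bound)
    then have "(2 * (c * n) * (4 * \<kappa>1 * S)) / (4 * c) \<le> ((c * n)\<^sup>2 + (4 * \<kappa>1 * S)\<^sup>2) / (4 * c)"
      using c by (intro divide_right_mono) auto
    moreover have "(2 * (c * n) * (4 * \<kappa>1 * S)) / (4 * c) = 2 * \<kappa>1 * n * S" using c by simp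
    moreover have "((c * n)\<^sup>2 + (4 * \<kappa>1 * S)\<^sup>2) / (4 * c) = c / 4 * n\<^sup>2 + 4 * \<kappa>1\<^sup>2 / c * S\<^sup>2"
      using c by (simp add: power_mult_distrib add_divide_distrib power2_eq_square ac_simps)
    ultimately show ?thesis by (simp only:)
  qed
  also have "c / 4 * n\<^sup>2 \<le> c / 2 * q x x"
  proof -
    have "c / 2 * (n\<^sup>2 / 2) \<le> c / 2 * q x x" using q_lower[OF x] c by (intro mult_left_mono) (auto simp: n_def)
    then show ?thesis by simp
  qed
  finally have in_bound: "2 * inner (snd x) b + 2 * \<epsilon> * inner (fst x) b \<le> c / 2 * q x x + 4 * \<kappa>1\<^sup>2 / c * S\<^sup>2" by simp
  have "min (c / 2) (4 * \<epsilon>) * q x x \<le> c / 2 * q x x"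
    using q_nonneg[OF x] by (intro mult_right_mono) auto
  moreover have "min (c / 2) (4 * \<epsilon>) * (\<alpha> / 2 * quartic (fst x)) \<le> 4 * \<epsilon> * (\<alpha> / 2 * quartic (fst x))"
    using quartic_state_nonneg[OF x] pos(7) by (intro mult_right_mono) auto
  ultimately have decay: "min (c / 2) (4 * \<epsilon>) * lyapunov x \<le> c / 2 * q x x + 4 * \<epsilon> * (\<alpha> / 2 * quartic (fst x))"
    unfolding lyapunov_def distrib_left by (rule add_mono)
  have eq: "- c * q x x + 2 * q x (\<F> x + \<B> b) + \<alpha> / 2 * (4 * inner (cube (fst x)) (snd x))
      = - (c / 2 * q x x + c / 2 * q x x) + (2 * inner (snd x) b + 2 * \<epsilon> * inner (fst x) b) - 4 * \<epsilon> * (\<alpha> / 2 * quartic (fst x))"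
    unfolding q_forcing[OF x] by (simp add: algebra_simps)
  have combine: "- (h + h) + B - D \<le> K - M" if "B \<le> h + K" "M \<le> h + D" for h B D K M :: real
    using that by linarith
  show ?thesis unfolding eq by (rule combine[OF in_bound[unfolded \<kappa>1_def] decay])
qed

text \<open>The input enters through its right limit \<open>up\<close>, since u may jump at t. Near
  x t the cubic term is Lipschitz in the state norm, with a constant depending on N (x t).\<close>

lemma forcing_continuous:
  fixes t :: real
  assumes x: "\<And>s. s \<ge> 0 \<Longrightarrow> x s \<in> X" and u: "\<And>s. s \<ge> 0 \<Longrightarrow> u s \<in> L2_on l" and up: "up \<in> L2_on l"
    and lx: "((\<lambda>s. N (x s - x t)) \<longlongrightarrow> 0) (at_right t)" and lu: "(u \<longlongrightarrow> up) (at_right t)" and t: "t \<ge> 0"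
  shows "((\<lambda>s. N (\<F> (x s) + \<B> (u s) - (\<F> (x t) + \<B> up))) \<longlongrightarrow> 0) (at_right t)"
proof (rule Lim_null_comparison)
  define M where "M = m * (N (x t) + 1)"
  let ?R = "\<lambda>s. sqrt (\<rho> * a) * (\<alpha> / (\<rho> * a) * (3 * M\<^sup>2 * (\<kappa> * N (x s - x t))) + 1 / (\<rho> * a) * norm (u s - up))"
  have "(?R \<longlongrightarrow> sqrt (\<rho> * a) * (\<alpha> / (\<rho> * a) * (3 * M\<^sup>2 * (\<kappa> * 0)) + 1 / (\<rho> * a) * norm (up - up))) (at_right t)"
    by (intro tendsto_intros lx lu)
  then show "(?R \<longlongrightarrow> 0) (at_right t)" by simp
  have "\<forall>\<^sub>F s in at_right t. N (x s - x t) < 1" by (rule order_tendstoD(2)[OF lx]) simp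
  moreover have "\<forall>\<^sub>F s in at_right t. s > t" by (rule eventually_at_right_less)
  ultimately show "\<forall>\<^sub>F s in at_right t. norm (N (\<F> (x s) + \<B> (u s) - (\<F> (x t) + \<B> up))) \<le> ?R s"
  proof eventually_elim
    case (elim s)
    have s0: "s \<ge> 0" using elim t by simp
    have xs: "x s \<in> X" "x t \<in> X" "x s - x t \<in> X" using x[OF s0] x[OF t] by auto
    have "N (x s) \<le> N (x t) + 1" using N_add[OF xs(2,3)] elim by simp
    then have "ess_le (fst (x s)) M" "ess_le (fst (x t)) M"
      unfolding M_def using ess_le_N xs by auto
    then have "norm (cube (fst (x s)) - cube (fst (x t))) \<le> 3 * M\<^sup>2 * norm (fst (x s) - fst (x t))"
      by (rule cube_lipschitz)
    also have "\<dots> \<le> 3 * M\<^sup>2 * (\<kappa> * N (x s - x t))"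
      using norm_le_N(2)[OF xs(3)] by (intro mult_left_mono) auto
    finally have cb: "norm (cube (fst (x s)) - cube (fst (x t))) \<le> 3 * M\<^sup>2 * (\<kappa> * N (x s - x t))" .
    let ?b = "- (\<alpha> / (\<rho> * a)) *\<^sub>R (cube (fst (x s)) - cube (fst (x t))) + (1 / (\<rho> * a)) *\<^sub>R (u s - up)"
    have eq: "\<F> (x s) + \<B> (u s) - (\<F> (x t) + \<B> up) = (0, ?b)"
      by (simp add: op_F_eq op_B_def algebra_simps)
    have "(0, ?b) \<in> X"
      unfolding eq[symmetric] using op_F_X op_B_X xs u[OF s0] up by (intro V_simps) auto
    then have "?b \<in> L2_on l" by (simp add: X_iff)
    then have "N (0, ?b) = sqrt (\<rho> * a) * norm ?b" by (rule N_snd)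
    also have "\<dots> \<le> sqrt (\<rho> * a) * (\<alpha> / (\<rho> * a) * norm (cube (fst (x s)) - cube (fst (x t))) + 1 / (\<rho> * a) * norm (u s - up))"
    proof (rule mult_left_mono)
      have "norm ?b \<le> norm (- (\<alpha> / (\<rho> * a)) *\<^sub>R (cube (fst (x s)) - cube (fst (x t)))) + norm ((1 / (\<rho> * a)) *\<^sub>R (u s - up))"
        by (rule norm_triangle_ineq)
      then show "norm ?b \<le> \<alpha> / (\<rho> * a) * norm (cube (fst (x s)) - cube (fst (x t))) + 1 / (\<rho> * a) * norm (u s - up)"
        unfolding norm_scaleR using pos by simp
    qed (use s in simp)
    also have "\<dots> \<le> ?R s"
      using cb pos by (intro mult_left_mono add_right_mono) auto
    finally have "N (0, ?b) \<le> ?R s" .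
    then show ?case unfolding eq using N_nonneg[OF \<open>(0, ?b) \<in> X\<close>] by simp
  qed
qed

text \<open>The right-hand estimates of q and of the quartic integral along the mild solution,
  combined by \<open>lyapunov_decay\<close>, are the hypothesis of
  \<open>dini_exponential_bound\<close>, with the input term as K and rate
  \<open>min (c / 2) (4 * \<epsilon>)\<close>.\<close>

lemma mild_solution_estimate:
  assumes c: "c > 0" "\<And>x t. x \<in> X \<Longrightarrow> t \<ge> 0 \<Longrightarrow> q (T t x) (T t x) \<le> exp (- c * t) * q x x"
    and x0: "x0 \<in> X" and u: "u \<in> PC (L2_on l)"
    and mild: "mild_solution X N T \<F> \<B> x0 u x" and t: "t \<ge> 0"
  shows "lyapunov (x t) \<le> exp (- min (c / 2) (4 * \<epsilon>) * t) * lyapunov x0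
    + 4 * ((1 + \<epsilon>) * \<kappa>)\<^sup>2 / c / min (c / 2) (4 * \<epsilon>) * (SUP s\<in>{0..}. norm (u s))\<^sup>2"
proof -
  define S where "S = (SUP s\<in>{0..}. norm (u s))"
  define r where "r = min (c / 2) (4 * \<epsilon>)"
  define K where "K = 4 * ((1 + \<epsilon>) * \<kappa>)\<^sup>2 / c * S\<^sup>2"
  have r: "r > 0" using c \<epsilon>(1) by (simp add: r_def)
  have K: "K \<ge> 0" using c by (simp add: K_def)
  have xX: "\<And>s. s \<ge> 0 \<Longrightarrow> x s \<in> X" using mild by (simp add: mild_solution_def)
  have uL: "\<And>s. s \<ge> 0 \<Longrightarrow> u s \<in> L2_on l" using u by (simp add: PC_def)
  have bdd: "bdd_above ((\<lambda>s. norm (u s)) ` {0..})"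
  proof -
    have "bounded (u ` {0..})" using u by (simp add: PC_def)
    then obtain B where "\<And>y. y \<in> u ` {0..} \<Longrightarrow> norm y \<le> B" by (auto simp: bounded_iff)
    then show ?thesis by (auto simp: bdd_above_def)
  qed
  have uS: "norm (u s) \<le> S" if "s \<ge> 0" for s unfolding S_def by (rule cSUP_upper[OF _ bdd]) (use that in simp)
  have ev_X: "\<forall>\<^sub>F s in at s0 within {0..}. x s \<in> X" for s0
    using xX by (auto simp: eventually_at_filter)
  have J_N: "((\<lambda>s. J (x s)) \<longlongrightarrow> J (x s0)) (at s0 within {0..}) \<longleftrightarrow> ((\<lambda>s. N (x s - x s0)) \<longlongrightarrow> 0) (at s0 within {0..})"
    if "s0 \<ge> 0" for s0
    by (rule J_tendsto[OF ev_X xX[OF that]])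
  have Nlim: "((\<lambda>s. N (x s - x s0)) \<longlongrightarrow> 0) (at s0 within {0..})" if s0: "s0 \<ge> 0" for s0
  proof -
    have "((\<lambda>s. N (x s - x s0)) \<longlongrightarrow> 0) (at s0 within {0..s0 + 1})"
      using mild s0 unfolding mild_solution_def by auto
    \<comment> \<open>Continuity is given on compact intervals; being local, it holds on the
      half-line as well.\<close>
    moreover have "at s0 within {0..s0 + 1} = at s0 within {0..}"
      by (rule at_within_nhd[of _ "{..<s0 + 1}"]) auto
    ultimately show ?thesis by (simp only:)
  qed
  then have Jcont: "continuous_on {0..} (\<lambda>s. J (x s))" by (simp add: continuous_on_def J_N)
  have Nright: "((\<lambda>s. N (x s - x s0)) \<longlongrightarrow> 0) (at_right s0)" if s0: "s0 \<ge> 0" for s0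
    by (rule tendsto_within_subset[OF Nlim[OF s0]]) (use s0 in auto)
  \<comment> \<open>The two integrals are merged so that \<open>mild_step\<close> sees a single
    forcing term.\<close>
  have full: "\<exists>y. has_integral_norm X N (\<lambda>s. T (t - s) (\<F> (x s) + \<B> (u s))) y 0 t \<and> x t = T t x0 + y"
    if t: "t \<ge> 0" for t
  proof -
    obtain y z where y: "has_integral_norm X N (\<lambda>s. T (t - s) (\<F> (x s))) y 0 t"
      and z: "has_integral_norm X N (\<lambda>s. T (t - s) (\<B> (u s))) z 0 t" and xt: "x t = T t x0 + y + z"
      using mild t unfolding mild_solution_def by blast
    have "has_integral_norm X N (\<lambda>s. T (t - s) (\<F> (x s)) + T (t - s) (\<B> (u s))) (y + z) 0 t"
      by (rule has_integral_norm_add[OF _ _ y z]) (auto intro!: T_in op_F_X op_B_X xX uL)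
    moreover have "y + z \<in> X" using y z by (auto simp: has_integral_norm_def)
    ultimately have "((\<lambda>s. J (T (t - s) (\<F> (x s)) + T (t - s) (\<B> (u s)))) has_integral J (y + z)) {0..t}"
      by (subst (asm) has_integral_norm_iff) (auto intro!: T_in op_F_X op_B_X xX uL V_simps(2))
    then have "((\<lambda>s. J (T (t - s) (\<F> (x s) + \<B> (u s)))) has_integral J (y + z)) {0..t}"
      by (rule has_integral_eq[rotated]) (auto simp: T_add op_F_X op_B_X xX uL)
    then have "has_integral_norm X N (\<lambda>s. T (t - s) (\<F> (x s) + \<B> (u s))) (y + z) 0 t"
      using \<open>y + z \<in> X\<close> by (subst has_integral_norm_iff) (auto intro!: T_in op_F_X op_B_X xX uL V_simps(2))
    then show ?thesis using xt by (intro exI[of _ "y + z"]) (simp add: add.assoc)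
  qed
  \<comment> \<open>\<open>mild_solution\<close> states no initial condition separately; it is read
    off the integral equation at time 0.\<close>
  have x_0: "x 0 = x0"
  proof -
    obtain y where y: "has_integral_norm X N (\<lambda>s. T (0 - s) (\<F> (x s) + \<B> (u s))) y 0 0" "x 0 = T 0 x0 + y"
      using full[of 0] by auto
    have yX: "y \<in> X" using y(1) by (simp add: has_integral_norm_def)
    have "((\<lambda>s. J (T (0 - s) (\<F> (x s) + \<B> (u s)))) has_integral J y) {0..0}"
      using y(1) yX by (subst (asm) has_integral_norm_iff) (auto intro!: T_in op_F_X op_B_X xX uL V_simps(2))
    then have "J y = 0" unfolding atLeastAtMost_singleton by (rule has_integral_unique[OF _ has_integral_refl(2)])
    then have "y = 0" using N_eq_0[OF yX] N_J[OF yX] by simp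
    then show ?thesis using y(2) x0 by (simp add: T_0)
  qed
  have cont: "continuous_on {0..} (\<lambda>s. lyapunov (x s))"
    unfolding lyapunov_def
  proof (intro continuous_intros)
    show "continuous_on {0..} (\<lambda>s. q (x s) (x s))" by (rule q_continuous[OF _ Jcont]) (simp add: xX)
    show "continuous_on {0..} (\<lambda>s. quartic (fst (x s)))"
      unfolding continuous_on_def quartic_def
    proof (intro ballI tendsto_inner)
      fix s0 :: real assume "s0 \<in> {0..}"
      then have s0: "s0 \<ge> 0" by simp
      have ev: "\<forall>\<^sub>F s in at s0 within {0..}. s \<ge> 0" by (simp add: eventually_at_filter)
      show fst: "((\<lambda>s. fst (x s)) \<longlongrightarrow> fst (x s0)) (at s0 within {0..})"
      proof (rule LIM_zero_cancel, rule Lim_null_comparison)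
        show "\<forall>\<^sub>F s in at s0 within {0..}. norm (fst (x s) - fst (x s0)) \<le> \<kappa> * N (x s - x s0)"
          using ev by eventually_elim (use norm_le_N(2)[of "x _ - x s0"] xX s0 in force)
        have "((\<lambda>s. \<kappa> * N (x s - x s0)) \<longlongrightarrow> \<kappa> * 0) (at s0 within {0..})" by (intro tendsto_intros Nlim s0)
        then show "((\<lambda>s. \<kappa> * N (x s - x s0)) \<longlongrightarrow> 0) (at s0 within {0..})" by simp
      qed
      define M where "M = m * (N (x s0) + 1)"
      have "\<forall>\<^sub>F s in at s0 within {0..}. N (x s - x s0) < 1" by (rule order_tendstoD(2)[OF Nlim[OF s0]]) simp
      with ev have "\<forall>\<^sub>F s in at s0 within {0..}. norm (cube (fst (x s)) - cube (fst (x s0))) \<le> 3 * M\<^sup>2 * norm (fst (x s) - fst (x s0))"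
      proof eventually_elim
        case (elim s)
        have "N (x s) \<le> N (x s0) + 1"
          using N_add[OF xX[OF s0] V_simps(3)[OF xX[OF elim(1)] xX[OF s0]]] elim by simp
        then show ?case unfolding M_def by (intro cube_lipschitz ess_le_N xX s0 elim) auto
      qed
      moreover have "((\<lambda>s. 3 * M\<^sup>2 * norm (fst (x s) - fst (x s0))) \<longlongrightarrow> 3 * M\<^sup>2 * norm (fst (x s0) - fst (x s0))) (at s0 within {0..})"
        by (intro tendsto_intros fst)
      then have "((\<lambda>s. 3 * M\<^sup>2 * norm (fst (x s) - fst (x s0))) \<longlongrightarrow> 0) (at s0 within {0..})" by simp
      ultimately show "((\<lambda>s. cube (fst (x s))) \<longlongrightarrow> cube (fst (x s0))) (at s0 within {0..})"
        by (rule LIM_zero_cancel[OF Lim_null_comparison])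
    qed
  qed
  have dini: "\<forall>\<^sub>F h in at_right 0. lyapunov (x (s + h)) \<le> lyapunov (x s) + h * (K - r * lyapunov (x s) + \<eta>)"
    if s: "s \<ge> 0" and \<eta>: "\<eta> > 0" for s \<eta>
  proof -
    \<comment> \<open>The right limit of the input still lies in the closed set
      \<open>L2_on l\<close> and obeys the bound \<open>S\<close>.\<close>
    obtain up where up: "(u \<longlongrightarrow> up) (at_right s)" using u s by (auto simp: PC_def)
    have ev: "\<forall>\<^sub>F \<sigma> in at_right s. \<sigma> \<ge> 0"
      using eventually_at_right_less[of s] by eventually_elim (use s in simp)
    have upL: "up \<in> L2_on l"
      by (rule Lim_in_closed_set[OF closed_L2_on _ _ up]) (use ev in eventually_elim, auto simp: uL)
    have upS: "norm up \<le> S"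
      by (rule tendsto_upperbound[OF tendsto_norm[OF up]]) (use ev in eventually_elim, auto simp: uS)
    define p where "p = \<F> (x s) + \<B> up"
    have p: "p \<in> X" unfolding p_def by (intro V_simps(2) op_F_X op_B_X xX s upL)
    have p0: "fst p = 0" by (simp add: p_def op_F_eq op_B_def)
    have yX: "x (s + h) \<in> X" if "h > 0" for h using xX[of "s + h"] that s by simp
    have step: "((\<lambda>h. N ((1 / h) *\<^sub>R (x (s + h) - T h (x s)) - p)) \<longlongrightarrow> 0) (at_right 0)"
    proof (rule mild_step[OF x0 _ p full _ s])
      show "0 \<le> \<sigma> \<Longrightarrow> \<F> (x \<sigma>) + \<B> (u \<sigma>) \<in> X" for \<sigma>
        by (intro V_simps(2) op_F_X op_B_X xX uL)
      show "((\<lambda>\<sigma>. N (\<F> (x \<sigma>) + \<B> (u \<sigma>) - p)) \<longlongrightarrow> 0) (at_right s)"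
        unfolding p_def by (rule forcing_continuous[OF xX uL upL Nright[OF s] up s])
    qed
    have Nb: "\<forall>\<^sub>F h in at_right 0. N (x (s + h)) \<le> N (x s) + 1"
    proof -
      have "\<forall>\<^sub>F \<sigma> in at_right s. N (x \<sigma> - x s) < 1" by (rule order_tendstoD(2)[OF Nright[OF s]]) simp
      with ev have "\<forall>\<^sub>F \<sigma> in at_right s. N (x \<sigma>) \<le> N (x s) + 1"
      proof eventually_elim
        case (elim \<sigma>)
        then show ?case using N_add[OF xX[OF s] V_simps(3)[OF xX[OF elim(1)] xX[OF s]]] by simp
      qed
      then show ?thesis by (subst (asm) at_right_to_0) (simp add: eventually_filtermap add.commute)
    qed
    \<comment> \<open>The tolerance is split evenly: \<eta> / 2 for q, and \<eta> / \<alpha> for the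
      quartic integral, which is multiplied by \<alpha> / 2.\<close>
    have \<eta>': "\<eta> / 2 > 0" "\<eta> / \<alpha> > 0" using \<eta> pos(7) by auto
    have Q: "\<forall>\<^sub>F h in at_right 0. q (x (s + h)) (x (s + h)) \<le> q (x s) (x s) + h * (- c * q (x s) (x s) + 2 * q (x s) p + \<eta> / 2)"
      by (rule q_mild_step[OF c(2)[OF xX[OF s]] c(1) q_nonneg[OF xX[OF s]] xX[OF s] p yX step \<eta>'(1)])
    have P: "\<forall>\<^sub>F h in at_right 0. quartic (fst (x (s + h))) \<le> quartic (fst (x s)) + h * (4 * inner (cube (fst (x s))) (snd (x s)) + \<eta> / \<alpha>)"
      by (rule quartic_first_order[OF xX[OF s] yX fst_right_derivative[OF xX[OF s] yX p p0 step] Nb \<eta>'(2)])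
    have "\<forall>\<^sub>F h in at_right (0::real). h > 0" by (simp add: eventually_at_right_less)
    with Q P show ?thesis
    proof eventually_elim
      case (elim h)
      have "\<alpha> / 2 * quartic (fst (x (s + h))) \<le> \<alpha> / 2 * (quartic (fst (x s)) + h * (4 * inner (cube (fst (x s))) (snd (x s)) + \<eta> / \<alpha>))"
        using elim(2) pos(7) by (intro mult_left_mono) auto
      also have "\<dots> = \<alpha> / 2 * quartic (fst (x s)) + h * (\<alpha> / 2 * (4 * inner (cube (fst (x s))) (snd (x s))) + \<eta> / 2)"
        using pos(7) by (simp add: algebra_simps)
      finally have "lyapunov (x (s + h)) \<le> lyapunov (x s) + h * ((- c * q (x s) (x s) + 2 * q (x s) p
          + \<alpha> / 2 * (4 * inner (cube (fst (x s))) (snd (x s)))) + \<eta>)"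
        using elim(1) unfolding lyapunov_def by (simp add: algebra_simps)
      also have "\<dots> \<le> lyapunov (x s) + h * (K - r * lyapunov (x s) + \<eta>)"
        using lyapunov_decay[OF c(1) xX[OF s] upS] elim(3) unfolding p_def K_def r_def
        by (intro add_left_mono mult_left_mono add_right_mono) auto
      finally show ?case .
    qed
  qed
  have "lyapunov (x t) \<le> exp (- r * t) * (lyapunov (x 0) - K / r) + K / r"
    by (rule dini_exponential_bound[where g="\<lambda>s. lyapunov (x s)", OF cont r dini t])
  also have "\<dots> \<le> exp (- r * t) * lyapunov x0 + K / r"
  proof -
    have "0 \<le> exp (- r * t) * (K / r)" using K r by simp
    then show ?thesis by (simp add: x_0 right_diff_distrib)
  qed
  finally show ?thesis by (simp add: K_def r_def S_def)
qed

end

section \<open>Comparison functions\<close>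

lemma exp_quadratic_class_KL:
  fixes a b r :: real
  assumes "a > 0" "b \<ge> 0" "r > 0"
  shows "(\<lambda>x t. exp (- r * t) * (a * x + b * x\<^sup>2)) \<in> class_KL"
proof -
  have pos: "0 < a * x + b * x\<^sup>2" if "x > 0" for x using assms that by (simp add: add_pos_nonneg)
  have nonneg: "0 \<le> a * x + b * x\<^sup>2" if "x \<ge> 0" for x using assms that by simp
  have mono: "a * x + b * x\<^sup>2 < a * y + b * y\<^sup>2" if "0 \<le> x" "x < y" for x y
    using assms that by (intro add_less_le_mono mult_strict_left_mono mult_left_mono power_mono) auto
  have K: "(\<lambda>x. exp (- r * t) * (a * x + b * x\<^sup>2)) \<in> class_K" for t
    unfolding class_K_def
    by (auto simp: nonneg mono strict_mono_on_def intro!: continuous_intros mult_strict_left_mono)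
  have L: "(\<lambda>t. exp (- r * t) * (a * x + b * x\<^sup>2)) \<in> class_L" if x: "x > 0" for x
  proof -
    have "LIM t at_top. - r * t :> at_bot"
      using assms(3) by (intro filterlim_tendsto_neg_mult_at_bot[OF tendsto_const _ filterlim_ident]) auto
    then have "((\<lambda>t. exp (- r * t)) \<longlongrightarrow> 0) at_top" by (rule filterlim_compose[OF exp_at_bot])
    then have "((\<lambda>t. exp (- r * t) * (a * x + b * x\<^sup>2)) \<longlongrightarrow> 0 * (a * x + b * x\<^sup>2)) at_top"
      by (intro tendsto_intros)
    then show ?thesis
      unfolding class_L_def using pos[OF x] assms(3)
      by (auto simp: monotone_on_def intro!: continuous_intros mult_strict_right_mono)
  qed
  have "continuous_on ({0..} \<times> {0..}) (\<lambda>(x, t). exp (- r * t) * (a * x + b * x\<^sup>2))"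
    unfolding split_beta by (intro continuous_intros)
  with K L nonneg show ?thesis unfolding class_KL_def by auto
qed

lemma linear_class_K:
  fixes g :: real assumes "g > 0" shows "(\<lambda>s. g * s) \<in> class_K"
  unfolding class_K_def using assms by (auto simp: strict_mono_on_def intro!: continuous_intros)

theorem corollaryV2:
  fixes E I \<rho> a l k \<alpha> \<mu> C\<^sub>d :: real
    and T :: "real \<Rightarrow> L2 \<times> L2 \<Rightarrow> L2 \<times> L2"
  assumes "0 < E" "0 < I" "0 < \<rho>" "0 < a" "0 < l" "0 < k" "0 < \<alpha>" "0 < \<mu>" "0 \<le> C\<^sub>d"
    and "generates (state_space l) (state_norm E I \<rho> a l k)
           (dom_A E I l C\<^sub>d) (op_A E I \<rho> a l k \<mu> C\<^sub>d) T"
  shows "\<exists>\<beta>\<in>class_KL. \<exists>\<gamma>\<in>class_K. \<forall>x0\<in>state_space l. \<forall>u\<in>PC (L2_on l). \<forall>x.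
           mild_solution (state_space l) (state_norm E I \<rho> a l k) T
             (op_F \<rho> a \<alpha>) (op_B \<rho> a) x0 u x \<longrightarrow>
           (\<forall>t>0. state_norm E I \<rho> a l k (x t)
                    \<le> \<beta> (state_norm E I \<rho> a l k x0) t + \<gamma> (SUP s\<in>{0..}. norm (u s)))"
proof -
  interpret railway E I \<rho> a l k \<alpha> \<mu> C\<^sub>d T
    using assms by unfold_locales
  obtain c where c: "c > 0" "\<And>x t. x \<in> X \<Longrightarrow> t \<ge> 0 \<Longrightarrow> q (T t x) (T t x) \<le> exp (- c * t) * q x x"
    by (rule T_rate) blast
  obtain C C' where C: "C > 0" "C' > 0" "\<And>x. x \<in> X \<Longrightarrow> lyapunov x \<le> C * (N x)\<^sup>2 + C' * (N x) ^ 4"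
    by (rule lyapunov_upper) blast
  define r where "r = min (c / 2) (4 * \<epsilon>)"
  define K where "K = 4 * ((1 + \<epsilon>) * \<kappa>)\<^sup>2 / c / r"
  \<comment> \<open>\<open>lyapunov_lower\<close> costs a factor 2, and the final estimate is the
    square root of one for N^2: hence these constants, and the rate r / 2 below.\<close>
  define A B g where "A = sqrt (2 * C)" and "B = sqrt (2 * C')" and "g = sqrt (2 * K)"
  have r: "r > 0" using c(1) \<epsilon>(1) by (simp add: r_def)
  have K: "K > 0" using r c(1) \<epsilon>(1) \<kappa>_pos by (simp add: K_def)
  have ABg: "A > 0" "B > 0" "g > 0" "A\<^sup>2 = 2 * C" "B\<^sup>2 = 2 * C'" "g\<^sup>2 = 2 * K"
    using C K by (auto simp: A_def B_def g_def)
  have main: "N (x t) \<le> exp (- (r / 2) * t) * (A * N x0 + B * (N x0)\<^sup>2) + g * (SUP s\<in>{0..}. norm (u s))"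
    if x0: "x0 \<in> X" and u: "u \<in> PC (L2_on l)"
      and mild: "mild_solution X N T \<F> \<B> x0 u x" and t: "t > 0" for x0 u x t
  proof -
    define S where "S = (SUP s\<in>{0..}. norm (u s))"
    define e where "e = exp (- (r / 2) * t)"
    define n where "n = N x0"
    have n: "n \<ge> 0" using N_nonneg[OF x0] by (simp add: n_def)
    have "bounded (u ` {0..})" using u by (simp add: PC_def)
    then obtain M where "\<And>y. y \<in> u ` {0..} \<Longrightarrow> norm y \<le> M" by (auto simp: bounded_iff)
    then have "bdd_above ((\<lambda>s. norm (u s)) ` {0..})" by (auto simp: bdd_above_def)
    then have "norm (u 0) \<le> S" unfolding S_def by (intro cSUP_upper) auto
    then have S: "S \<ge> 0" using norm_ge_zero order_trans by blast
    have e: "e > 0" "e\<^sup>2 = exp (- r * t)" by (simp_all add: e_def power2_eq_square flip: exp_add)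
    have xt: "x t \<in> X" using mild t by (simp add: mild_solution_def)
    have "(N (x t))\<^sup>2 \<le> 2 * lyapunov (x t)" using lyapunov_lower[OF xt] by simp
    also have "\<dots> \<le> 2 * (exp (- r * t) * lyapunov x0 + K * S\<^sup>2)"
      using mild_solution_estimate[OF c x0 u mild, of t] t by (simp add: r_def K_def S_def)
    also have "\<dots> \<le> 2 * (e\<^sup>2 * (C * n\<^sup>2 + C' * n ^ 4) + K * S\<^sup>2)"
      using C(3)[OF x0] e by (simp add: n_def mult_left_mono)
    also have "\<dots> = e\<^sup>2 * ((A * n)\<^sup>2 + (B * n\<^sup>2)\<^sup>2) + (g * S)\<^sup>2"
    proof -
      have "(A * n)\<^sup>2 = 2 * C * n\<^sup>2" "(B * n\<^sup>2)\<^sup>2 = 2 * C' * n ^ 4" "(g * S)\<^sup>2 = 2 * K * S\<^sup>2"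
        by (simp_all add: power_mult_distrib ABg(4-6) flip: power_mult)
      then show ?thesis by (simp only:) (simp add: algebra_simps)
    qed
    \<comment> \<open>A sum of squares of nonnegative numbers is at most the square of their sum.
      This separates the initial state from the input after the root is taken, and turns n^4 into a
      term quadratic in n.\<close>
    also have "\<dots> \<le> (e * (A * n + B * n\<^sup>2) + g * S)\<^sup>2"
    proof -
      have sq: "x\<^sup>2 + y\<^sup>2 \<le> (x + y)\<^sup>2" if "0 \<le> x" "0 \<le> y" for x y :: real
        using that by (simp add: power2_sum)
      have "e\<^sup>2 * ((A * n)\<^sup>2 + (B * n\<^sup>2)\<^sup>2) \<le> e\<^sup>2 * (A * n + B * n\<^sup>2)\<^sup>2"
        using ABg n by (intro mult_left_mono sq) auto
      also have "\<dots> = (e * (A * n + B * n\<^sup>2))\<^sup>2" by (simp add: power_mult_distrib)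
      finally show ?thesis
        using sq[of "e * (A * n + B * n\<^sup>2)" "g * S"] e ABg n S by simp
    qed
    finally have "N (x t) \<le> e * (A * n + B * n\<^sup>2) + g * S"
      by (rule power2_le_imp_le) (use e ABg n S in simp)
    then show ?thesis by (simp add: e_def n_def S_def)
  qed
  show ?thesis
  proof (intro bexI[where x="\<lambda>x t. exp (- (r / 2) * t) * (A * x + B * x\<^sup>2)"] bexI[where x="\<lambda>s. g * s"] ballI allI impI)
    show "(\<lambda>x t. exp (- (r / 2) * t) * (A * x + B * x\<^sup>2)) \<in> class_KL"
      by (rule exp_quadratic_class_KL) (use ABg r in auto)
    show "(\<lambda>s. g * s) \<in> class_K" by (rule linear_class_K[OF ABg(3)])
  qed (rule main)
qed

end
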